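(* Let $\mathcal A\in\{\mathfrak S,\mathcal B,\mathcal Bs,\mathcal H,\mathcal P\}$. For any integer $N$, let $(M_i^N)_{i\in\mathcal I}$ be a family of random matrices of size $N$. Suppose that $(M_i^N)_{i\in\mathcal I}$ is $\mathcal G(\mathcal A)$-invariant (for every $N$) and converges in $\mathcal A$-distribution. Then it converges in $\mathcal P$-distribution and it is asymptotically $\mathcal G(\mathcal A)$-invariant. Besides, if it satisfies the asymptotic $\mathcal A$-factorization property, then it satisfies the asymptotic $\mathcal P$-factorization property.
   Context: Partitions. For $k\ge 0$, $\mathcal P_k$ is the set of partitions of $\{1,\dots,k,1',\dots,k'\}$, drawn with a top row $1,\dots,k$ and a bottom row $1',\dots,k'$. $\mathrm{nc}(p)$ is the number of blocks of $p$; $p\vee p'$ is the finest partition coarser than both; $\mathrm{id}_k=\{\{i,i'\}\}$; ${}^tp$ is obtained by exchanging $i$ and $i'$ for every $i$; $p\trianglelefteq p'$ means $p'$ is coarser than $p$; $p\otimes p'$ is obtained by putting $p'$ to the right of $p$. A permutation $\sigma\in\mathfrak S_k$ is identified with $\{\{i,\sigma(i)'\}\}\in\mathcal P_k$. $\mathcal B_k$, $\mathcal H_k$, $\mathcal Bs_k$ are the sets of $p\in\mathcal P_k$ whose blocks all have size $2$, all have even size, all have size at most $2$ respectively. Set $d(p,p')=\frac{\mathrm{nc}(p)+\mathrm{nc}(p')}{2}-\mathrm{nc}(p\vee p')$ and $p\le p'$ if $d(\mathrm{id}_k,p)+d(p,p')=d(\mathrm{id}_k,p')$ (a partial order). Representation.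 $E_i^j$ is the $N\times N$ matrix sending $e_j$ to $e_i$ and the other basis vectors to $0$. For $I=(i_1,\dots,i_k,i_{1'},\dots,i_{k'})\in\{1,\dots,N\}^{2k}$, $\mathrm{Ker}(I)\in\mathcal P_k$ is the partition where $a,b$ are in the same block iff $i_a=i_b$; $\rho_N(p)=\sum_{I:\,p\trianglelefteq\mathrm{Ker}(I)}E_{i_{1'}}^{i_1}\otimes\dots\otimes E_{i_{k'}}^{i_k}$. Groups. $\mathcal G(\mathfrak S)(N)=U(N)$, $\mathcal G(\mathcal B)(N)=O(N)$, $\mathcal G(\mathcal H)(N)$ = signed permutation matrices, $\mathcal G(\mathcal Bs)(N)$ = orthogonal matrices whose rows and columns all sum to $1$, $\mathcal G(\mathcal P)(N)$ = permutation matrices. A family of random matrices of size $N$ is $\mathcal G(\mathcal A)$-invariant if for every $g\in\mathcal G(\mathcal A)(N)$, every $k$ and $(i_1,\dots,i_k)$, $(gM_{i_1}g^{-1},\dots,gM_{i_k}g^{-1})$ has the same law as $(M_{i_1},\dots,M_{i_k})$. Random matrices have entries with finite moments of all orders. $\mathbb Em_p(M_1,\dots,M_k)=N^{-\mathrm{nc}(p\vee\mathrm{id}_k)}\mathbb E\,\mathrm{Tr}\big[(M_1\otimes\dots\otimes M_k)\rho_N({}^tp)\big]$. For $\mathcal C\in\{\mathcal A,\mathcal P\}$, $(M_i^N)_{i}$ converges in $\mathcal C$-distribution if $\mathbb Em_p(M_{i_1}^N,\dots,M^N_{i_k})$ converges as $N\to\infty$ for all $k$, $p\in\mathcal C_k$,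 $(i_1,\dots,i_k)\in\mathcal I^k$; the limit is denoted $\mathbb Em_p(M_{i_1},\dots,M_{i_k})$. The asymptotic $\mathcal C$-cumulants are defined by $\mathbb Em_p(M_{i_1},\dots,M_{i_k})=\sum_{p'\in\mathcal C_k,p'\le p}\mathbb E\kappa_{p'}^{\mathcal C}(M_{i_1},\dots,M_{i_k})$ for all $p\in\mathcal C_k$. The asymptotic $\mathcal C$-factorization property means $\mathbb Em_{p_1\otimes p_2}(M_{i_1},\dots,M_{i_{k+l}})=\mathbb Em_{p_1}(M_{i_1},\dots,M_{i_k})\,\mathbb Em_{p_2}(M_{i_{k+1}},\dots,M_{i_{k+l}})$ for all $k,l$, $p_1\in\mathcal C_k$, $p_2\in\mathcal C_l$ and indices. A family converging in $\mathcal P$-distribution is asymptotically $\mathcal G(\mathcal A)$-invariant if for all $k$, $p\in\mathcal P_k$ and indices, $\mathbb E\kappa_p^{\mathcal P}(M_{i_1},\dots,M_{i_k})$ equals $\mathbb E\kappa_p^{\mathcal A}(M_{i_1},\dots,M_{i_k})$ if $p\in\mathcal A_k$ and $0$ otherwise. *)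

theory Defs
  imports "HOL-Probability.Probability" "Jordan_Normal_Form.Schur_Decomposition"
begin

section \<open>Partitions\<close>

text \<open>The point \<open>i\<close> of the top row is encoded as \<open>Inl (i - 1)\<close> and the point \<open>i'\<close> of the bottom
  row as \<open>Inr (i - 1)\<close>; similarly the basis of the \<open>N\<close>-dimensional space is indexed from \<open>0\<close>.\<close>

type_synonym part = "(nat + nat) set set"

definition points :: "nat \<Rightarrow> (nat + nat) set" where
  "points k = {..<k} <+> {..<k}"

definition partitions :: "nat \<Rightarrow> part set" where
  "partitions k = {p. partition_on (points k) p}"

definition nc :: "part \<Rightarrow> nat" where
  "nc p = card p"

definition coarser :: "nat \<Rightarrow> part \<Rightarrow> part \<Rightarrow> bool" where
  "coarser k p q \<longleftrightarrow> refines (points k) p q"  \<comment> \<open>\<open>q\<close> is coarser than \<open>p\<close>\<close>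

definition join :: "nat \<Rightarrow> part \<Rightarrow> part \<Rightarrow> part" where
  "join k p q = (THE r. r \<in> partitions k \<and> coarser k p r \<and> coarser k q r \<and>
     (\<forall>s\<in>partitions k. coarser k p s \<and> coarser k q s \<longrightarrow> coarser k r s))"

definition perm_part :: "nat \<Rightarrow> (nat \<Rightarrow> nat) \<Rightarrow> part" where
  "perm_part k \<sigma> = (\<lambda>i. {Inl i, Inr (\<sigma> i)}) ` {..<k}"

definition id_part :: "nat \<Rightarrow> part" where
  "id_part k = (\<lambda>i. {Inl i, Inr i}) ` {..<k}"

definition transpose_part :: "part \<Rightarrow> part" where
  "transpose_part p = (\<lambda>B. case_sum Inr Inl ` B) ` p"

text \<open>\<open>k\<close> is the size of the left factor \<open>p\<close>.\<close>

definition tensor_part :: "nat \<Rightarrow> part \<Rightarrow> part \<Rightarrow> part" where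
  "tensor_part k p q = p \<union> (\<lambda>B. map_sum (\<lambda>i. k + i) (\<lambda>i. k + i) ` B) ` q"

definition part_dist :: "nat \<Rightarrow> part \<Rightarrow> part \<Rightarrow> real" where
  "part_dist k p q = (real (nc p) + real (nc q)) / 2 - real (nc (join k p q))"

definition geodesic_le :: "nat \<Rightarrow> part \<Rightarrow> part \<Rightarrow> bool" where
  "geodesic_le k p q \<longleftrightarrow>
     part_dist k (id_part k) p + part_dist k p q = part_dist k (id_part k) q"

text \<open>The classes \<open>\<SS>\<close>, \<open>\<B>\<close>, \<open>\<B>s\<close>, \<open>\<H>\<close>, \<open>\<P>\<close>, in this order.\<close>

datatype part_class = ClassS | ClassB | ClassBs | ClassH | ClassP

fun parts :: "part_class \<Rightarrow> nat \<Rightarrow> part set" where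
  "parts ClassS k = {perm_part k \<sigma> |\<sigma>. \<sigma> permutes {..<k}}"
| "parts ClassB k = {p \<in> partitions k. \<forall>B\<in>p. card B = 2}"
| "parts ClassBs k = {p \<in> partitions k. \<forall>B\<in>p. card B \<le> 2}"
| "parts ClassH k = {p \<in> partitions k. \<forall>B\<in>p. even (card B)}"
| "parts ClassP k = partitions k"


section \<open>Tensor representation of partitions\<close>

definition mtrace :: "complex mat \<Rightarrow> complex" where
  "mtrace A = (\<Sum>i<dim_row A. A $$ (i, i))"

definition kron :: "complex mat \<Rightarrow> complex mat \<Rightarrow> complex mat" where
  "kron A B = Matrix.mat (dim_row A * dim_row B) (dim_col A * dim_col B)
     (\<lambda>(r, c). A $$ (r div dim_row B, c div dim_col B) * B $$ (r mod dim_row B, c mod dim_col B))"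

definition kron_list :: "complex mat list \<Rightarrow> complex mat" where
  "kron_list As = foldr kron As (1\<^sub>m 1)"

definition elem_mat :: "nat \<Rightarrow> nat \<Rightarrow> nat \<Rightarrow> complex mat" where
  "elem_mat N i j = Matrix.mat N N (\<lambda>(a, b). if a = i \<and> b = j then 1 else 0)"

definition Ker :: "nat \<Rightarrow> (nat + nat \<Rightarrow> nat) \<Rightarrow> part" where
  "Ker k I = (\<lambda>a. {b \<in> points k. I b = I a}) ` points k"

text \<open>Matrices of unspecified size do not form an additive monoid, so the sum of matrices is
  written entrywise.\<close>

definition rho :: "nat \<Rightarrow> nat \<Rightarrow> part \<Rightarrow> complex mat" where
  "rho N k p = Matrix.mat (N ^ k) (N ^ k) (\<lambda>rc.
     \<Sum>I\<in>{I \<in> points k \<rightarrow>\<^sub>E {..<N}. coarser k p (Ker k I)}.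
       kron_list (map (\<lambda>l. elem_mat N (I (Inr l)) (I (Inl l))) [0..<k]) $$ rc)"


section \<open>Matrix groups\<close>

definition unitary_group :: "nat \<Rightarrow> complex mat set" where
  "unitary_group N =
     {g \<in> carrier_mat N N. g * mat_adjoint g = 1\<^sub>m N \<and> mat_adjoint g * g = 1\<^sub>m N}"

definition orthogonal_group :: "nat \<Rightarrow> complex mat set" where
  "orthogonal_group N = {g \<in> carrier_mat N N. elements_mat g \<subseteq> \<real> \<and>
     g * transpose_mat g = 1\<^sub>m N \<and> transpose_mat g * g = 1\<^sub>m N}"

fun matrix_group :: "part_class \<Rightarrow> nat \<Rightarrow> complex mat set" where
  "matrix_group ClassS N = unitary_group N"
| "matrix_group ClassB N = orthogonal_group N"
| "matrix_group ClassBs N = {g \<in> orthogonal_group N.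
     (\<forall>a<N. (\<Sum>b<N. g $$ (a, b)) = 1) \<and> (\<forall>b<N. (\<Sum>a<N. g $$ (a, b)) = 1)}"
| "matrix_group ClassH N = {Matrix.mat N N (\<lambda>(a, b). if a = \<sigma> b then \<epsilon> b else 0) |\<sigma> \<epsilon>.
     \<sigma> permutes {..<N} \<and> (\<forall>b<N. \<epsilon> b \<in> {1, - 1})}"
| "matrix_group ClassP N = {Matrix.mat N N (\<lambda>(a, b). if a = \<sigma> b then 1 else 0) |\<sigma>.
     \<sigma> permutes {..<N}}"


section \<open>Random matrices\<close>

definition random_matrix :: "'w measure \<Rightarrow> nat \<Rightarrow> ('w \<Rightarrow> complex mat) \<Rightarrow> bool" where
  "random_matrix \<Omega> N X \<longleftrightarrow> (\<forall>\<omega>\<in>space \<Omega>. X \<omega> \<in> carrier_mat N N) \<and>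
     (\<forall>a<N. \<forall>b<N. (\<lambda>\<omega>. X \<omega> $$ (a, b)) \<in> borel_measurable \<Omega> \<and>
        (\<forall>n::nat. integrable \<Omega> (\<lambda>\<omega>. norm (X \<omega> $$ (a, b)) ^ n)))"

text \<open>The law of a tuple of matrices, as the joint law of all the entries: the coordinate
  \<open>(l, a, b)\<close> is the entry \<open>(a, b)\<close> of the \<open>l\<close>-th matrix.\<close>

definition joint_law ::
    "'w measure \<Rightarrow> nat \<Rightarrow> ('w \<Rightarrow> complex mat) list \<Rightarrow> (nat \<times> nat \<times> nat \<Rightarrow> complex) measure" where
  "joint_law \<Omega> N Xs = (let S = {..<length Xs} \<times> {..<N} \<times> {..<N} in
     distr \<Omega> (PiM S (\<lambda>_. borel)) (\<lambda>\<omega>. restrict (\<lambda>(l, a, b). (Xs ! l) \<omega> $$ (a, b)) S))"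

text \<open>\<open>h\<close> is the inverse of \<open>g\<close>.\<close>

definition group_invariant ::
    "part_class \<Rightarrow> 'w measure \<Rightarrow> nat \<Rightarrow> 'i set \<Rightarrow> ('i \<Rightarrow> 'w \<Rightarrow> complex mat) \<Rightarrow> bool" where
  "group_invariant A \<Omega> N J X \<longleftrightarrow>
     (\<forall>g\<in>matrix_group A N. \<forall>h\<in>carrier_mat N N. inverts_mat g h \<and> inverts_mat h g \<longrightarrow>
        (\<forall>js\<in>lists J.
           joint_law \<Omega> N (map (\<lambda>j \<omega>. g * X j \<omega> * h) js) = joint_law \<Omega> N (map X js)))"

definition moment :: "'w measure \<Rightarrow> nat \<Rightarrow> part \<Rightarrow> ('w \<Rightarrow> complex mat) list \<Rightarrow> complex" where
  "moment \<Omega> N p Xs = (let k = length Xs in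
     (\<integral>\<omega>. mtrace (kron_list (map (\<lambda>X. X \<omega>) Xs) * rho N k (transpose_part p)) \<partial>\<Omega>)
       / of_nat N ^ nc (join k p (id_part k)))"


section \<open>Asymptotics\<close>

text \<open>Below, \<open>X N j\<close> is the matrix of size \<open>N\<close> with index \<open>j \<in> J\<close>, defined on the probability
  space \<open>\<Omega> N\<close>.\<close>

definition converges_in_distribution ::
    "part_class \<Rightarrow> (nat \<Rightarrow> 'w measure) \<Rightarrow> 'i set \<Rightarrow> (nat \<Rightarrow> 'i \<Rightarrow> 'w \<Rightarrow> complex mat) \<Rightarrow> bool" where
  "converges_in_distribution C \<Omega> J X \<longleftrightarrow>
     (\<forall>js\<in>lists J. \<forall>p\<in>parts C (length js). convergent (\<lambda>N. moment (\<Omega> N) N p (map (X N) js)))"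

definition limit_moment ::
    "(nat \<Rightarrow> 'w measure) \<Rightarrow> (nat \<Rightarrow> 'i \<Rightarrow> 'w \<Rightarrow> complex mat) \<Rightarrow> part \<Rightarrow> 'i list \<Rightarrow> complex" where
  "limit_moment \<Omega> X p js = lim (\<lambda>N. moment (\<Omega> N) N p (map (X N) js))"

text \<open>The cumulants \<open>p \<mapsto> cumulant C \<Omega> X p js\<close>, for \<open>p\<close> in \<open>parts C (length js)\<close>, are the solution
  of a linear system which is unitriangular because \<open>geodesic_le\<close> is a partial order;
  extensionality only fixes the irrelevant values outside \<open>parts C (length js)\<close>.\<close>

definition cumulant ::
    "part_class \<Rightarrow> (nat \<Rightarrow> 'w measure) \<Rightarrow> (nat \<Rightarrow> 'i \<Rightarrow> 'w \<Rightarrow> complex mat) \<Rightarrow> part \<Rightarrow> 'i list \<Rightarrow> complex" where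
  "cumulant C \<Omega> X p js = (let k = length js in
     (THE \<kappa>. \<kappa> \<in> extensional (parts C k) \<and>
        (\<forall>q\<in>parts C k. limit_moment \<Omega> X q js = (\<Sum>r\<in>{r \<in> parts C k. geodesic_le k r q}. \<kappa> r))) p)"

definition factorization_property ::
    "part_class \<Rightarrow> (nat \<Rightarrow> 'w measure) \<Rightarrow> 'i set \<Rightarrow> (nat \<Rightarrow> 'i \<Rightarrow> 'w \<Rightarrow> complex mat) \<Rightarrow> bool" where
  "factorization_property C \<Omega> J X \<longleftrightarrow>
     (\<forall>is\<in>lists J. \<forall>js\<in>lists J. \<forall>p\<in>parts C (length is). \<forall>q\<in>parts C (length js).
        limit_moment \<Omega> X (tensor_part (length is) p q) (is @ js) =
          limit_moment \<Omega> X p is * limit_moment \<Omega> X q js)"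

definition asymptotically_invariant ::
    "part_class \<Rightarrow> (nat \<Rightarrow> 'w measure) \<Rightarrow> 'i set \<Rightarrow> (nat \<Rightarrow> 'i \<Rightarrow> 'w \<Rightarrow> complex mat) \<Rightarrow> bool" where
  "asymptotically_invariant A \<Omega> J X \<longleftrightarrow> converges_in_distribution ClassP \<Omega> J X \<and>
     (\<forall>js\<in>lists J. \<forall>p\<in>partitions (length js).
        cumulant ClassP \<Omega> X p js =
          (if p \<in> parts A (length js) then cumulant A \<Omega> X p js else 0))"

end

theory Submission
  imports Defs
begin

text \<open>The expectation of \<open>M\<^sub>1 \<otimes> \<dots> \<otimes> M\<^sub>k\<close> is a tensor fixed by the group, and duality says that such a
  tensor is a combination \<open>\<Sum> c\<^sub>q \<rho>(q)\<close> over the partitions \<open>q\<close> of the class \<open>\<A>\<close>. Pairing it with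
  \<open>\<rho>(p)\<close> expresses every moment, for \<open>p\<close> in \<open>\<P>\<close>, by the finitely many unknowns \<open>c\<^sub>q\<close>. After the rescaling
  \<open>\<kappa>\<^sub>q = c\<^sub>q N\<^bsup>nc(q) - nc(q \<or> id)\<^esup>\<close> the coefficients of this linear system are
  \<open>N\<^bsup>d(id, p) - d(id, q) - d(q, p)\<^esup>\<close>. The triangle inequality for \<open>d\<close> bounds them, and in the limit they
  become the indicator of \<open>q \<le> p\<close>, which is unitriangular in \<open>p, q\<close> over \<open>\<A>\<close>. So convergence of the
  moments over \<open>\<A>\<close> forces convergence of the \<open>\<kappa>\<^sub>q\<close>, hence of all moments, with limit the sum of
  \<open>\<kappa>\<^sub>q\<close> over the \<open>q \<le> p\<close> in \<open>\<A>\<close> (theorem \<open>moments_tendsto_cumulant_sums\<close>). Uniqueness of cumulants then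
  says that the \<open>\<P>\<close>-cumulants are the \<open>\<A>\<close>-cumulants on \<open>\<A>\<close> and zero elsewhere. The factorization property
  passes from moments to cumulants and back because everything below \<open>p \<otimes> p'\<close> is itself a tensor
  product, of something below \<open>p\<close> and something below \<open>p'\<close> (lemma \<open>bij_betw_tensor_ideal\<close>).

  The duality (theorem \<open>invariant_tensor_spanned\<close>) is proved for \<open>N \<ge> 2k + 3\<close> at once for all five groups.
  All of them contain the permutation matrices, so an entry of an invariant tensor depends only on
  the kernel of its index. Subtracting a combination of \<open>\<rho>(q)\<close> with \<open>q\<close> in \<open>\<A>\<close> removes the entries whose
  kernel lies in \<open>\<A>\<close>, and what remains is zero: a diagonal matrix with a single phase kills the kernels
  with a bad small block, and for \<open>\<SS>\<close>, \<open>\<B>\<close> and \<open>\<B>s\<close> one reflection, which fixes the vector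
  \<open>(1, \<dots>, 1)\<close> and so belongs to all three groups, kills the kernels with a block of three or more
  points.

  Partitions are handled through their colourings, the functions that are constant on blocks: joins
  become intersections of sets of colourings, block numbers become cardinalities, and the triangle
  inequality for \<open>d\<close> is a statement about subgroups of a finite group.\<close>

section \<open>Partitions seen through their colourings\<close>

definition blockwise_const :: "'a set set \<Rightarrow> ('a \<Rightarrow> 'b) \<Rightarrow> bool" where
  "blockwise_const p I \<longleftrightarrow> (\<forall>B\<in>p. \<forall>x\<in>B. \<forall>y\<in>B. I x = I y)"

text \<open>With the colours \<open>{..<N}\<close> these are the multi-indices \<open>I\<close> with \<open>p \<unlhd> Ker I\<close> that enter \<open>\<rho>\<^sub>N(p)\<close>; two
  colours suffice to recover \<open>p\<close> and its number of blocks.\<close>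

definition colourings :: "nat \<Rightarrow> 'b set \<Rightarrow> part \<Rightarrow> (nat + nat \<Rightarrow> 'b) set" where
  "colourings k Y p = {I \<in> points k \<rightarrow>\<^sub>E Y. blockwise_const p I}"

lemma blockwise_constD: "blockwise_const p I \<Longrightarrow> B \<in> p \<Longrightarrow> x \<in> B \<Longrightarrow> y \<in> B \<Longrightarrow> I x = I y"
  unfolding blockwise_const_def by blast

lemma blockwise_const_comp: "blockwise_const p I \<Longrightarrow> blockwise_const p (\<lambda>x. f (I x))"
  unfolding blockwise_const_def by (intro ballI arg_cong[of _ _ f]) blast

lemma blockwise_const_comp2:
  assumes "blockwise_const p I" "blockwise_const p J"
  shows "blockwise_const p (\<lambda>x. f (I x) (J x))"
  unfolding blockwise_const_def
proof (intro ballI)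
  fix B x y assume "B \<in> p" "x \<in> B" "y \<in> B"
  then show "f (I x) (J x) = f (I y) (J y)"
    using blockwise_constD[OF assms(1), of B x y] blockwise_constD[OF assms(2), of B x y] by simp
qed

lemma finite_points [simp]: "finite (points k)"
  by (simp add: points_def)

lemma Inl_in_points [simp]: "Inl i \<in> points k \<longleftrightarrow> i < k"
  and Inr_in_points [simp]: "Inr i \<in> points k \<longleftrightarrow> i < k"
  by (auto simp: points_def)

lemma card_points: "card (points k) = 2 * k"
  by (simp add: points_def card_Plus)

lemma finite_partitions [simp]: "finite (partitions k)"
  by (simp add: partitions_def finitely_many_partition_on)

lemma partitionsD:
  assumes "p \<in> partitions k"
  shows "\<Union>p = points k" "finite p" "{} \<notin> p"
    "\<And>B C x. B \<in> p \<Longrightarrow> C \<in> p \<Longrightarrow> x \<in> B \<Longrightarrow> x \<in> C \<Longrightarrow> B = C"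
  using assms finite_elements[of "points k" p]
  by (auto simp: partitions_def partition_on_def disjoint_def)

lemma partitions_blockD:
  assumes "p \<in> partitions k" "B \<in> p"
  shows "B \<subseteq> points k" "finite B" "B \<noteq> {}"
proof -
  show "B \<subseteq> points k" using partitionsD(1)[OF assms(1)] assms(2) by blast
  then show "finite B" by (rule finite_subset) simp
  show "B \<noteq> {}" using partitionsD(3)[OF assms(1)] assms(2) by blast
qed

lemma blockwise_const_cong:
  assumes p: "p \<in> partitions k" and IJ: "\<And>x. x \<in> points k \<Longrightarrow> I x = J x"
  shows "blockwise_const p I \<longleftrightarrow> blockwise_const p J"
proof -
  have "I x = J x" if "B \<in> p" "x \<in> B" for x B
    using IJ partitions_blockD(1)[OF p that(1)] that(2) by blast
  then show ?thesis by (simp add: blockwise_const_def)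
qed

definition block :: "part \<Rightarrow> nat + nat \<Rightarrow> (nat + nat) set" where
  "block p x = (THE B. B \<in> p \<and> x \<in> B)"

lemma block_eq:
  assumes "p \<in> partitions k" "B \<in> p" "x \<in> B"
  shows "block p x = B"
  unfolding block_def
proof (rule the_equality)
  fix C assume "C \<in> p \<and> x \<in> C"
  then show "C = B" using partitionsD(4)[OF assms(1) _ assms(2) _ assms(3)] by blast
qed (use assms in simp)

lemma block_in:
  assumes "p \<in> partitions k" "x \<in> points k"
  shows "block p x \<in> p" "x \<in> block p x"
proof -
  obtain B where "B \<in> p" "x \<in> B" using assms(2) partitionsD(1)[OF assms(1)] by blast
  then show "block p x \<in> p" "x \<in> block p x" by (simp_all add: block_eq[OF assms(1)])
qed

lemma bij_betw_colourings:
  assumes p: "p \<in> partitions k"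
  shows "bij_betw (\<lambda>J. \<lambda>x\<in>points k. J (block p x)) (p \<rightarrow>\<^sub>E Y) (colourings k Y p)"
proof (rule bij_betw_byWitness[where f' = "\<lambda>I. \<lambda>B\<in>p. I (SOME x. x \<in> B)"])
  have some: "(SOME x. x \<in> B) \<in> B" if "B \<in> p" for B
    using partitions_blockD(3)[OF p that] by (simp add: some_in_eq)
  have some': "(SOME x. x \<in> B) \<in> points k" if "B \<in> p" for B
    using some[OF that] partitions_blockD(1)[OF p that] by blast
  show "\<forall>J\<in>p \<rightarrow>\<^sub>E Y. (\<lambda>B\<in>p. (\<lambda>x\<in>points k. J (block p x)) (SOME x. x \<in> B)) = J"
  proof
    fix J assume J: "J \<in> p \<rightarrow>\<^sub>E Y"
    show "(\<lambda>B\<in>p. (\<lambda>x\<in>points k. J (block p x)) (SOME x. x \<in> B)) = J"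
    proof
      fix B
      show "(\<lambda>B\<in>p. (\<lambda>x\<in>points k. J (block p x)) (SOME x. x \<in> B)) B = J B"
      proof (cases "B \<in> p")
        case True
        then show ?thesis using some[OF True] some'[OF True] block_eq[OF p True] by simp
      next
        case False
        then show ?thesis using PiE_arb[OF J False] by simp
      qed
    qed
  qed
  show "\<forall>I\<in>colourings k Y p. (\<lambda>x\<in>points k. (\<lambda>B\<in>p. I (SOME x. x \<in> B)) (block p x)) = I"
  proof
    fix I assume I: "I \<in> colourings k Y p"
    show "(\<lambda>x\<in>points k. (\<lambda>B\<in>p. I (SOME x. x \<in> B)) (block p x)) = I"
    proof
      fix x
      show "(\<lambda>x\<in>points k. (\<lambda>B\<in>p. I (SOME x. x \<in> B)) (block p x)) x = I x"
      proof (cases "x \<in> points k")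
        case True
        have "I (SOME y. y \<in> block p x) = I x"
          by (rule blockwise_constD[OF _ block_in(1)[OF p True] some[OF block_in(1)[OF p True]]
            block_in(2)[OF p True]]) (use I in \<open>simp add: colourings_def\<close>)
        then show ?thesis using True block_in[OF p True] by simp
      next
        case False
        moreover have "I \<in> points k \<rightarrow>\<^sub>E Y" using I by (simp add: colourings_def)
        ultimately show ?thesis using PiE_arb[of I "points k" "\<lambda>_. Y" x] by simp
      qed
    qed
  qed
  show "(\<lambda>J. \<lambda>x\<in>points k. J (block p x)) ` (p \<rightarrow>\<^sub>E Y) \<subseteq> colourings k Y p"
  proof clarify
    fix J assume J: "J \<in> p \<rightarrow>\<^sub>E Y"
    have "(\<lambda>x\<in>points k. J (block p x)) \<in> points k \<rightarrow>\<^sub>E Y"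
      using J block_in[OF p] by auto
    moreover have "blockwise_const p (\<lambda>x\<in>points k. J (block p x))"
      unfolding blockwise_const_def
    proof (intro ballI)
      fix B x y assume B: "B \<in> p" "x \<in> B" "y \<in> B"
      then have "x \<in> points k" "y \<in> points k" using partitions_blockD(1)[OF p B(1)] by auto
      then show "(\<lambda>x\<in>points k. J (block p x)) x = (\<lambda>x\<in>points k. J (block p x)) y"
        using B by (simp add: block_eq[OF p B(1)])
    qed
    ultimately show "(\<lambda>x\<in>points k. J (block p x)) \<in> colourings k Y p"
      by (simp add: colourings_def)
  qed
  show "(\<lambda>I. \<lambda>B\<in>p. I (SOME x. x \<in> B)) ` colourings k Y p \<subseteq> p \<rightarrow>\<^sub>E Y"
    using some' by (auto simp: colourings_def)
qed

lemma finite_colourings: "finite Y \<Longrightarrow> finite (colourings k Y p)"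
  by (simp add: colourings_def finite_PiE)

lemma card_colourings:
  assumes "p \<in> partitions k"
  shows "card (colourings k Y p) = card Y ^ nc p"
  using bij_betw_same_card[OF bij_betw_colourings[OF assms, of Y]]
    card_PiE[OF partitionsD(2)[OF assms], of "\<lambda>_. Y"]
  by (simp add: nc_def)

lemma coarser_partitions: "coarser k p q \<Longrightarrow> p \<in> partitions k \<and> q \<in> partitions k"
  by (simp add: coarser_def refines_def partitions_def)

lemma coarser_blocksI:
  assumes "p \<in> partitions k" "q \<in> partitions k" "\<And>B. B \<in> p \<Longrightarrow> \<exists>C\<in>q. B \<subseteq> C"
  shows "coarser k p q"
  unfolding coarser_def refines_def
proof (intro conjI ballI)
  show "partition_on (points k) p" "partition_on (points k) q"
    using assms(1,2) by (simp_all add: partitions_def)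
qed (rule assms(3))

lemma coarser_const:
  assumes pq: "coarser k p q" and I: "blockwise_const q I"
  shows "blockwise_const p I"
  unfolding blockwise_const_def
proof (intro ballI)
  fix B x y assume B: "B \<in> p" "x \<in> B" "y \<in> B"
  obtain C where "C \<in> q" "B \<subseteq> C" using pq B(1) unfolding coarser_def refines_def by blast
  then show "I x = I y" using blockwise_constD[OF I, of C x y] B by blast
qed

text \<open>The indicator of a block of \<open>q\<close> is a colouring that detects whether a block of \<open>p\<close> leaves it.\<close>

lemma coarserI:
  assumes p: "p \<in> partitions k" and q: "q \<in> partitions k"
    and sub: "colourings k (UNIV :: bool set) q \<subseteq> colourings k UNIV p"
  shows "coarser k p q"
proof -
  have "\<exists>C\<in>q. B \<subseteq> C" if B: "B \<in> p" for B
  proof -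
    obtain x where x: "x \<in> B" using partitions_blockD(3)[OF p B] by blast
    have xp: "x \<in> points k" using x partitions_blockD(1)[OF p B] by blast
    let ?C = "block q x"
    have C: "?C \<in> q" "x \<in> ?C" using block_in[OF q xp] .
    let ?I = "\<lambda>y\<in>points k. y \<in> ?C"
    have "blockwise_const q ?I"
      unfolding blockwise_const_def
    proof (intro ballI)
      fix B x y assume B: "B \<in> q" "x \<in> B" "y \<in> B"
      then have "x \<in> points k" "y \<in> points k" using partitions_blockD(1)[OF q B(1)] by auto
      then show "?I x = ?I y" using B C partitionsD(4)[OF q] by (metis restrict_apply')
    qed
    then have "?I \<in> colourings k UNIV q" by (simp add: colourings_def)
    then have "?I \<in> colourings k UNIV p" using sub by blast
    then have bp: "blockwise_const p ?I" by (simp add: colourings_def)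
    have "?I y = ?I x" if "y \<in> B" for y by (rule blockwise_constD[OF bp B that x])
    then have "y \<in> ?C" if "y \<in> B" for y
      using that xp C(2) partitions_blockD(1)[OF p B] by (metis restrict_apply' subsetD)
    then have "B \<subseteq> ?C" by blast
    then show ?thesis using C by blast
  qed
  then show ?thesis by (rule coarser_blocksI[OF p q])
qed

lemma coarser_refl: "p \<in> partitions k \<Longrightarrow> coarser k p p"
  unfolding coarser_def by (rule refines_refl) (simp add: partitions_def)

lemma coarser_antisym: "coarser k p q \<Longrightarrow> coarser k q p \<Longrightarrow> p = q"
  unfolding coarser_def by (rule refines_asym)

lemma coarser_colourings:
  assumes "coarser k p q"
  shows "colourings k Y q \<subseteq> colourings k Y p"
  unfolding colourings_def using coarser_const[OF assms] by blast

lemma two_power_nc: "p \<in> partitions k \<Longrightarrow> card (colourings k (UNIV :: bool set) p) = 2 ^ nc p"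
  by (simp add: card_colourings)

lemma coarser_nc_le:
  assumes "coarser k p q"
  shows "nc q \<le> nc p"
proof -
  have "(2::nat) ^ nc q \<le> 2 ^ nc p"
    using card_mono[OF finite_colourings coarser_colourings[OF assms, of "UNIV :: bool set"]]
      coarser_partitions[OF assms] by (simp add: two_power_nc)
  then show ?thesis by simp
qed

lemma coarser_nc_eq:
  assumes "coarser k p q" and "nc p \<le> nc q"
  shows "p = q"
proof -
  have p: "p \<in> partitions k" and q: "q \<in> partitions k" using coarser_partitions[OF assms(1)] by auto
  have "nc p = nc q" using coarser_nc_le[OF assms(1)] assms(2) by simp
  then have "colourings k (UNIV :: bool set) q = colourings k UNIV p"
    using p q by (intro card_subset_eq finite_colourings coarser_colourings[OF assms(1)])
      (auto simp: two_power_nc)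
  then have "coarser k q p" using p q by (intro coarserI) auto
  then show ?thesis by (rule coarser_antisym[OF assms(1)])
qed

lemma Ker_partitions: "Ker k I \<in> partitions k"
  by (auto simp: Ker_def partitions_def partition_on_def disjoint_def)

lemma coarser_Ker_iff:
  assumes p: "p \<in> partitions k"
  shows "coarser k p (Ker k I) \<longleftrightarrow> blockwise_const p I"
proof
  assume c: "coarser k p (Ker k I)"
  have "blockwise_const (Ker k I) I" by (auto simp: blockwise_const_def Ker_def)
  then show "blockwise_const p I" by (rule coarser_const[OF c])
next
  assume bc: "blockwise_const p I"
  have "\<exists>C\<in>Ker k I. B \<subseteq> C" if B: "B \<in> p" for B
  proof -
    obtain x where x: "x \<in> B" using partitions_blockD(3)[OF p B] by blast
    have sub: "B \<subseteq> points k" using partitions_blockD(1)[OF p B] .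
    have "B \<subseteq> {b \<in> points k. I b = I x}" using sub blockwise_constD[OF bc B _ x] by blast
    then show ?thesis using x sub by (auto simp: Ker_def)
  qed
  then show "coarser k p (Ker k I)" by (rule coarser_blocksI[OF p Ker_partitions])
qed

text \<open>Two points lie in the same block of the join when no colouring compatible with both
  partitions separates them; this relation is visibly an equivalence, which spares the
  construction of chains of blocks.\<close>

lemma join_exists:
  assumes p: "p \<in> partitions k" and q: "q \<in> partitions k"
  shows "\<exists>r\<in>partitions k. \<forall>s\<in>partitions k. coarser k r s \<longleftrightarrow> coarser k p s \<and> coarser k q s"
proof -
  define K where "K = {I :: nat + nat \<Rightarrow> bool. blockwise_const p I \<and> blockwise_const q I}"
  define R where "R = {(x, y). x \<in> points k \<and> y \<in> points k \<and> {I \<in> K. I x} = {I \<in> K. I y}}"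
  define r where "r = points k // R"
  have R: "equiv (points k) R"
    by (rule equivI) (auto simp: R_def refl_on_def sym_def trans_def)
  have r: "r \<in> partitions k"
    unfolding r_def partitions_def using partition_on_quotient[OF R] by simp
  have const: "blockwise_const r I" if "I \<in> K" for I
    unfolding blockwise_const_def
  proof (intro ballI)
    fix B x y assume "B \<in> r" "x \<in> B" "y \<in> B"
    then have "(x, y) \<in> R" unfolding r_def by (metis R quotient_eq_iff)
    then have "I \<in> {I \<in> K. I x} \<longleftrightarrow> I \<in> {I \<in> K. I y}" by (simp add: R_def)
    then show "I x = I y" using that by simp
  qed
  have "coarser k r s \<longleftrightarrow> coarser k p s \<and> coarser k q s" if s: "s \<in> partitions k" for s
  proof
    assume rs: "coarser k r s"
    have "coarser k t r" if t: "t \<in> partitions k" "\<And>I. I \<in> K \<Longrightarrow> blockwise_const t I" for t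
    proof -
      have "\<exists>C\<in>r. B \<subseteq> C" if B: "B \<in> t" for B
      proof -
        obtain x where x: "x \<in> B" using partitions_blockD(3)[OF t(1) B] by blast
        have sub: "B \<subseteq> points k" using partitions_blockD(1)[OF t(1) B] .
        have "B \<subseteq> R `` {x}"
        proof
          fix y assume y: "y \<in> B"
          have "{I \<in> K. I x} = {I \<in> K. I y}" using blockwise_constD[OF t(2) B x y] by blast
          then show "y \<in> R `` {x}" using x y sub by (simp add: R_def subset_iff)
        qed
        moreover have "R `` {x} \<in> r" using x sub by (auto simp: r_def intro: quotientI)
        ultimately show ?thesis by blast
      qed
      then show ?thesis by (rule coarser_blocksI[OF t(1) r])
    qed
    then have "coarser k p r" "coarser k q r" using p q by (auto simp: K_def)
    then show "coarser k p s \<and> coarser k q s"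
      using rs unfolding coarser_def by (meson refines_trans)
  next
    assume ps: "coarser k p s \<and> coarser k q s"
    show "coarser k r s"
    proof (rule coarserI[OF r s], rule subsetI)
      fix I assume "I \<in> colourings k (UNIV :: bool set) s"
      then have I: "I \<in> points k \<rightarrow>\<^sub>E UNIV" "blockwise_const s I" by (auto simp: colourings_def)
      then have "I \<in> K"
        using coarser_const[OF conjunct1[OF ps] I(2)] coarser_const[OF conjunct2[OF ps] I(2)]
        by (simp add: K_def)
      then show "I \<in> colourings k UNIV r" using I const by (simp add: colourings_def)
    qed
  qed
  then show ?thesis using r by blast
qed

lemma join_partitions:
  assumes p: "p \<in> partitions k" and q: "q \<in> partitions k"
  shows "join k p q \<in> partitions k"
    and "s \<in> partitions k \<Longrightarrow> coarser k (join k p q) s \<longleftrightarrow> coarser k p s \<and> coarser k q s"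
proof -
  obtain r where r: "r \<in> partitions k"
    and least: "\<And>s. s \<in> partitions k \<Longrightarrow> coarser k r s \<longleftrightarrow> coarser k p s \<and> coarser k q s"
    using join_exists[OF p q] by blast
  have "join k p q = r"
    unfolding join_def
  proof (rule the_equality)
    show "r \<in> partitions k \<and> coarser k p r \<and> coarser k q r \<and>
      (\<forall>s\<in>partitions k. coarser k p s \<and> coarser k q s \<longrightarrow> coarser k r s)"
      using r least[OF r] least coarser_refl[OF r] by simp
    fix r' assume r': "r' \<in> partitions k \<and> coarser k p r' \<and> coarser k q r' \<and>
      (\<forall>s\<in>partitions k. coarser k p s \<and> coarser k q s \<longrightarrow> coarser k r' s)"
    have "coarser k r r'" "coarser k r' r" using least[of r'] r' least[OF r] r coarser_refl[OF r] by simp_all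
    then show "r' = r" by (rule coarser_antisym[rotated])
  qed
  then show "join k p q \<in> partitions k"
    "s \<in> partitions k \<Longrightarrow> coarser k (join k p q) s \<longleftrightarrow> coarser k p s \<and> coarser k q s"
    using r least by simp_all
qed

lemma blockwise_const_indicators:
  "blockwise_const p I \<longleftrightarrow> (\<forall>c. blockwise_const p (\<lambda>x. of_bool (I x = c) :: nat))"
proof
  assume R: "\<forall>c. blockwise_const p (\<lambda>x. of_bool (I x = c) :: nat)"
  show "blockwise_const p I"
    unfolding blockwise_const_def
  proof (intro ballI)
    fix B x y assume "B \<in> p" "x \<in> B" "y \<in> B"
    then have "(of_bool (I x = I y) :: nat) = of_bool (I y = I y)"
      using blockwise_constD[OF R[rule_format, of "I y"]] by blast
    then show "I x = I y" by (auto simp: of_bool_def split: if_splits)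
  qed
qed (auto intro: blockwise_const_comp)

lemma blockwise_const_join:
  assumes p: "p \<in> partitions k" and q: "q \<in> partitions k"
  shows "blockwise_const (join k p q) I \<longleftrightarrow> blockwise_const p I \<and> blockwise_const q I"
proof -
  have "blockwise_const (join k p q) J \<longleftrightarrow> blockwise_const p J \<and> blockwise_const q J"
    for J :: "nat + nat \<Rightarrow> nat"
    using join_partitions(2)[OF assms Ker_partitions, of J]
    by (simp add: coarser_Ker_iff[OF p] coarser_Ker_iff[OF q]
        coarser_Ker_iff[OF join_partitions(1)[OF assms]])
  then show ?thesis by (subst (1 2 3) blockwise_const_indicators) blast
qed

lemma colourings_join:
  assumes "p \<in> partitions k" "q \<in> partitions k"
  shows "colourings k Y (join k p q) = colourings k Y p \<inter> colourings k Y q"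
  by (auto simp: colourings_def blockwise_const_join[OF assms])

lemma join_commute:
  assumes "p \<in> partitions k" "q \<in> partitions k"
  shows "join k p q = join k q p"
  by (intro coarser_antisym[of k] coarserI join_partitions assms) (auto simp: colourings_join assms)

lemma join_idem:
  assumes "p \<in> partitions k"
  shows "join k p p = p"
  by (intro coarser_antisym[of k] coarserI join_partitions assms) (auto simp: colourings_join assms)

lemma coarser_join:
  assumes "p \<in> partitions k" "q \<in> partitions k"
  shows "coarser k p (join k p q)" "coarser k q (join k p q)"
  using join_partitions(2)[OF assms join_partitions(1)[OF assms]]
    coarser_refl[OF join_partitions(1)[OF assms]] by simp_all

section \<open>The geodesic order\<close>

text \<open>Two-colourings form an abelian group under pointwise addition mod 2, in which the colourings of
  \<open>p \<or> q\<close> and of \<open>q \<or> r\<close> are two subgroups of the colourings of \<open>q\<close>. The bound is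
  \<open>|U| |W| \<le> |U + W| |U \<inter> W|\<close> for these subgroups.\<close>

lemma nc_join_submodular:
  assumes p: "p \<in> partitions k" and q: "q \<in> partitions k" and r: "r \<in> partitions k"
  shows "2 ^ nc (join k p q) * 2 ^ nc (join k q r)
    \<le> 2 ^ nc q * card (colourings k (UNIV :: bool set) p \<inter> colourings k UNIV q \<inter> colourings k UNIV r)"
proof -
  let ?C = "colourings k (UNIV :: bool set)"
  define add where "add = (\<lambda>(I :: nat + nat \<Rightarrow> bool) J. \<lambda>x\<in>points k. I x \<noteq> J x)"
  have closed: "add I J \<in> ?C s" if "s \<in> partitions k" "I \<in> ?C s" "J \<in> ?C s" for s I J
  proof -
    have "blockwise_const s (\<lambda>x. I x \<noteq> J x)"
      by (rule blockwise_const_comp2) (use that(2,3) in \<open>simp_all add: colourings_def\<close>)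
    then have "blockwise_const s (add I J)"
      using blockwise_const_cong[OF that(1), of "add I J" "\<lambda>x. I x \<noteq> J x"] by (simp add: add_def)
    then show ?thesis by (simp add: colourings_def add_def)
  qed
  have ext: "I \<in> extensional (points k)" if "I \<in> ?C s" for I s
    using that by (auto simp: colourings_def PiE_def)
  have cancel: "add I (add I J) = J" if "J \<in> extensional (points k)" for I J
    using that by (auto simp: add_def fun_eq_iff extensional_def)
  have swap: "add I J = add J I" for I J by (auto simp: add_def fun_eq_iff)
  let ?U = "?C p \<inter> ?C q" and ?W = "?C q \<inter> ?C r" and ?V = "?C p \<inter> ?C q \<inter> ?C r"
  \<comment> \<open>a fixed first component in each fibre of the addition map; the other points of the fibre differ
    from it by an element of the intersection\<close>
  define rep where "rep = (\<lambda>z. SOME u. u \<in> ?U \<and> (\<exists>w\<in>?W. z = add u w))"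
  define F where "F = (\<lambda>(u, w). (add u w, add u (rep (add u w))))"
  have rep: "rep (add u w) \<in> ?U \<and> (\<exists>w'\<in>?W. add u w = add (rep (add u w)) w')"
    if "u \<in> ?U" "w \<in> ?W" for u w
  proof -
    have "\<exists>u'. u' \<in> ?U \<and> (\<exists>w'\<in>?W. add u w = add u' w')" using that by blast
    then show ?thesis unfolding rep_def by (rule someI_ex)
  qed
  have "inj_on F (?U \<times> ?W)"
  proof (rule inj_onI, clarify)
    fix u w u' w' assume u: "u \<in> ?C p" "u \<in> ?C q" "u' \<in> ?C p" "u' \<in> ?C q"
      and w: "w \<in> ?C q" "w \<in> ?C r" "w' \<in> ?C q" "w' \<in> ?C r"
      and eq: "F (u, w) = F (u', w')"
    have z: "add u w = add u' w'" using eq by (simp add: F_def)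
    then have "add u (rep (add u w)) = add u' (rep (add u w))" using eq by (simp add: F_def)
    then have "u = u'" using cancel[OF ext[OF u(1)]] cancel[OF ext[OF u(3)]] swap by metis
    moreover from this have "w = w'"
      using z cancel[OF ext[OF w(1)]] cancel[OF ext[OF w(3)]] by metis
    ultimately show "u = u' \<and> w = w'" by simp
  qed
  moreover have "F ` (?U \<times> ?W) \<subseteq> ?C q \<times> ?V"
  proof clarify
    fix u w a b assume F: "(a, b) = F (u, w)" and u: "u \<in> ?C p" "u \<in> ?C q" and w: "w \<in> ?C q" "w \<in> ?C r"
    define u0 where "u0 = rep (add u w)"
    obtain w0 where u0: "u0 \<in> ?U" and w0: "w0 \<in> ?W" and z: "add u w = add u0 w0"
      using rep[of u w] u w unfolding u0_def by blast
    have "add u u0 = add w w0"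
    proof
      fix x show "add u u0 x = add w w0 x"
        using fun_cong[OF z, of x] by (cases "x \<in> points k") (auto simp: add_def)
    qed
    then have "add u u0 \<in> ?V"
      using closed[OF p u(1), of u0] closed[OF q u(2), of u0] closed[OF r w(2), of w0] u0 w0
      by auto
    then show "a \<in> ?C q \<and> b \<in> ?V"
      using F closed[OF q u(2) w(1)] by (simp add: F_def u0_def)
  qed
  ultimately have "card (?U \<times> ?W) \<le> card (?C q \<times> ?V)"
    by (rule card_inj_on_le) (simp add: finite_colourings)
  then show ?thesis
    using two_power_nc[OF join_partitions(1)[OF p q]] two_power_nc[OF join_partitions(1)[OF q r]]
    by (simp add: card_cartesian_product colourings_join p q r two_power_nc)
qed

text \<open>The triangle inequality for \<open>d\<close>, freed of the halves.\<close>

lemma nc_join_triangle: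
  assumes "p \<in> partitions k" "q \<in> partitions k" "r \<in> partitions k"
  shows "nc (join k p q) + nc (join k q r) \<le> nc q + nc (join k p r)"
proof -
  have "card (colourings k (UNIV :: bool set) p \<inter> colourings k UNIV q \<inter> colourings k UNIV r)
    \<le> card (colourings k (UNIV :: bool set) (join k p r))"
    using assms by (intro card_mono finite_colourings) (auto simp: colourings_join)
  then have "(2::nat) ^ nc (join k p q) * 2 ^ nc (join k q r) \<le> 2 ^ nc q * 2 ^ nc (join k p r)"
    using nc_join_submodular[OF assms] two_power_nc[OF join_partitions(1)[OF assms(1,3)]]
    by (metis (no_types, lifting) le_trans mult_le_mono2)
  then show ?thesis by (simp flip: power_add)
qed

lemma id_part_partitions: "id_part k \<in> partitions k"
  by (auto simp: id_part_def partitions_def partition_on_def disjoint_def points_def)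

lemma part_dist_pos:
  assumes p: "p \<in> partitions k" and q: "q \<in> partitions k" and ne: "p \<noteq> q"
  shows "0 < part_dist k p q"
proof -
  note c = coarser_join[OF p q]
  have le: "nc (join k p q) \<le> nc p" "nc (join k p q) \<le> nc q" using c[THEN coarser_nc_le] by simp_all
  have "\<not> (nc p \<le> nc (join k p q) \<and> nc q \<le> nc (join k p q))"
    using coarser_nc_eq[OF c(1)] coarser_nc_eq[OF c(2)] ne by auto
  then show ?thesis using le by (auto simp: part_dist_def field_simps)
qed

lemma geodesic_le_refl: "p \<in> partitions k \<Longrightarrow> geodesic_le k p p"
  by (simp add: geodesic_le_def part_dist_def join_idem)

text \<open>The distance to the identity is a strict rank function for the geodesic order, so that the
  moment-cumulant relation is unitriangular.\<close>

lemma geodesic_le_rank: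
  assumes "p \<in> partitions k" "q \<in> partitions k" "geodesic_le k p q" "p \<noteq> q"
  shows "part_dist k (id_part k) p < part_dist k (id_part k) q"
  using part_dist_pos[OF assms(1,2,4)] assms(3) by (simp add: geodesic_le_def)

lemma geodesic_le_iff_nc:
  assumes p: "p \<in> partitions k" and q: "q \<in> partitions k"
  shows "geodesic_le k p q \<longleftrightarrow>
    nc (join k p q) + nc (join k p (id_part k)) = nc (join k q (id_part k)) + nc p"
  using join_commute[OF p id_part_partitions] join_commute[OF q id_part_partitions]
  by (auto simp: geodesic_le_def part_dist_def field_simps)

lemma nc_join_id_le:
  assumes p: "p \<in> partitions k" and q: "q \<in> partitions k"
  shows "nc (join k p q) + nc (join k p (id_part k)) \<le> nc (join k q (id_part k)) + nc p"
  using nc_join_triangle[OF q p id_part_partitions] join_commute[OF p q] by simp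

text \<open>Equality in the triangle inequality forces \<open>id \<or> p \<or> q = id \<or> q\<close>, so that a partition below
  \<open>q\<close> refines the join of \<open>q\<close> with the identity.\<close>

lemma geodesic_le_coarser:
  assumes p: "p \<in> partitions k" and q: "q \<in> partitions k" and le: "geodesic_le k p q"
  shows "coarser k p (join k q (id_part k))"
proof -
  let ?C = "colourings k (UNIV :: bool set)" and ?id = "id_part k"
  note id = id_part_partitions[of k]
  have "(2::nat) ^ nc p * 2 ^ nc (join k q ?id) = 2 ^ nc (join k q p) * 2 ^ nc (join k p ?id)"
    using le[unfolded geodesic_le_iff_nc[OF p q]] join_commute[OF p q]
    by (simp add: add_ac flip: power_add)
  also have "\<dots> \<le> 2 ^ nc p * card (?C q \<inter> ?C p \<inter> ?C ?id)" by (rule nc_join_submodular[OF q p id])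
  finally have "2 ^ nc (join k q ?id) \<le> card (?C q \<inter> ?C p \<inter> ?C ?id)" by simp
  moreover have "card (?C q \<inter> ?C ?id) = 2 ^ nc (join k q ?id)"
    using two_power_nc[OF join_partitions(1)[OF q id]] by (simp add: colourings_join q id)
  ultimately have "?C q \<inter> ?C p \<inter> ?C ?id = ?C q \<inter> ?C ?id"
    by (intro card_seteq) (auto intro!: finite_colourings)
  then have "?C (join k q ?id) \<subseteq> ?C p" using q id by (auto simp: colourings_join)
  then show ?thesis using p q id by (intro coarserI join_partitions)
qed

section \<open>Tensor products of partitions\<close>

abbreviation shift :: "nat \<Rightarrow> nat + nat \<Rightarrow> nat + nat" where
  "shift k \<equiv> map_sum (\<lambda>i. k + i) (\<lambda>i. k + i)"

lemma inj_shift: "inj (shift k)"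
  by (rule sum.inj_map) (auto simp: inj_on_def)

lemma shift_notin_points [simp]: "shift k x \<notin> points k"
  by (cases x) auto

lemma shift_in_points [simp]: "shift k x \<in> points (k + l) \<longleftrightarrow> x \<in> points l"
  by (cases x) auto

lemma points_add: "points (k + l) = points k \<union> shift k ` points l"
proof (intro equalityI subsetI)
  fix x assume x: "x \<in> points (k + l)"
  show "x \<in> points k \<union> shift k ` points l"
  proof (cases x)
    case (Inl i)
    then show ?thesis using x by (cases "i < k") (auto intro!: image_eqI[of _ _ "Inl (i - k)"])
  next
    case (Inr i)
    then show ?thesis using x by (cases "i < k") (auto intro!: image_eqI[of _ _ "Inr (i - k)"])
  qed
next
  fix x assume "x \<in> points k \<union> shift k ` points l"
  then show "x \<in> points (k + l)" by (elim UnE imageE) (auto simp: points_def)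
qed

lemma tensor_partitions:
  assumes p: "p \<in> partitions k" and q: "q \<in> partitions l"
  shows "tensor_part k p q \<in> partitions (k + l)"
proof -
  have "partition_on (points k \<union> shift k ` points l) (p \<union> (`) (shift k) ` q)"
    unfolding partition_on_def
  proof (intro conjI)
    show "\<Union>(p \<union> (`) (shift k) ` q) = points k \<union> shift k ` points l"
      by (simp add: partitionsD(1)[OF p] partitionsD(1)[OF q] flip: image_Union)
    show "{} \<notin> p \<union> (`) (shift k) ` q"
      using partitionsD(3)[OF p] partitionsD(3)[OF q] by auto
    have pq: "disjnt B (shift k ` C)" "disjnt (shift k ` C) B" if "B \<in> p" for B C
      using partitions_blockD(1)[OF p that] shift_notin_points by (auto simp: disjnt_iff)
    have pp: "disjnt B C" if "B \<in> p" "C \<in> p" "B \<noteq> C" for B C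
      using partitionsD(4)[OF p that(1,2)] that(3) by (auto simp: disjnt_iff)
    have qq: "disjnt (shift k ` B) (shift k ` C)"
      if "B \<in> q" "C \<in> q" "shift k ` B \<noteq> shift k ` C" for B C
    proof -
      have "B \<noteq> C" using that(3) by blast
      then have "disjnt B C" using partitionsD(4)[OF q that(1,2)] by (auto simp: disjnt_iff)
      then show ?thesis
        using image_Int[OF inj_shift, of k B C] by (simp add: disjnt_def)
    qed
    show "disjoint (p \<union> (`) (shift k) ` q)"
    proof (rule pairwiseI)
      fix B C assume "B \<in> p \<union> (`) (shift k) ` q" "C \<in> p \<union> (`) (shift k) ` q" "B \<noteq> C"
      then show "disjnt B C" by (elim UnE imageE) (simp_all add: pp pq qq)
    qed
  qed
  then show ?thesis by (simp add: partitions_def tensor_part_def points_add)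
qed

lemma blockwise_const_tensor:
  "blockwise_const (tensor_part k p q) I \<longleftrightarrow> blockwise_const p I \<and> blockwise_const q (I \<circ> shift k)"
  by (simp add: blockwise_const_def tensor_part_def ball_Un)

text \<open>Two colours separate partitions, so identities between joins can be read off from their colourings.\<close>

lemma partition_eqI:
  assumes "p \<in> partitions k" "q \<in> partitions k"
    and "\<And>I :: nat + nat \<Rightarrow> bool. blockwise_const p I \<longleftrightarrow> blockwise_const q I"
  shows "p = q"
  by (rule coarser_antisym[of k]; rule coarserI) (use assms in \<open>simp_all add: colourings_def\<close>)

lemma join_tensor:
  assumes "p \<in> partitions k" "p' \<in> partitions k" "q \<in> partitions l" "q' \<in> partitions l"
  shows "join (k + l) (tensor_part k p q) (tensor_part k p' q')
    = tensor_part k (join k p p') (join l q q')"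
proof (rule partition_eqI[of _ "k + l"])
  show "join (k + l) (tensor_part k p q) (tensor_part k p' q') \<in> partitions (k + l)"
    "tensor_part k (join k p p') (join l q q') \<in> partitions (k + l)"
    using assms by (auto intro!: join_partitions tensor_partitions)
  fix I :: "nat + nat \<Rightarrow> bool"
  show "blockwise_const (join (k + l) (tensor_part k p q) (tensor_part k p' q')) I
    \<longleftrightarrow> blockwise_const (tensor_part k (join k p p') (join l q q')) I"
    unfolding blockwise_const_tensor
      blockwise_const_join[OF tensor_partitions[OF assms(1,3)] tensor_partitions[OF assms(2,4)]]
      blockwise_const_join[OF assms(1,2)] blockwise_const_join[OF assms(3,4)]
    by blast
qed

lemma nc_tensor:
  assumes p: "p \<in> partitions k" and q: "q \<in> partitions l"
  shows "nc (tensor_part k p q) = nc p + nc q"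
proof -
  have "p \<inter> (`) (shift k) ` q = {}"
  proof (rule ccontr)
    assume "p \<inter> (`) (shift k) ` q \<noteq> {}"
    then obtain B where B: "B \<in> q" "shift k ` B \<in> p" by auto
    then have "B = {}" using partitions_blockD(1)[OF p B(2)] shift_notin_points by blast
    then show False using B(1) partitionsD(3)[OF q] by simp
  qed
  moreover have "inj_on ((`) (shift k)) q"
    by (rule inj_onI) (simp add: inj_image_eq_iff[OF inj_shift])
  ultimately show ?thesis
    using partitionsD(2)[OF p] partitionsD(2)[OF q]
    by (simp add: nc_def tensor_part_def card_Un_disjoint card_image)
qed

lemma id_part_tensor: "id_part (k + l) = tensor_part k (id_part k) (id_part l)"
proof -
  have "{..<k + l} = {..<k} \<union> (+) k ` {..<l}"
  proof (intro equalityI subsetI)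
    fix x assume "x \<in> {..<k + l}"
    then show "x \<in> {..<k} \<union> (+) k ` {..<l}"
      by (cases "x < k") (auto intro!: image_eqI[of _ _ "x - k"])
  qed auto
  then show ?thesis
    by (simp add: id_part_def tensor_part_def image_Un image_image)
qed

text \<open>The defect in the triangle inequality through the identity is additive and nonnegative, so it
  vanishes for a tensor product only when it vanishes for both factors.\<close>

lemma geodesic_le_tensor_iff:
  assumes p: "p \<in> partitions k" "p' \<in> partitions l" and q: "q \<in> partitions k" "q' \<in> partitions l"
  shows "geodesic_le (k + l) (tensor_part k q q') (tensor_part k p p')
    \<longleftrightarrow> geodesic_le k q p \<and> geodesic_le l q' p'"
proof -
  note id = id_part_partitions[of k] id_part_partitions[of l]
  have "nc (join (k + l) (tensor_part k a a') (tensor_part k b b')) = nc (join k a b) + nc (join l a' b')"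
    if "a \<in> partitions k" "b \<in> partitions k" "a' \<in> partitions l" "b' \<in> partitions l" for a a' b b'
    unfolding join_tensor[OF that]
    by (rule nc_tensor[OF join_partitions(1)[OF that(1,2)] join_partitions(1)[OF that(3,4)]])
  then show ?thesis
    using nc_join_id_le[OF q(1) p(1)] nc_join_id_le[OF q(2) p(2)]
    by (simp add: geodesic_le_iff_nc tensor_partitions p q id id_part_tensor nc_tensor[OF q]) arith
qed

lemma tensor_recover:
  assumes p: "p \<in> partitions k" and q: "q \<in> partitions l"
  shows "{B \<in> tensor_part k p q. B \<subseteq> points k} = p" "{B. shift k ` B \<in> tensor_part k p q} = q"
proof -
  have ne: "\<not> shift k ` B \<subseteq> points k" if "B \<noteq> {}" for B
    using that shift_notin_points by blast
  show "{B \<in> tensor_part k p q. B \<subseteq> points k} = p"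
    using partitions_blockD(1)[OF p] partitions_blockD(3)[OF q] ne by (auto simp: tensor_part_def)
  show "{B. shift k ` B \<in> tensor_part k p q} = q"
  proof (intro equalityI subsetI)
    fix B assume "B \<in> {B. shift k ` B \<in> tensor_part k p q}"
    then consider "shift k ` B \<in> p" | C where "C \<in> q" "shift k ` B = shift k ` C"
      by (auto simp: tensor_part_def)
    then show "B \<in> q"
    proof cases
      case 1
      then show ?thesis
        using ne[of B] partitions_blockD(1)[OF p 1] partitions_blockD(3)[OF p 1] by auto
    next
      case 2
      then show ?thesis using inj_shift by (metis inj_image_eq_iff)
    qed
  qed (auto simp: tensor_part_def)
qed

lemma tensor_inj:
  assumes "p \<in> partitions k" "q \<in> partitions l" "p' \<in> partitions k" "q' \<in> partitions l"
    and "tensor_part k p q = tensor_part k p' q'"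
  shows "p = p'" "q = q'"
  using tensor_recover[OF assms(1,2)] tensor_recover[OF assms(3,4)] assms(5) by simp_all

text \<open>When no block crosses from the left points to the right points, the blocks on either side form the
  two factors.\<close>

lemma tensor_splitI:
  assumes q: "q \<in> partitions (k + l)" and sep: "blockwise_const q (\<lambda>x. x \<in> points k)"
  shows "\<exists>q1\<in>partitions k. \<exists>q2\<in>partitions l. q = tensor_part k q1 q2"
proof -
  define q1 where "q1 = {B \<in> q. B \<subseteq> points k}"
  define q2 where "q2 = {B. shift k ` B \<in> q}"
  have side: "B \<subseteq> points k \<or> (\<exists>C. B = shift k ` C)" if B: "B \<in> q" for B
  proof (cases "B \<subseteq> points k")
    case False
    then obtain x where x: "x \<in> B" "x \<notin> points k" by blast
    then have "y \<notin> points k" if "y \<in> B" for y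
      using blockwise_constD[OF sep B x(1) that] by simp
    then have "B \<subseteq> shift k ` points l"
      using partitions_blockD(1)[OF q B] unfolding points_add by blast
    then show ?thesis by (meson subset_image_iff)
  qed simp
  have left: "block q x \<in> q1" if "x \<in> points k" for x
  proof -
    have x: "x \<in> points (k + l)" using that by (simp add: points_add)
    have "\<not> (\<exists>C. block q x = shift k ` C)"
    proof
      assume "\<exists>C. block q x = shift k ` C"
      then obtain y where "x = shift k y" using block_in(2)[OF q x] by blast
      then show False using that by simp
    qed
    then show ?thesis using side[OF block_in(1)[OF q x]] block_in(1)[OF q x] by (simp add: q1_def)
  qed
  have right: "\<exists>C\<in>q2. x \<in> C" if "x \<in> points l" for x
  proof -
    have x: "shift k x \<in> points (k + l)" using that by simp
    have "\<not> block q (shift k x) \<subseteq> points k"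
      using block_in(2)[OF q x] shift_notin_points by blast
    then obtain C where C: "block q (shift k x) = shift k ` C" using side[OF block_in(1)[OF q x]] by blast
    then have "C \<in> q2" using block_in(1)[OF q x] by (simp add: q2_def)
    moreover have "x \<in> C" using block_in(2)[OF q x] C inj_image_mem_iff[OF inj_shift] by metis
    ultimately show ?thesis by blast
  qed
  have q1: "q1 \<in> partitions k"
    unfolding partitions_def partition_on_def mem_Collect_eq
  proof (intro conjI)
    show "\<Union>q1 = points k"
    proof (intro equalityI subsetI)
      fix x assume "x \<in> points k"
      then show "x \<in> \<Union>q1"
        using left[of x] block_in(2)[OF q, of x] by (auto simp: points_add)
    qed (auto simp: q1_def)
    show "disjoint q1" using partitionsD(4)[OF q] unfolding q1_def disjoint_def by blast
    show "{} \<notin> q1" using partitionsD(3)[OF q] by (simp add: q1_def)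
  qed
  have q2: "q2 \<in> partitions l"
    unfolding partitions_def partition_on_def mem_Collect_eq
  proof (intro conjI)
    show "\<Union>q2 = points l"
    proof (intro equalityI subsetI)
      fix x assume "x \<in> \<Union>q2"
      then obtain B where "shift k ` B \<in> q" "x \<in> B" by (auto simp: q2_def)
      then have "shift k x \<in> points (k + l)" using partitions_blockD(1)[OF q] by blast
      then show "x \<in> points l" by simp
    qed (use right in blast)
    show "disjoint q2"
      unfolding disjoint_def
    proof (intro ballI impI)
      fix B C assume "B \<in> q2" "C \<in> q2" "B \<noteq> C"
      then have B: "shift k ` B \<in> q" "shift k ` C \<in> q" and ne: "shift k ` B \<noteq> shift k ` C"
        using inj_shift by (auto simp: q2_def inj_image_eq_iff)
      show "B \<inter> C = {}"
      proof (rule ccontr)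
        assume "B \<inter> C \<noteq> {}"
        then obtain x where "x \<in> B" "x \<in> C" by blast
        then show False using partitionsD(4)[OF q B, of "shift k x"] ne by simp
      qed
    qed
    show "{} \<notin> q2" using partitionsD(3)[OF q] by (simp add: q2_def)
  qed
  have "q = tensor_part k q1 q2"
  proof (intro equalityI subsetI)
    fix B assume "B \<in> q"
    then show "B \<in> tensor_part k q1 q2" using side[of B] by (auto simp: tensor_part_def q1_def q2_def)
  qed (auto simp: tensor_part_def q1_def q2_def)
  then show ?thesis using q1 q2 by blast
qed

text \<open>The colouring that distinguishes left from right is compatible with the identity and with every
  tensor product, hence with their join and with everything below it.\<close>

lemma geodesic_below_tensor:
  assumes p: "p \<in> partitions k" "p' \<in> partitions l" and q: "q \<in> partitions (k + l)"
    and le: "geodesic_le (k + l) q (tensor_part k p p')"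
  shows "\<exists>q1\<in>partitions k. \<exists>q2\<in>partitions l. q = tensor_part k q1 q2"
proof (rule tensor_splitI[OF q])
  let ?I = "\<lambda>x. x \<in> points k"
  have sep: "blockwise_const (tensor_part k r s) ?I" if r: "r \<in> partitions k" for r s
    unfolding blockwise_const_tensor
  proof
    show "blockwise_const r ?I"
      unfolding blockwise_const_def using partitions_blockD(1)[OF r] by blast
    show "blockwise_const s (?I \<circ> shift k)" by (simp add: blockwise_const_def)
  qed
  note pp = tensor_partitions[OF p]
  have "blockwise_const (join (k + l) (tensor_part k p p') (id_part (k + l))) ?I"
    unfolding blockwise_const_join[OF pp id_part_partitions]
    using sep[OF p(1)] sep[OF id_part_partitions] by (simp add: id_part_tensor)
  then show "blockwise_const q ?I" by (rule coarser_const[OF geodesic_le_coarser[OF q pp le]])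
qed

section \<open>The classes of partitions by their admissible blocks\<close>

fun admissible :: "part_class \<Rightarrow> (nat + nat) set \<Rightarrow> bool" where
  "admissible ClassS B \<longleftrightarrow> card B = 2 \<and> (\<exists>i. Inl i \<in> B) \<and> (\<exists>j. Inr j \<in> B)"
| "admissible ClassB B \<longleftrightarrow> card B = 2"
| "admissible ClassBs B \<longleftrightarrow> card B \<le> 2"
| "admissible ClassH B \<longleftrightarrow> even (card B)"
| "admissible ClassP B \<longleftrightarrow> True"

lemma admissible_ClassS_iff: "admissible ClassS B \<longleftrightarrow> (\<exists>i j. B = {Inl i, Inr j})"
proof
  assume "admissible ClassS B"
  then obtain i j where "card B = 2" "Inl i \<in> B" "Inr j \<in> B" by auto
  moreover from this have "{Inl i, Inr j} = B"
    by (intro card_subset_eq) (auto intro: card_ge_0_finite)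
  ultimately show "\<exists>i j. B = {Inl i, Inr j}" by blast
qed auto

lemma perm_part_partitions:
  assumes "\<sigma> permutes {..<k}"
  shows "perm_part k \<sigma> \<in> partitions k"
  unfolding partitions_def partition_on_def mem_Collect_eq
proof (intro conjI)
  have lt: "\<sigma> i < k" if "i < k" for i using permutes_in_image[OF assms, of i] that by simp
  show "\<Union>(perm_part k \<sigma>) = points k"
  proof (intro equalityI subsetI)
    fix x assume "x \<in> points k"
    then show "x \<in> \<Union>(perm_part k \<sigma>)"
    proof (cases x)
      case (Inr j)
      then have "j \<in> \<sigma> ` {..<k}" using \<open>x \<in> points k\<close> permutes_image[OF assms] by simp
      then show ?thesis using Inr by (auto simp: perm_part_def)
    qed (auto simp: perm_part_def)
  qed (use lt in \<open>auto simp: perm_part_def\<close>)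
  show "disjoint (perm_part k \<sigma>)"
    using permutes_inj[OF assms] by (auto simp: perm_part_def disjoint_def inj_eq)
  show "{} \<notin> perm_part k \<sigma>" by (auto simp: perm_part_def)
qed

text \<open>This brings the definition of \<open>\<SS>\<close> by permutations into the blockwise form of the other four
  classes, so that all five can be treated at once.\<close>

lemma parts_ClassS: "parts ClassS k = {p \<in> partitions k. \<forall>B\<in>p. admissible ClassS B}"
proof (intro equalityI subsetI)
  fix p assume "p \<in> parts ClassS k"
  then obtain \<sigma> where "\<sigma> permutes {..<k}" and p: "p = perm_part k \<sigma>" by auto
  moreover have "\<forall>B\<in>perm_part k \<sigma>. admissible ClassS B"
    unfolding admissible_ClassS_iff perm_part_def by blast
  ultimately show "p \<in> {p \<in> partitions k. \<forall>B\<in>p. admissible ClassS B}"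
    using perm_part_partitions by blast
next
  fix p assume "p \<in> {p \<in> partitions k. \<forall>B\<in>p. admissible ClassS B}"
  then have p: "p \<in> partitions k" and adm: "\<And>B. B \<in> p \<Longrightarrow> \<exists>i j. B = {Inl i, Inr j}"
    unfolding admissible_ClassS_iff by auto
  have "\<exists>j. {Inl i, Inr j} \<in> p" if "i < k" for i
  proof -
    have i: "Inl i \<in> points k" using that by simp
    obtain i' j where "block p (Inl i) = {Inl i', Inr j}" using adm[OF block_in(1)[OF p i]] by blast
    then show ?thesis using block_in[OF p i] by auto
  qed
  then obtain f where f: "\<And>i. i < k \<Longrightarrow> {Inl i, Inr (f i)} \<in> p" by metis
  define \<sigma> where "\<sigma> i = (if i < k then f i else i)" for i
  have inj: "inj_on \<sigma> {..<k}"
  proof (rule inj_onI)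
    fix i i' assume i: "i \<in> {..<k}" "i' \<in> {..<k}" and eq: "\<sigma> i = \<sigma> i'"
    then have "{Inl i, Inr (f i)} = {Inl i', Inr (f i')}"
      by (intro partitionsD(4)[OF p f f, of i i' "Inr (f i)"]) (auto simp: \<sigma>_def)
    then show "i = i'" by (auto simp: doubleton_eq_iff)
  qed
  have "\<sigma> ` {..<k} \<subseteq> {..<k}"
    using partitions_blockD(1)[OF p f] by (auto simp: \<sigma>_def)
  then have "bij_betw \<sigma> {..<k} {..<k}"
    using inj endo_inj_surj[of "{..<k}" \<sigma>] by (simp add: bij_betw_def)
  then have perm: "\<sigma> permutes {..<k}" by (rule bij_imp_permutes) (simp add: \<sigma>_def)
  have "p = perm_part k \<sigma>"
  proof (intro equalityI subsetI)
    fix B assume B: "B \<in> p"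
    obtain i j where ij: "B = {Inl i, Inr j}" using adm[OF B] by blast
    then have i: "i < k" using partitions_blockD(1)[OF p B] by simp
    have "B = {Inl i, Inr (f i)}" using partitionsD(4)[OF p B f[OF i], of "Inl i"] ij by simp
    then show "B \<in> perm_part k \<sigma>" using i by (auto simp: perm_part_def \<sigma>_def)
  qed (use f in \<open>auto simp: perm_part_def \<sigma>_def\<close>)
  then show "p \<in> parts ClassS k" using perm by auto
qed

lemma parts_iff: "p \<in> parts A k \<longleftrightarrow> p \<in> partitions k \<and> (\<forall>B\<in>p. admissible A B)"
proof (cases A)
  case ClassS
  then show ?thesis by (simp add: parts_ClassS del: parts.simps admissible.simps)
qed simp_all

lemma parts_partitions: "p \<in> parts A k \<Longrightarrow> p \<in> partitions k"
  by (simp add: parts_iff)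

lemma finite_parts [simp]: "finite (parts A k)"
  by (rule finite_subset[of _ "partitions k"]) (auto simp: parts_iff)

lemma admissible_shift: "admissible A (shift k ` B) \<longleftrightarrow> admissible A B"
proof -
  have "card (shift k ` B) = card B"
    using inj_shift by (intro card_image) (meson inj_on_subset subset_UNIV)
  moreover have "(\<exists>i. Inl i \<in> shift k ` B) \<longleftrightarrow> (\<exists>i. Inl i \<in> B)"
  proof
    assume "\<exists>i. Inl i \<in> shift k ` B"
    then obtain i x where "Inl i = shift k x" "x \<in> B" by auto
    then show "\<exists>i. Inl i \<in> B" by (cases x) auto
  qed force
  moreover have "(\<exists>i. Inr i \<in> shift k ` B) \<longleftrightarrow> (\<exists>i. Inr i \<in> B)"
  proof
    assume "\<exists>i. Inr i \<in> shift k ` B"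
    then obtain i x where "Inr i = shift k x" "x \<in> B" by auto
    then show "\<exists>i. Inr i \<in> B" by (cases x) auto
  qed force
  ultimately show ?thesis by (cases A) simp_all
qed

lemma tensor_in_parts_iff:
  assumes "p \<in> partitions k" "q \<in> partitions l"
  shows "tensor_part k p q \<in> parts A (k + l) \<longleftrightarrow> p \<in> parts A k \<and> q \<in> parts A l"
  using assms tensor_partitions[OF assms]
  by (auto simp: parts_iff tensor_part_def ball_Un admissible_shift)

text \<open>Hence the geodesic order ideal generated by a tensor product, within any of the classes, is the
  product of the two ideals.\<close>

lemma bij_betw_tensor_ideal:
  assumes p: "p \<in> partitions k" "p' \<in> partitions l"
  shows "bij_betw (\<lambda>(q, q'). tensor_part k q q')
    ({q \<in> parts A k. geodesic_le k q p} \<times> {q \<in> parts A l. geodesic_le l q p'})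
    {r \<in> parts A (k + l). geodesic_le (k + l) r (tensor_part k p p')}"
  unfolding bij_betw_def
proof (intro conjI equalityI subsetI)
  show "inj_on (\<lambda>(q, q'). tensor_part k q q')
    ({q \<in> parts A k. geodesic_le k q p} \<times> {q \<in> parts A l. geodesic_le l q p'})"
    by (rule inj_onI) (auto dest: tensor_inj simp: parts_iff)
  fix r
  show "r \<in> {r \<in> parts A (k + l). geodesic_le (k + l) r (tensor_part k p p')}"
    if "r \<in> (\<lambda>(q, q'). tensor_part k q q') `
      ({q \<in> parts A k. geodesic_le k q p} \<times> {q \<in> parts A l. geodesic_le l q p'})"
    using that p by (auto simp: tensor_in_parts_iff geodesic_le_tensor_iff parts_partitions)
  assume r: "r \<in> {r \<in> parts A (k + l). geodesic_le (k + l) r (tensor_part k p p')}"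
  then obtain q q' where q: "q \<in> partitions k" "q' \<in> partitions l" and eq: "r = tensor_part k q q'"
    using geodesic_below_tensor[OF p, of r] parts_partitions by blast
  then show "r \<in> (\<lambda>(q, q'). tensor_part k q q') `
      ({q \<in> parts A k. geodesic_le k q p} \<times> {q \<in> parts A l. geodesic_le l q p'})"
    using r p by (auto simp: tensor_in_parts_iff geodesic_le_tensor_iff)
qed

section \<open>Unitriangular systems\<close>

text \<open>Solvability by induction along the rank: the element of highest rank occurs only in its own
  equation, and can be eliminated last.\<close>

lemma unitriangular_solve:
  fixes Z :: "'a \<Rightarrow> 'a \<Rightarrow> complex" and rank :: "'a \<Rightarrow> real"
  assumes "finite S" and one: "\<And>q. q \<in> S \<Longrightarrow> Z q q = 1"
    and tri: "\<And>q r. q \<in> S \<Longrightarrow> r \<in> S \<Longrightarrow> Z q r \<noteq> 0 \<Longrightarrow> r = q \<or> rank r < rank q"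
  shows "\<exists>c. \<forall>q\<in>S. (\<Sum>r\<in>S. Z q r * c r) = m q"
  using assms
proof (induction S rule: finite_ranking_induct[where f = rank])
  case (insert x S)
  show ?case
  proof (cases "x \<in> S")
    case True
    then show ?thesis using insert by (simp add: insert_absorb)
  next
    case False
    obtain c where c: "\<forall>q\<in>S. (\<Sum>r\<in>S. Z q r * c r) = m q" using insert by auto
    define c' where "c' = c(x := m x - (\<Sum>r\<in>S. Z x r * c r))"
    have old: "(\<Sum>r\<in>S. Z q r * c' r) = (\<Sum>r\<in>S. Z q r * c r)" for q
      using False by (intro sum.cong) (auto simp: c'_def)
    have "Z q x = 0" if "q \<in> S" for q
    proof (rule ccontr)
      assume "Z q x \<noteq> 0"
      then have "x = q \<or> rank x < rank q" using insert.prems(2)[of q x] that by simp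
      then show False using insert.hyps(2)[OF that] that False by auto
    qed
    then have "(\<Sum>r\<in>insert x S. Z q r * c' r) = m q" if "q \<in> insert x S" for q
      using that c insert.hyps(1) False insert.prems(1)[of x] by (auto simp: old) (simp add: c'_def)
    then show ?thesis by blast
  qed
qed simp

text \<open>The rows of the inverse solve the transposed system, which is unitriangular for the opposite rank.\<close>

lemma unitriangular_left_inverse:
  fixes Z :: "'a \<Rightarrow> 'a \<Rightarrow> complex" and rank :: "'a \<Rightarrow> real"
  assumes "finite S" and one: "\<And>q. q \<in> S \<Longrightarrow> Z q q = 1"
    and tri: "\<And>q r. q \<in> S \<Longrightarrow> r \<in> S \<Longrightarrow> Z q r \<noteq> 0 \<Longrightarrow> r = q \<or> rank r < rank q"
  shows "\<exists>H. \<forall>p\<in>S. \<forall>r\<in>S. (\<Sum>q\<in>S. H p q * Z q r) = of_bool (p = r)"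
proof -
  have "\<exists>h. \<forall>r\<in>S. (\<Sum>q\<in>S. Z q r * h q) = of_bool (p = r)" for p
  proof (rule unitriangular_solve[where rank = "\<lambda>q. - rank q"])
    fix q r assume "q \<in> S" "r \<in> S" "Z r q \<noteq> 0"
    then show "r = q \<or> - rank r < - rank q" using tri[of r q] by auto
  qed (use assms(1) one in auto)
  then obtain H where "\<forall>p. \<forall>r\<in>S. (\<Sum>q\<in>S. Z q r * H p q) = of_bool (p = r)" by metis
  then show ?thesis by (intro exI[of _ H]) (simp add: mult.commute)
qed

lemma left_inverse_apply:
  fixes Z H :: "'a \<Rightarrow> 'a \<Rightarrow> complex"
  assumes S: "finite S" and H: "\<And>r. r \<in> S \<Longrightarrow> (\<Sum>q\<in>S. H p q * Z q r) = of_bool (p = r)" and p: "p \<in> S"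
  shows "(\<Sum>q\<in>S. H p q * (\<Sum>r\<in>S. Z q r * c r)) = c p"
proof -
  have "(\<Sum>q\<in>S. H p q * (\<Sum>r\<in>S. Z q r * c r)) = (\<Sum>q\<in>S. \<Sum>r\<in>S. H p q * Z q r * c r)"
    by (simp add: sum_distrib_left mult.assoc)
  also have "\<dots> = (\<Sum>r\<in>S. (\<Sum>q\<in>S. H p q * Z q r) * c r)"
    by (subst sum.swap) (simp add: sum_distrib_right)
  also have "\<dots> = (\<Sum>r\<in>S. if r = p then c r else 0)"
    by (intro sum.cong) (auto simp: H)
  also have "\<dots> = c p" using S p by simp
  finally show ?thesis .
qed

lemma unitriangular_unique:
  fixes Z :: "'a \<Rightarrow> 'a \<Rightarrow> complex" and rank :: "'a \<Rightarrow> real"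
  assumes S: "finite S" and one: "\<And>q. q \<in> S \<Longrightarrow> Z q q = 1"
    and tri: "\<And>q r. q \<in> S \<Longrightarrow> r \<in> S \<Longrightarrow> Z q r \<noteq> 0 \<Longrightarrow> r = q \<or> rank r < rank q"
    and eq: "\<And>q. q \<in> S \<Longrightarrow> (\<Sum>r\<in>S. Z q r * c r) = (\<Sum>r\<in>S. Z q r * d r)" and p: "p \<in> S"
  shows "c p = d p"
proof -
  obtain H where H: "\<forall>p\<in>S. \<forall>r\<in>S. (\<Sum>q\<in>S. H p q * Z q r) = of_bool (p = r)"
    using unitriangular_left_inverse[where Z = Z and rank = rank, OF S one tri] by blast
  have "c p = (\<Sum>q\<in>S. H p q * (\<Sum>r\<in>S. Z q r * c r))"
    using left_inverse_apply[OF S _ p, of H Z c] H p by simp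
  also have "\<dots> = (\<Sum>q\<in>S. H p q * (\<Sum>r\<in>S. Z q r * d r))" by (simp add: eq)
  also have "\<dots> = d p" using left_inverse_apply[OF S _ p, of H Z d] H p by simp
  finally show ?thesis .
qed

text \<open>Multiplying by the inverse \<open>H\<close> of the limit turns the system into \<open>\<kappa> = H m - E \<kappa>\<close> with \<open>E\<close> tending
  to zero; as soon as \<open>\<bar>E\<bar> \<le> 1/2\<close> this bounds \<open>\<kappa>\<close>, and then the equation gives the limit.\<close>

lemma perturbed_unitriangular_convergent:
  fixes Z :: "'a \<Rightarrow> 'a \<Rightarrow> complex" and rank :: "'a \<Rightarrow> real" and G :: "nat \<Rightarrow> 'a \<Rightarrow> 'a \<Rightarrow> complex"
  assumes S: "finite S" and one: "\<And>q. q \<in> S \<Longrightarrow> Z q q = 1"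
    and tri: "\<And>q r. q \<in> S \<Longrightarrow> r \<in> S \<Longrightarrow> Z q r \<noteq> 0 \<Longrightarrow> r = q \<or> rank r < rank q"
    and G: "\<And>q r. q \<in> S \<Longrightarrow> r \<in> S \<Longrightarrow> (\<lambda>N. G N q r) \<longlonglongrightarrow> Z q r"
    and m: "\<And>q. q \<in> S \<Longrightarrow> (\<lambda>N. m N q) \<longlonglongrightarrow> \<mu> q"
    and sys: "eventually (\<lambda>N. \<forall>q\<in>S. m N q = (\<Sum>r\<in>S. G N q r * \<kappa> N r)) sequentially"
  shows "\<exists>\<kappa>'. \<forall>r\<in>S. (\<lambda>N. \<kappa> N r) \<longlonglongrightarrow> \<kappa>' r"
proof -
  obtain H where H: "\<forall>p\<in>S. \<forall>r\<in>S. (\<Sum>q\<in>S. H p q * Z q r) = of_bool (p = r)"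
    using unitriangular_left_inverse[where Z = Z and rank = rank, OF S one tri] by blast
  define E where "E N p r = (\<Sum>q\<in>S. H p q * G N q r) - of_bool (p = r)" for N p r
  define h where "h N p = (\<Sum>q\<in>S. H p q * m N q)" for N p
  define s where "s N = (\<Sum>p\<in>S. norm (\<kappa> N p))" for N
  define b where "b N = (\<Sum>p\<in>S. norm (h N p))" for N
  define \<epsilon> where "\<epsilon> N = (\<Sum>p\<in>S. \<Sum>r\<in>S. norm (E N p r))" for N
  have h_lim: "(\<lambda>N. h N p) \<longlonglongrightarrow> (\<Sum>q\<in>S. H p q * \<mu> q)" for p
    unfolding h_def by (intro tendsto_sum tendsto_mult_left m)
  have E_lim: "(\<lambda>N. E N p r) \<longlonglongrightarrow> (\<Sum>q\<in>S. H p q * Z q r) - of_bool (p = r)" if "r \<in> S" for p r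
    unfolding E_def by (intro tendsto_diff tendsto_sum tendsto_mult_left G that tendsto_const)
  have "(\<lambda>N. norm (E N p r)) \<longlonglongrightarrow> 0" if "p \<in> S" "r \<in> S" for p r
    using E_lim[OF that(2), of p] H that by (intro tendsto_norm_zero) simp
  then have "(\<lambda>N. \<epsilon> N) \<longlonglongrightarrow> (\<Sum>p\<in>S. \<Sum>r\<in>S. 0)" unfolding \<epsilon>_def by (intro tendsto_sum)
  then have \<epsilon>_lim: "\<epsilon> \<longlonglongrightarrow> 0" by simp
  have b_lim: "b \<longlonglongrightarrow> (\<Sum>p\<in>S. norm (\<Sum>q\<in>S. H p q * \<mu> q))"
    unfolding b_def by (intro tendsto_sum tendsto_norm h_lim)
  have bound: "norm (\<kappa> N p - h N p) \<le> \<epsilon> N * (2 * b N)"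
    if p: "p \<in> S" and sysN: "\<forall>q\<in>S. m N q = (\<Sum>r\<in>S. G N q r * \<kappa> N r)" and small: "\<epsilon> N < 1 / 2" for N p
  proof -
    have eq: "h N p - \<kappa> N p = (\<Sum>r\<in>S. E N p r * \<kappa> N r)" if "p \<in> S" for p
    proof -
      have "h N p = (\<Sum>q\<in>S. \<Sum>r\<in>S. H p q * G N q r * \<kappa> N r)"
        unfolding h_def using sysN by (intro sum.cong) (auto simp: sum_distrib_left mult.assoc)
      also have "\<dots> = (\<Sum>r\<in>S. (\<Sum>q\<in>S. H p q * G N q r) * \<kappa> N r)"
        by (subst sum.swap) (simp add: sum_distrib_right)
      also have "\<dots> = (\<Sum>r\<in>S. E N p r * \<kappa> N r + (if r = p then \<kappa> N r else 0))"
        by (intro sum.cong) (auto simp: E_def algebra_simps)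
      also have "\<dots> = (\<Sum>r\<in>S. E N p r * \<kappa> N r) + \<kappa> N p"
        using S that by (simp add: sum.distrib)
      finally show ?thesis by simp
    qed
    have row: "norm (h N p - \<kappa> N p) \<le> (\<Sum>r\<in>S. norm (E N p r)) * s N" if "p \<in> S" for p
    proof -
      have "norm (h N p - \<kappa> N p) \<le> (\<Sum>r\<in>S. norm (E N p r * \<kappa> N r))"
        unfolding eq[OF that] by (rule norm_sum)
      also have "\<dots> \<le> (\<Sum>r\<in>S. norm (E N p r) * s N)"
        unfolding s_def using S by (intro sum_mono) (auto simp: norm_mult intro!: mult_left_mono member_le_sum)
      finally show ?thesis by (simp add: sum_distrib_right)
    qed
    have s0: "0 \<le> s N" unfolding s_def by (intro sum_nonneg) auto
    have "s N \<le> (\<Sum>p\<in>S. norm (h N p) + (\<Sum>r\<in>S. norm (E N p r)) * s N)"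
      unfolding s_def[of N]
    proof (rule sum_mono)
      fix p assume "p \<in> S"
      then show "norm (\<kappa> N p) \<le> norm (h N p) + (\<Sum>r\<in>S. norm (E N p r)) * (\<Sum>p\<in>S. norm (\<kappa> N p))"
        using row[of p] norm_triangle_ineq2[of "\<kappa> N p" "h N p"]
        by (simp add: s_def norm_minus_commute)
    qed
    also have "\<dots> = b N + \<epsilon> N * s N" by (simp add: b_def \<epsilon>_def sum.distrib sum_distrib_right)
    also have "\<dots> \<le> b N + 1 / 2 * s N" using small s0 by (intro add_left_mono mult_right_mono) auto
    finally have s_le: "s N \<le> 2 * b N" by simp
    have e: "(\<Sum>r\<in>S. norm (E N p r)) \<le> \<epsilon> N" unfolding \<epsilon>_def using S p
      by (intro member_le_sum[of p S "\<lambda>p. \<Sum>r\<in>S. norm (E N p r)"] sum_nonneg) auto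
    have "norm (\<kappa> N p - h N p) \<le> (\<Sum>r\<in>S. norm (E N p r)) * s N"
      using row[OF p] by (simp add: norm_minus_commute)
    also have "\<dots> \<le> \<epsilon> N * (2 * b N)"
      using e s_le s0 by (intro mult_mono) (auto simp: \<epsilon>_def intro!: sum_nonneg)
    finally show ?thesis .
  qed
  have "(\<lambda>N. \<kappa> N p) \<longlonglongrightarrow> (\<Sum>q\<in>S. H p q * \<mu> q)" if p: "p \<in> S" for p
  proof -
    have "eventually (\<lambda>N. \<epsilon> N < 1 / 2) sequentially" using order_tendstoD(2)[OF \<epsilon>_lim, of "1/2"] by simp
    with sys have ev: "eventually (\<lambda>N. norm (\<kappa> N p - h N p) \<le> \<epsilon> N * (2 * b N)) sequentially"
      by eventually_elim (rule bound[OF p])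
    have "(\<lambda>N. \<epsilon> N * (2 * b N)) \<longlonglongrightarrow> 0"
      using tendsto_mult[OF \<epsilon>_lim tendsto_mult_left[OF b_lim, of 2]] by simp
    then have "(\<lambda>N. \<kappa> N p - h N p) \<longlonglongrightarrow> 0" by (rule Lim_null_comparison[OF ev])
    from tendsto_add[OF this h_lim[of p]] show ?thesis by simp
  qed
  then show ?thesis by (intro exI[of _ "\<lambda>p. \<Sum>q\<in>S. H p q * \<mu> q"]) blast
qed

section \<open>Invariant tensors\<close>

abbreviation indices :: "nat \<Rightarrow> nat \<Rightarrow> (nat + nat \<Rightarrow> nat) set" where
  "indices k N \<equiv> points k \<rightarrow>\<^sub>E {..<N}"

text \<open>A scalar \<open>u\<close> for which the diagonal matrix with one entry \<open>u\<close> and all other entries 1 lies in the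
  group. Its powers detect the inadmissible blocks of at most two points, and for \<open>\<H>\<close> all of them.\<close>

fun unit_phase :: "part_class \<Rightarrow> complex" where
  "unit_phase ClassS = \<i>"
| "unit_phase ClassB = - 1"
| "unit_phase ClassBs = 1"
| "unit_phase ClassH = - 1"
| "unit_phase ClassP = 1"

text \<open>A conjugation by \<open>g\<close> acts through \<open>g\<close> on row indices, which are attached to the bottom points of a
  partition, and through the inverse of \<open>g\<close> on column indices.\<close>

definition phase :: "part_class \<Rightarrow> nat + nat \<Rightarrow> complex" where
  "phase A x = (case x of Inl _ \<Rightarrow> inverse (unit_phase A) | Inr _ \<Rightarrow> unit_phase A)"

definition reflection_vector :: "nat \<Rightarrow> nat \<Rightarrow> nat \<Rightarrow> nat \<Rightarrow> nat \<Rightarrow> complex" where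
  "reflection_vector a b c d x = (if x = a \<or> x = b then 1 else if x = c \<or> x = d then - 1 else 0)"

text \<open>The entries of the reflection \<open>1 - 2 v v\<^sup>T\<close> for the unit vector \<open>v = (e\<^sub>a + e\<^sub>b - e\<^sub>c - e\<^sub>d) / 2\<close>,
  whose double is \<open>reflection_vector a b c d\<close>.
  As \<open>v\<close> is orthogonal to \<open>(1, \<dots>, 1)\<close>, all rows and columns sum to 1; so the reflection lies in all
  three groups that are not made of monomial matrices.\<close>

definition reflection :: "nat \<Rightarrow> nat \<Rightarrow> nat \<Rightarrow> nat \<Rightarrow> nat \<Rightarrow> nat \<Rightarrow> complex" where
  "reflection a b c d x y = of_bool (x = y) - reflection_vector a b c d x * reflection_vector a b c d y / 2"

text \<open>The effect on the entries of a tensor of being fixed by the permutation matrices, by the diagonal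
  matrices with one phase, and by the reflections above.\<close>

definition kernel_invariant :: "nat \<Rightarrow> nat \<Rightarrow> ((nat + nat \<Rightarrow> nat) \<Rightarrow> complex) \<Rightarrow> bool" where
  "kernel_invariant k N T \<longleftrightarrow> (\<forall>I\<in>indices k N. \<forall>J\<in>indices k N. Ker k I = Ker k J \<longrightarrow> T I = T J)"

definition phase_invariant :: "part_class \<Rightarrow> nat \<Rightarrow> nat \<Rightarrow> ((nat + nat \<Rightarrow> nat) \<Rightarrow> complex) \<Rightarrow> bool" where
  "phase_invariant A k N T \<longleftrightarrow>
     (\<forall>I\<in>indices k N. \<forall>a<N. T I = (\<Prod>x\<in>{x \<in> points k. I x = a}. phase A x) * T I)"

definition reflection_invariant :: "nat \<Rightarrow> nat \<Rightarrow> ((nat + nat \<Rightarrow> nat) \<Rightarrow> complex) \<Rightarrow> bool" where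
  "reflection_invariant k N T \<longleftrightarrow>
     (\<forall>a<N. \<forall>b<N. \<forall>c<N. \<forall>d<N. distinct [a, b, c, d] \<longrightarrow> (\<forall>I\<in>indices k N.
        T I = (\<Sum>J\<in>indices k N. (\<Prod>x\<in>points k. reflection a b c d (I x) (J x)) * T J)))"

definition tensor_invariant :: "part_class \<Rightarrow> nat \<Rightarrow> nat \<Rightarrow> ((nat + nat \<Rightarrow> nat) \<Rightarrow> complex) \<Rightarrow> bool" where
  "tensor_invariant A k N T \<longleftrightarrow> kernel_invariant k N T \<and> phase_invariant A k N T \<and>
     (A \<in> {ClassS, ClassB, ClassBs} \<longrightarrow> reflection_invariant k N T)"

lemma Ker_eqI:
  assumes "\<And>x y. x \<in> points k \<Longrightarrow> y \<in> points k \<Longrightarrow> I x = I y \<longleftrightarrow> J x = J y"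
  shows "Ker k I = Ker k J"
  unfolding Ker_def using assms by (intro image_cong refl) auto

lemma block_Ker: "x \<in> points k \<Longrightarrow> block (Ker k I) x = {b \<in> points k. I b = I x}"
  by (intro block_eq[OF Ker_partitions]) (auto simp: Ker_def)

lemma Ker_eqD:
  assumes "Ker k I = Ker k J" "x \<in> points k" "y \<in> points k"
  shows "I x = I y \<longleftrightarrow> J x = J y"
proof -
  have "y \<in> block (Ker k I) x \<longleftrightarrow> y \<in> block (Ker k J) x" using assms(1) by simp
  then show ?thesis using assms(2,3) unfolding block_Ker[OF assms(2)] by (metis (mono_tags, lifting) mem_Collect_eq)
qed

lemma reflection_vector_sums:
  assumes "distinct [a, b, c, d]" "a < N" "b < N" "c < N" "d < N"
  shows "(\<Sum>x<N. reflection_vector a b c d x) = 0" "(\<Sum>x<N. (reflection_vector a b c d x)\<^sup>2) = 4"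
proof -
  have outside: "reflection_vector a b c d x = 0" if "x \<in> {..<N} - {a, b, c, d}" for x
    using that by (auto simp: reflection_vector_def)
  have sub: "{a, b, c, d} \<subseteq> {..<N}" using assms by auto
  have "(\<Sum>x<N. reflection_vector a b c d x) = (\<Sum>x\<in>{a, b, c, d}. reflection_vector a b c d x)"
    using sub outside by (intro sum.mono_neutral_right) auto
  also have "\<dots> = 0" using assms(1) by (simp add: reflection_vector_def)
  finally show "(\<Sum>x<N. reflection_vector a b c d x) = 0" .
  have "(\<Sum>x<N. (reflection_vector a b c d x)\<^sup>2) = (\<Sum>x\<in>{a, b, c, d}. (reflection_vector a b c d x)\<^sup>2)"
    using sub outside by (intro sum.mono_neutral_right) auto
  also have "\<dots> = 4" using assms(1) by (simp add: reflection_vector_def)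
  finally show "(\<Sum>x<N. (reflection_vector a b c d x)\<^sup>2) = 4" .
qed

lemma reflection_commute: "reflection a b c d x y = reflection a b c d y x"
  by (auto simp: reflection_def)

lemma reflection_row_sum:
  assumes "distinct [a, b, c, d]" "a < N" "b < N" "c < N" "d < N" "x < N"
  shows "(\<Sum>y<N. reflection a b c d x y) = 1"
proof -
  have "(\<Sum>y<N. reflection a b c d x y)
    = (\<Sum>y<N. if x = y then 1 else 0) - reflection_vector a b c d x * (\<Sum>y<N. reflection_vector a b c d y) / 2"
    by (simp add: reflection_def of_bool_def sum_subtractf sum_distrib_left sum_divide_distrib)
  also have "\<dots> = 1" using reflection_vector_sums[OF assms(1-5)] assms(6) by simp
  finally show ?thesis .
qed

lemma reflection_involution:
  assumes "distinct [a, b, c, d]" "a < N" "b < N" "c < N" "d < N" "x < N" "z < N"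
  shows "(\<Sum>y<N. reflection a b c d x y * reflection a b c d z y) = of_bool (x = z)"
proof -
  let ?s = "reflection_vector a b c d"
  have "reflection a b c d x y * reflection a b c d z y
    = (if x = y then of_bool (x = z) - ?s z * ?s x / 2 else 0) - (if z = y then ?s x * ?s z / 2 else 0)
      + ?s x * ?s z / 4 * (?s y)\<^sup>2" for y
    by (auto simp: reflection_def algebra_simps power2_eq_square)
  then have "(\<Sum>y<N. reflection a b c d x y * reflection a b c d z y)
    = (\<Sum>y<N. if x = y then of_bool (x = z) - ?s z * ?s x / 2 else 0)
      - (\<Sum>y<N. if z = y then ?s x * ?s z / 2 else 0) + ?s x * ?s z / 4 * (\<Sum>y<N. (?s y)\<^sup>2)"
    by (simp add: sum.distrib sum_subtractf sum_distrib_left)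
  also have "\<dots> = of_bool (x = z)"
    using reflection_vector_sums[OF assms(1-5)] assms(6,7) by simp
  finally show ?thesis .
qed

text \<open>A fibre of \<open>m \<ge> 3\<close> points with value \<open>a\<close> is reflected against three values that do not occur. In
  the expansion, a fibre that stays together contributes \<open>\<plusminus> 2\<^sup>-\<^sup>m\<close> times the same entry, and a fibre
  that is torn apart gives an index with more values. By induction the latter terms vanish, so that
  the entry is a multiple of itself by a factor of modulus at most \<open>4 / 2\<^sup>m < 1\<close>.\<close>

lemma reflection_invariant_vanishes:
  assumes ker: "kernel_invariant k N T" and reflect: "reflection_invariant k N T" and N: "2 * k + 3 \<le> N"
    and small: "\<And>I. I \<in> indices k N \<Longrightarrow> (\<And>x. x \<in> points k \<Longrightarrow> card {y \<in> points k. I y = I x} \<le> 2) \<Longrightarrow> T I = 0"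
    and I: "I \<in> indices k N"
  shows "T I = 0"
  using I
proof (induction "2 * k - card (I ` points k)" arbitrary: I rule: less_induct)
  case less
  note I = less.prems
  show ?case
  proof (cases "\<forall>x\<in>points k. card {y \<in> points k. I y = I x} \<le> 2")
    case True
    then show ?thesis using small[OF I] by blast
  next
    case False
    then obtain x0 where x0: "x0 \<in> points k" and big: "3 \<le> card {y \<in> points k. I y = I x0}" by auto
    define a where "a = I x0"
    define F where "F = {y \<in> points k. I y = a}"
    have aN: "a < N" using I x0 by (auto simp: a_def)
    have F3: "3 \<le> card F" and x0F: "x0 \<in> F" using big x0 by (auto simp: F_def a_def)
    have "card (I ` points k) \<le> 2 * k" using card_image_le[of "points k" I] by (simp add: card_points)
    \<comment> \<open>the index takes at most \<open>2 k\<close> values, which leaves three fresh ones\<close>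
    then have "3 \<le> card ({..<N} - I ` points k)"
      using N diff_card_le_card_Diff[of "I ` points k" "{..<N}"] by simp
    then obtain U where "U \<subseteq> {..<N} - I ` points k" "card U = 3"
      by (meson obtain_subset_with_card_n)
    then obtain b c d where bcd: "{b, c, d} \<subseteq> {..<N} - I ` points k" "distinct [b, c, d]"
      by (auto simp: card_3_iff)
    have aI: "a \<in> I ` points k" using x0 by (simp add: a_def)
    then have dist: "distinct [a, b, c, d]" using bcd by auto
    let ?V = "{a, b, c, d}" and ?r = "reflection a b c d"
    have VN: "?V \<subseteq> {..<N}" using bcd aN by auto
    define w where "w J = (\<Prod>x\<in>points k. ?r (I x) (J x))" for J
    \<comment> \<open>only the indices that send the whole fibre to one of the four values survive\<close>
    define move where "move y = (\<lambda>x\<in>points k. if I x = a then y else I x)" for y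
    have out: "I x \<notin> ?V" if "x \<in> points k" "x \<notin> F" for x
      using that bcd(1) by (auto simp: F_def)
    have r_out: "?r (I x) z = of_bool (I x = z)" if "x \<in> points k" "x \<notin> F" for x z
      using out[OF that] by (simp add: reflection_def reflection_vector_def)
    have r_a: "?r a z = 0" if "z \<notin> ?V" for z
      using that by (auto simp: reflection_def reflection_vector_def)
    have moveI: "move y \<in> indices k N" if "y \<in> ?V" for y
      using that VN I by (auto simp: move_def)
    have zero: "w J * T J = 0" if J: "J \<in> indices k N" and Jm: "J \<notin> move ` ?V" for J
    proof (cases "w J = 0")
      case False
      then have nz: "?r (I x) (J x) \<noteq> 0" if "x \<in> points k" for x
        using that by (auto simp: w_def)
      have J_out: "J x = I x" if "x \<in> points k" "x \<notin> F" for x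
        using nz[OF that(1)] r_out[OF that] by (auto split: if_splits)
      have J_F: "J x \<in> ?V" if "x \<in> F" for x
        using nz[of x] r_a[of "J x"] that by (auto simp: F_def)
      have "\<exists>x\<in>F. J x \<noteq> J x0"
      proof (rule ccontr)
        assume "\<not> (\<exists>x\<in>F. J x \<noteq> J x0)"
        then have const: "J x = J x0" if "x \<in> F" for x using that by blast
        have "J = move (J x0)"
        proof
          fix x show "J x = move (J x0) x"
          proof (cases "x \<in> points k")
            case True
            then show ?thesis
              using const[of x] J_out[of x] by (cases "x \<in> F") (auto simp: move_def F_def)
          next
            case False
            then show ?thesis using PiE_arb[OF J False] by (simp add: move_def)
          qed
        qed
        then show False using Jm J_F[OF x0F] by blast
      qed
      then obtain x1 where x1: "x1 \<in> F" "J x1 \<noteq> J x0" by blast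
      let ?W = "I ` (points k - F)"
      have "I ` points k = insert a ?W"
        using x0F by (auto simp: F_def)
      then have cI: "card (I ` points k) \<le> Suc (card ?W)" by (simp add: card_insert_if)
      have "I x \<noteq> J x0" "I x \<noteq> J x1" if "x \<in> points k" "x \<notin> F" for x
        using out[OF that] J_F[OF x0F] J_F[OF x1(1)] by metis+
      then have "?W \<inter> {J x0, J x1} = {}" by blast
      then have "card (?W \<union> {J x0, J x1}) = card ?W + 2"
        using x1(2) by (subst card_Un_disjoint) auto
      moreover have "?W \<union> {J x0, J x1} \<subseteq> J ` points k"
      proof -
        have "?W \<subseteq> J ` points k" using J_out by (force intro: rev_image_eqI)
        then show ?thesis using x0F x1(1) by (auto simp: F_def)
      qed
      ultimately have "card ?W + 2 \<le> card (J ` points k)"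
        by (metis card_mono finite_imageI finite_points)
      then have less_card: "card (I ` points k) < card (J ` points k)" using cI by simp
      moreover have "card (J ` points k) \<le> 2 * k"
        using card_image_le[of "points k" J] by (simp add: card_points)
      ultimately have "T J = 0" by (intro less.hyps[OF _ J]) simp
      then show ?thesis by simp
    qed simp
    have inj: "inj_on move ?V"
    proof (rule inj_onI)
      fix y z assume "move y = move z"
      from fun_cong[OF this, of x0] show "y = z" using x0 by (simp add: move_def a_def)
    qed
    have w_move: "w (move y) = ?r a y ^ card F" for y
    proof -
      have "w (move y) = (\<Prod>x\<in>points k. if x \<in> F then ?r a y else 1)"
        unfolding w_def using r_out by (intro prod.cong refl) (auto simp: move_def F_def)
      also have "\<dots> = (\<Prod>x\<in>F. ?r a y)"
        by (subst prod.inter_filter[symmetric]) (auto simp: F_def intro!: prod.cong)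
      finally show ?thesis by simp
    qed
    have T_move: "T (move y) = T I" if y: "y \<in> ?V" for y
    proof -
      have fresh: "y = a \<or> y \<notin> I ` points k" using y bcd(1) by auto
      have "Ker k (move y) = Ker k I"
      proof (rule Ker_eqI)
        fix u v assume uv: "u \<in> points k" "v \<in> points k"
        then have ne: "I u = y \<Longrightarrow> y = a" "I v = y \<Longrightarrow> y = a" using fresh by auto
        have "(if I u = a then y else I u) = (if I v = a then y else I v) \<longleftrightarrow> I u = I v"
          using ne by (cases "I u = a"; cases "I v = a") metis+
        then show "move y u = move y v \<longleftrightarrow> I u = I v" using uv by (simp add: move_def)
      qed
      then show ?thesis using ker moveI[OF y] I unfolding kernel_invariant_def by blast
    qed
    have "T I = (\<Sum>J\<in>indices k N. w J * T J)"
      using reflect VN dist I unfolding reflection_invariant_def w_def by simp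
    also have "\<dots> = (\<Sum>J\<in>move ` ?V. w J * T J)"
      using moveI zero by (intro sum.mono_neutral_right) (auto intro!: finite_PiE)
    also have "\<dots> = (\<Sum>y\<in>?V. w (move y) * T (move y))" by (subst sum.reindex[OF inj]) simp
    also have "\<dots> = (\<Sum>y\<in>?V. ?r a y ^ card F * T I)"
      by (rule sum.cong[OF refl]) (simp only: w_move T_move)
    also have "\<dots> = (\<Sum>y\<in>?V. ?r a y ^ card F) * T I" by (simp only: sum_distrib_right)
    finally have eq: "T I = (\<Sum>y\<in>?V. ?r a y ^ card F) * T I" .
    have "norm (?r a y ^ card F) \<le> 1 / 8" if "y \<in> ?V" for y
    proof -
      have half: "norm (?r a y) = 1 / 2"
        using that dist by (auto simp: reflection_def reflection_vector_def)
      have "(1 / 2 :: real) ^ card F \<le> (1 / 2) ^ 3" using F3 by (intro power_decreasing) auto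
      then show ?thesis by (simp add: norm_power half power_one_over)
    qed
    then have "norm (\<Sum>y\<in>?V. ?r a y ^ card F) \<le> (\<Sum>y\<in>?V. 1 / 8)" by (rule sum_norm_le)
    also have "\<dots> < 1" using dist by simp
    finally have "(\<Sum>y\<in>?V. ?r a y ^ card F) \<noteq> 1" by auto
    then show ?thesis using eq by (metis mult_cancel_right1)
  qed
qed

lemma phase_admissible:
  assumes "admissible A B"
  shows "(\<Prod>x\<in>B. phase A x) = 1"
proof (cases A)
  case ClassS
  then obtain i j where "B = {Inl i, Inr j}" using assms admissible_ClassS_iff by blast
  then show ?thesis using ClassS by (simp add: phase_def)
next
  case ClassB
  have "phase ClassB x = - 1" for x by (cases x) (auto simp: phase_def)
  then show ?thesis using assms ClassB by simp
next
  case ClassH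
  have "phase ClassH x = - 1" for x by (cases x) (auto simp: phase_def)
  then show ?thesis using assms ClassH by simp
qed (simp_all add: phase_def split: sum.splits)

text \<open>For \<open>u = -1\<close> the product detects the parity of the block. For \<open>u = \<i>\<close> a single point gives
  \<open>\<plusminus> \<i>\<close>, and two points of the same row give \<open>-1\<close>. Larger blocks can escape in the classes \<open>\<SS>\<close>, \<open>\<B>\<close> and
  \<open>\<B>s\<close>, where they are left to the reflection.\<close>

lemma phase_not_admissible:
  assumes "finite B" "B \<noteq> {}" "\<not> admissible A B" "A \<in> {ClassS, ClassB, ClassBs} \<Longrightarrow> card B \<le> 2"
  shows "(\<Prod>x\<in>B. phase A x) \<noteq> 1"
proof (cases A)
  case ClassS
  have "card B \<noteq> 0" using assms(1,2) by simp
  then consider "card B = 1" | "card B = 2" using assms(4) ClassS by fastforce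
  then show ?thesis
  proof cases
    case 1
    then obtain x where "B = {x}" by (auto simp: card_1_singleton_iff)
    then show ?thesis using ClassS by (cases x) (auto simp: phase_def complex_eq_iff)
  next
    case 2
    then obtain x y where xy: "B = {x, y}" "x \<noteq> y" by (auto simp: card_2_iff)
    then show ?thesis
      using ClassS assms(3) 2 by (cases x; cases y) (auto simp: phase_def)
  qed
next
  case ClassB
  have "card B \<noteq> 0" using assms(1,2) by simp
  then have "card B = 1" using assms(3,4) ClassB by auto
  then obtain x where "B = {x}" by (auto simp: card_1_singleton_iff)
  then show ?thesis using ClassB by (cases x) (auto simp: phase_def)
next
  case ClassH
  have "phase ClassH x = - 1" for x by (cases x) (auto simp: phase_def)
  then show ?thesis using ClassH assms(3) by simp
qed (use assms in auto)

text \<open>For \<open>\<H>\<close> and \<open>\<P>\<close> the phases alone show that a nonzero entry has its kernel in the class. For the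
  other classes they do so when no fibre has more than two points, and the reflections reduce to
  that case.\<close>

lemma invariant_vanishes:
  assumes inv: "tensor_invariant A k N T" and N: "2 * k + 3 \<le> N"
    and zero: "\<And>I. I \<in> indices k N \<Longrightarrow> Ker k I \<in> parts A k \<Longrightarrow> T I = 0"
    and I: "I \<in> indices k N"
  shows "T I = 0"
proof -
  have small: "T I = 0" if I: "I \<in> indices k N"
    and card: "A \<in> {ClassS, ClassB, ClassBs} \<Longrightarrow> \<forall>x\<in>points k. card {y \<in> points k. I y = I x} \<le> 2" for I
  proof (rule ccontr)
    assume nz: "T I \<noteq> 0"
    have "admissible A B" if "B \<in> Ker k I" for B
    proof -
      have "\<exists>x\<in>points k. B = {y \<in> points k. I y = I x}"
        using that unfolding Ker_def by (simp only: image_iff)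
      then obtain x where x: "x \<in> points k" and B: "B = {y \<in> points k. I y = I x}" by blast
      have "I x < N" using I x by auto
      then have "T I = (\<Prod>y\<in>B. phase A y) * T I"
        using inv I unfolding tensor_invariant_def phase_invariant_def B by blast
      then have "(\<Prod>y\<in>B. phase A y) = 1" using nz by simp
      moreover have "finite B" "B \<noteq> {}" using x B by auto
      moreover have "card B \<le> 2" if "A \<in> {ClassS, ClassB, ClassBs}" using card[OF that] x B by simp
      ultimately show ?thesis using phase_not_admissible[of B A] by blast
    qed
    then have "Ker k I \<in> parts A k" using Ker_partitions by (simp add: parts_iff)
    then show False using zero[OF I] nz by simp
  qed
  show ?thesis
  proof (cases "A \<in> {ClassS, ClassB, ClassBs}")
    case True
    then have "kernel_invariant k N T" "reflection_invariant k N T"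
      using inv by (simp_all add: tensor_invariant_def)
    then show ?thesis by (rule reflection_invariant_vanishes[OF _ _ N _ I]) (intro small ballI)
  next
    case False
    then show ?thesis using small[OF I] by simp
  qed
qed

text \<open>The entry of \<open>\<rho>\<^sub>N(q)\<close> with row index \<open>I \<circ> Inr\<close> and column index \<open>I \<circ> Inl\<close>.\<close>

definition part_tensor :: "part \<Rightarrow> (nat + nat \<Rightarrow> nat) \<Rightarrow> complex" where
  "part_tensor q I = of_bool (blockwise_const q I)"

lemma part_tensor_kernel_invariant:
  assumes "q \<in> partitions k"
  shows "kernel_invariant k N (part_tensor q)"
  unfolding kernel_invariant_def part_tensor_def by (simp flip: coarser_Ker_iff[OF assms])

text \<open>A fibre of an index that is constant on the blocks of \<open>q\<close> is a union of such blocks, and the phases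
  of an admissible block multiply to 1.\<close>

lemma part_tensor_phase_invariant:
  assumes "q \<in> parts A k"
  shows "phase_invariant A k N (part_tensor q)"
  unfolding phase_invariant_def
proof (intro ballI allI impI)
  fix I a
  have q: "q \<in> partitions k" using assms by (rule parts_partitions)
  show "part_tensor q I = (\<Prod>x\<in>{x \<in> points k. I x = a}. phase A x) * part_tensor q I"
  proof (cases "blockwise_const q I")
    case True
    have "(\<Prod>x\<in>{x \<in> points k. I x = a}. phase A x) = (\<Prod>x\<in>points k. if I x = a then phase A x else 1)"
      by (rule prod.inter_filter) simp
    also have "\<dots> = (\<Prod>B\<in>q. \<Prod>x\<in>B. if I x = a then phase A x else 1)"
      using q by (intro prod.partition) (simp_all add: partitions_def)
    also have "\<dots> = (\<Prod>B\<in>q. 1)"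
    proof (rule prod.cong)
      fix B assume B: "B \<in> q"
      obtain x where x: "x \<in> B" using partitions_blockD(3)[OF q B] by blast
      have "(\<Prod>y\<in>B. if I y = a then phase A y else 1) = (\<Prod>y\<in>B. if I x = a then phase A y else 1)"
        using blockwise_constD[OF True B x] by (intro prod.cong) auto
      also have "\<dots> = 1" using phase_admissible[of A B] assms B by (cases "I x = a") (simp_all add: parts_iff)
      finally show "(\<Prod>y\<in>B. if I y = a then phase A y else 1) = 1" .
    qed simp
    finally show ?thesis by simp
  qed (simp add: part_tensor_def)
qed

text \<open>The sum over the colourings of \<open>q\<close> factorizes over the blocks, and a block of one or two points
  contributes a row sum or an entry of the square of the reflection.\<close>

lemma part_tensor_reflection_invariant:
  assumes q: "q \<in> partitions k" and two: "\<And>B. B \<in> q \<Longrightarrow> card B \<le> 2"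
  shows "reflection_invariant k N (part_tensor q)"
  unfolding reflection_invariant_def
proof (intro allI impI ballI)
  fix a b c d I assume N: "a < N" "b < N" "c < N" "d < N" and dist: "distinct [a, b, c, d]"
    and I: "I \<in> indices k N"
  let ?r = "reflection a b c d"
  have factor: "(\<Sum>y<N. \<Prod>x\<in>B. ?r (I x) y) = of_bool (\<forall>x\<in>B. \<forall>y\<in>B. I x = I y)" if B: "B \<in> q" for B
  proof -
    have IN: "I x < N" if "x \<in> B" for x using that I partitions_blockD(1)[OF q B] by auto
    have "card B \<noteq> 0" using partitions_blockD(2,3)[OF q B] by simp
    then consider "card B = 1" | "card B = 2" using two[OF B] by fastforce
    then show ?thesis
    proof cases
      case 1
      then obtain x where "B = {x}" by (auto simp: card_1_singleton_iff)
      then show ?thesis using reflection_row_sum[OF dist N IN] by simp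
    next
      case 2
      then obtain x y where "B = {x, y}" "x \<noteq> y" by (auto simp: card_2_iff)
      moreover have "(\<forall>u\<in>{x, y}. \<forall>v\<in>{x, y}. I u = I v) \<longleftrightarrow> I x = I y"
      proof
        assume eq: "I x = I y"
        show "\<forall>u\<in>{x, y}. \<forall>v\<in>{x, y}. I u = I v"
        proof (intro ballI)
          fix u v assume "u \<in> {x, y}" "v \<in> {x, y}"
          then show "I u = I v" by (elim insertE emptyE) (simp_all only: eq)
        qed
      qed blast
      ultimately show ?thesis using reflection_involution[OF dist N IN IN, of x y] by simp
    qed
  qed
  have "(\<Sum>J\<in>indices k N. (\<Prod>x\<in>points k. ?r (I x) (J x)) * part_tensor q J)
    = (\<Sum>J\<in>colourings k {..<N} q. \<Prod>x\<in>points k. ?r (I x) (J x))"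
    unfolding colourings_def part_tensor_def
    by (subst sum.inter_filter) (auto intro!: finite_PiE sum.cong)
  also have "\<dots> = (\<Sum>h\<in>q \<rightarrow>\<^sub>E {..<N}. \<Prod>x\<in>points k. ?r (I x) (h (block q x)))"
    by (subst sum.reindex_bij_betw[OF bij_betw_colourings[OF q], symmetric]) simp
  also have "\<dots> = (\<Sum>h\<in>q \<rightarrow>\<^sub>E {..<N}. \<Prod>B\<in>q. \<Prod>x\<in>B. ?r (I x) (h B))"
  proof (rule sum.cong[OF refl])
    fix h
    have "(\<Prod>x\<in>points k. ?r (I x) (h (block q x))) = (\<Prod>B\<in>q. \<Prod>x\<in>B. ?r (I x) (h (block q x)))"
      using q by (intro prod.partition) (simp_all add: partitions_def)
    also have "\<dots> = (\<Prod>B\<in>q. \<Prod>x\<in>B. ?r (I x) (h B))"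
      by (intro prod.cong refl) (simp add: block_eq[OF q])
    finally show "(\<Prod>x\<in>points k. ?r (I x) (h (block q x))) = (\<Prod>B\<in>q. \<Prod>x\<in>B. ?r (I x) (h B))" .
  qed
  also have "\<dots> = (\<Prod>B\<in>q. \<Sum>y<N. \<Prod>x\<in>B. ?r (I x) y)"
    by (rule prod_sum_PiE[symmetric]) (simp_all add: partitionsD(2)[OF q])
  also have "\<dots> = (\<Prod>B\<in>q. of_bool (\<forall>x\<in>B. \<forall>y\<in>B. I x = I y))" by (intro prod.cong refl factor)
  also have "\<dots> = part_tensor q I"
  proof (cases "blockwise_const q I")
    case True
    have "(\<Prod>B\<in>q. of_bool (\<forall>x\<in>B. \<forall>y\<in>B. I x = I y) :: complex) = 1"
    proof (intro prod.neutral ballI)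
      fix B assume "B \<in> q"
      then have "\<forall>x\<in>B. \<forall>y\<in>B. I x = I y" using True unfolding blockwise_const_def by blast
      then show "(of_bool (\<forall>x\<in>B. \<forall>y\<in>B. I x = I y) :: complex) = 1" by (simp only: of_bool_eq_1_iff)
    qed
    then show ?thesis using True by (simp add: part_tensor_def)
  next
    case False
    then obtain B where B: "B \<in> q" "\<not> (\<forall>x\<in>B. \<forall>y\<in>B. I x = I y)"
      unfolding blockwise_const_def by blast
    from B(2) have "(of_bool (\<forall>x\<in>B. \<forall>y\<in>B. I x = I y) :: complex) = 0"
      by (simp only: of_bool_eq_0_iff simp_thms)
    then have "(\<Prod>B\<in>q. of_bool (\<forall>x\<in>B. \<forall>y\<in>B. I x = I y) :: complex) = 0"
      by (rule prod_zero[OF partitionsD(2)[OF q] bexI[OF _ B(1)]])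
    then show ?thesis using False by (simp add: part_tensor_def)
  qed
  finally show "part_tensor q I = (\<Sum>J\<in>indices k N. (\<Prod>x\<in>points k. ?r (I x) (J x)) * part_tensor q J)" ..
qed

lemma part_tensor_invariant:
  assumes q: "q \<in> parts A k"
  shows "tensor_invariant A k N (part_tensor q)"
proof -
  have "card B \<le> 2" if "A \<in> {ClassS, ClassB, ClassBs}" "B \<in> q" for B
    using that q by (auto simp: parts_iff)
  then have "A \<in> {ClassS, ClassB, ClassBs} \<Longrightarrow> reflection_invariant k N (part_tensor q)"
    by (rule part_tensor_reflection_invariant[OF parts_partitions[OF q]])
  then show ?thesis
    using part_tensor_kernel_invariant[OF parts_partitions[OF q]] part_tensor_phase_invariant[OF q]
    unfolding tensor_invariant_def by blast
qed

lemma tensor_invariant_diff_sum: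
  assumes T: "tensor_invariant A k N T" and R: "\<And>q. q \<in> S \<Longrightarrow> tensor_invariant A k N (R q)"
  shows "tensor_invariant A k N (\<lambda>I. T I - (\<Sum>q\<in>S. c q * R q I))" (is "tensor_invariant A k N ?D")
  unfolding tensor_invariant_def
proof (intro conjI impI)
  show "kernel_invariant k N ?D"
    unfolding kernel_invariant_def
  proof (intro ballI impI)
    fix I J assume IJ: "I \<in> indices k N" "J \<in> indices k N" "Ker k I = Ker k J"
    have "T I = T J" using T IJ unfolding tensor_invariant_def kernel_invariant_def by blast
    moreover have "R q I = R q J" if "q \<in> S" for q
      using R[OF that] IJ unfolding tensor_invariant_def kernel_invariant_def by blast
    ultimately show "?D I = ?D J" by simp
  qed
  show "phase_invariant A k N ?D"
    unfolding phase_invariant_def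
  proof (intro ballI allI impI)
    fix I a assume I: "I \<in> indices k N" and a: "a < N"
    define P where "P = (\<Prod>x\<in>{x \<in> points k. I x = a}. phase A x)"
    have T': "T I = P * T I"
      using T I a unfolding tensor_invariant_def phase_invariant_def P_def by blast
    have "R q I = P * R q I" if "q \<in> S" for q
      using R[OF that] I a unfolding tensor_invariant_def phase_invariant_def P_def by blast
    then have "(\<Sum>q\<in>S. c q * R q I) = (\<Sum>q\<in>S. c q * (P * R q I))" by (intro sum.cong) auto
    also have "\<dots> = P * (\<Sum>q\<in>S. c q * R q I)" by (simp add: sum_distrib_left mult_ac)
    finally show "?D I = P * ?D I" using T' by (metis right_diff_distrib)
  qed
  assume A: "A \<in> {ClassS, ClassB, ClassBs}"
  show "reflection_invariant k N ?D"
    unfolding reflection_invariant_def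
  proof (intro allI impI ballI)
    fix a b c' d I assume N: "a < N" "b < N" "c' < N" "d < N" and dist: "distinct [a, b, c', d]"
      and I: "I \<in> indices k N"
    define w where "w J = (\<Prod>x\<in>points k. reflection a b c' d (I x) (J x))" for J
    have T': "T I = (\<Sum>J\<in>indices k N. w J * T J)"
      using T A N dist I unfolding tensor_invariant_def reflection_invariant_def w_def by blast
    have R': "R q I = (\<Sum>J\<in>indices k N. w J * R q J)" if "q \<in> S" for q
      using R[OF that] A N dist I unfolding tensor_invariant_def reflection_invariant_def w_def by blast
    have "(\<Sum>q\<in>S. c q * R q I) = (\<Sum>q\<in>S. \<Sum>J\<in>indices k N. w J * (c q * R q J))"
      using R' by (intro sum.cong) (auto simp: sum_distrib_left mult_ac)
    also have "\<dots> = (\<Sum>J\<in>indices k N. w J * (\<Sum>q\<in>S. c q * R q J))"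
      by (subst sum.swap) (simp add: sum_distrib_left)
    finally show "?D I = (\<Sum>J\<in>indices k N. w J * ?D J)"
      using T' by (simp add: right_diff_distrib sum_subtractf)
  qed
qed

text \<open>Labelling each block by one of its points shows that \<open>2 k\<close> values suffice.\<close>

lemma Ker_surj:
  assumes p: "p \<in> partitions k" and N: "2 * k \<le> N"
  shows "\<exists>I\<in>indices k N. Ker k I = p"
proof -
  obtain e where e: "inj_on e (points k)" "e ` points k \<subseteq> {..<N}"
    using card_le_inj[of "points k" "{..<N}"] N by (auto simp: card_points)
  define f where "f B = e (SOME y. y \<in> B)" for B
  have some: "(SOME y. y \<in> B) \<in> B" if "B \<in> p" for B
    using partitions_blockD(3)[OF p that] by (simp add: some_in_eq)
  have f_inj: "B = C" if "B \<in> p" "C \<in> p" "f B = f C" for B C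
  proof -
    have "(SOME y. y \<in> B) = (SOME y. y \<in> C)"
      using that some[OF that(1)] some[OF that(2)] partitions_blockD(1)[OF p]
      unfolding f_def by (intro inj_onD[OF e(1)]) auto
    then show ?thesis using partitionsD(4)[OF p that(1,2)] some[OF that(1)] some[OF that(2)] by simp
  qed
  define I where "I = (\<lambda>x\<in>points k. f (block p x))"
  have "I \<in> indices k N"
  proof -
    have "f B < N" if "B \<in> p" for B
      using some[OF that] partitions_blockD(1)[OF p that] e(2) by (auto simp: f_def)
    then show ?thesis using block_in(1)[OF p] by (auto simp: I_def)
  qed
  moreover have "Ker k I = p"
  proof (intro coarser_antisym[of k])
    have "blockwise_const p I"
      unfolding blockwise_const_def
    proof (intro ballI)
      fix B x y assume "B \<in> p" "x \<in> B" "y \<in> B"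
      then show "I x = I y" using block_eq[OF p] partitions_blockD(1)[OF p] by (simp add: I_def subset_iff)
    qed
    then show "coarser k p (Ker k I)" using coarser_Ker_iff[OF p] by blast
    show "coarser k (Ker k I) p"
    proof (rule coarser_blocksI[OF Ker_partitions p])
      fix B assume "B \<in> Ker k I"
      then obtain x where x: "x \<in> points k" and B: "B = {y \<in> points k. I y = I x}" by (auto simp: Ker_def)
      have "y \<in> block p x" if "y \<in> B" for y
      proof -
        have y: "y \<in> points k" and "f (block p y) = f (block p x)" using that x by (auto simp: B I_def)
        then have "block p y = block p x" using f_inj block_in(1)[OF p] x by blast
        then show ?thesis using block_in(2)[OF p y] by simp
      qed
      then show "\<exists>C\<in>p. B \<subseteq> C" using block_in(1)[OF p x] by blast
    qed
  qed
  ultimately show ?thesis by blast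
qed

text \<open>Duality: the coefficients are determined by the entries whose kernel lies in the class, which is a
  unitriangular system for the refinement order, and an invariant tensor without such entries is zero.\<close>

theorem invariant_tensor_spanned:
  assumes inv: "tensor_invariant A k N T" and N: "2 * k + 3 \<le> N"
  shows "\<exists>c. \<forall>I\<in>indices k N. T I = (\<Sum>q\<in>parts A k. c q * part_tensor q I)"
proof -
  obtain rep where rep: "\<And>p. p \<in> partitions k \<Longrightarrow> rep p \<in> indices k N \<and> Ker k (rep p) = p"
    using Ker_surj[of _ k N] N by (metis add_leD1)
  have "\<exists>c. \<forall>p\<in>parts A k. (\<Sum>q\<in>parts A k. of_bool (coarser k q p) * c q) = T (rep p)"
  proof (rule unitriangular_solve[where rank = "\<lambda>p. - real (nc p)"])
    fix p q assume "(of_bool (coarser k q p) :: complex) \<noteq> 0"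
    then have qp: "coarser k q p" by (simp split: if_splits)
    show "q = p \<or> - real (nc q) < - real (nc p)"
      using coarser_nc_eq[OF qp] by (cases "nc q \<le> nc p") auto
  qed (simp_all add: coarser_refl parts_partitions)
  then obtain c where c: "\<And>p. p \<in> parts A k \<Longrightarrow>
      (\<Sum>q\<in>parts A k. of_bool (coarser k q p) * c q) = T (rep p)" by blast
  let ?D = "\<lambda>I. T I - (\<Sum>q\<in>parts A k. c q * part_tensor q I)"
  have D: "tensor_invariant A k N ?D"
    by (intro tensor_invariant_diff_sum inv part_tensor_invariant)
  have "?D I = 0" if "I \<in> indices k N" for I
  proof (rule invariant_vanishes[OF D N _ that])
    fix I assume I: "I \<in> indices k N" and K: "Ker k I \<in> parts A k"
    define p where "p = Ker k I"
    have p: "p \<in> parts A k" "p \<in> partitions k" using K parts_partitions by (auto simp: p_def)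
    have "part_tensor q (rep p) = of_bool (coarser k q p)" if "q \<in> parts A k" for q
      using coarser_Ker_iff[OF parts_partitions[OF that], of "rep p"] rep[OF p(2)]
      by (simp add: part_tensor_def)
    then have "(\<Sum>q\<in>parts A k. c q * part_tensor q (rep p)) = T (rep p)"
      unfolding c[OF p(1), symmetric] by (intro sum.cong) (auto simp: mult.commute)
    moreover have "?D I = ?D (rep p)"
      using D I rep[OF p(2)] unfolding tensor_invariant_def kernel_invariant_def p_def by blast
    ultimately show "?D I = 0" by simp
  qed
  then show ?thesis by (intro exI[of _ c]) simp
qed

section \<open>Moments as sums of entries\<close>

lemma sum_lessThan_mult:
  fixes f :: "nat \<Rightarrow> nat \<Rightarrow> complex"
  shows "(\<Sum>i<n * m. f (i div m) (i mod m)) = (\<Sum>a<n. \<Sum>b<m. f a b)"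
proof -
  have "(\<Sum>i<n * m. f (i div m) (i mod m)) = (\<Sum>(a, b)\<in>{..<n} \<times> {..<m}. f a b)"
  proof (rule sum.reindex_bij_witness[where i = "\<lambda>(a, b). a * m + b" and j = "\<lambda>i. (i div m, i mod m)"])
    fix i assume i: "i \<in> {..<n * m}"
    then have "m > 0" by (cases m) auto
    then show "(i div m, i mod m) \<in> {..<n} \<times> {..<m}" using i by (simp add: less_mult_imp_div_less)
  next
    fix ab assume "ab \<in> {..<n} \<times> {..<m}"
    then obtain a b where ab: "ab = (a, b)" "a < n" "b < m" by auto
    have "a * m + b < Suc a * m" using ab by simp
    also have "\<dots> \<le> n * m" using ab by (intro mult_right_mono) auto
    finally show "(case ab of (a, b) \<Rightarrow> a * m + b) \<in> {..<n * m}" using ab by simp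
  qed auto
  then show ?thesis by (simp add: sum.cartesian_product)
qed

lemma mtrace_mult:
  assumes "A \<in> carrier_mat n n" "B \<in> carrier_mat n n"
  shows "mtrace (A * B) = (\<Sum>i<n. \<Sum>j<n. A $$ (i, j) * B $$ (j, i))"
  unfolding mtrace_def using assms
  by (intro sum.cong) (auto simp: scalar_prod_def atLeast0LessThan intro!: sum.cong)

lemma kron_carrier:
  assumes "A \<in> carrier_mat n n" "B \<in> carrier_mat m m"
  shows "kron A B \<in> carrier_mat (n * m) (n * m)"
  using assms by (auto simp: kron_def)

lemma mtrace_kron_mult:
  assumes A: "A \<in> carrier_mat n n" and C: "C \<in> carrier_mat n n"
    and B: "B \<in> carrier_mat m m" and D: "D \<in> carrier_mat m m"
  shows "mtrace (kron A B * kron C D) = mtrace (A * C) * mtrace (B * D)"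
proof -
  have "mtrace (kron A B * kron C D)
    = (\<Sum>i<n * m. \<Sum>j<n * m. kron A B $$ (i, j) * kron C D $$ (j, i))"
    by (rule mtrace_mult[OF kron_carrier[OF A B] kron_carrier[OF C D]])
  also have "\<dots> = (\<Sum>i<n * m. \<Sum>j<n * m.
      (A $$ (i div m, j div m) * B $$ (i mod m, j mod m)) * (C $$ (j div m, i div m) * D $$ (j mod m, i mod m)))"
    using A B C D by (intro sum.cong refl) (auto simp: kron_def)
  also have "\<dots> = (\<Sum>i<n * m. \<Sum>a'<n. \<Sum>b'<m.
      (A $$ (i div m, a') * B $$ (i mod m, b')) * (C $$ (a', i div m) * D $$ (b', i mod m)))"
    by (intro sum.cong refl sum_lessThan_mult[where f = "\<lambda>a' b'. (A $$ (_ div m, a') * B $$ (_ mod m, b')) *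
      (C $$ (a', _ div m) * D $$ (b', _ mod m))"])
  also have "\<dots> = (\<Sum>a<n. \<Sum>b<m. \<Sum>a'<n. \<Sum>b'<m.
      (A $$ (a, a') * B $$ (b, b')) * (C $$ (a', a) * D $$ (b', b)))"
    by (rule sum_lessThan_mult)
  also have "\<dots> = (\<Sum>a<n. \<Sum>a'<n. \<Sum>b<m. \<Sum>b'<m.
      (A $$ (a, a') * C $$ (a', a)) * (B $$ (b, b') * D $$ (b', b)))"
  proof (rule sum.cong[OF refl])
    fix a
    show "(\<Sum>b<m. \<Sum>a'<n. \<Sum>b'<m. (A $$ (a, a') * B $$ (b, b')) * (C $$ (a', a) * D $$ (b', b)))
      = (\<Sum>a'<n. \<Sum>b<m. \<Sum>b'<m. (A $$ (a, a') * C $$ (a', a)) * (B $$ (b, b') * D $$ (b', b)))"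
      by (subst sum.swap) (simp add: mult_ac)
  qed
  also have "\<dots> = mtrace (A * C) * mtrace (B * D)"
    unfolding mtrace_mult[OF A C] mtrace_mult[OF B D]
    by (simp only: sum_distrib_right) (simp only: sum_distrib_left)
  finally show ?thesis .
qed

lemma kron_list_carrier:
  "(\<And>A. A \<in> set As \<Longrightarrow> A \<in> carrier_mat N N) \<Longrightarrow> kron_list As \<in> carrier_mat (N ^ length As) (N ^ length As)"
proof (induction As)
  case (Cons A As)
  then show ?case using kron_carrier[of A N "kron_list As" "N ^ length As"] by (simp add: kron_list_def)
qed (simp add: kron_list_def)

lemma mtrace_kron_list:
  assumes "length As = length Bs" "\<And>A. A \<in> set As \<union> set Bs \<Longrightarrow> A \<in> carrier_mat N N"
  shows "mtrace (kron_list As * kron_list Bs) = (\<Prod>l<length As. mtrace (As ! l * Bs ! l))"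
  using assms
proof (induction As Bs rule: list_induct2)
  case Nil
  then show ?case by (simp add: kron_list_def mtrace_def)
next
  case (Cons A As B Bs)
  have car: "A \<in> carrier_mat N N" "B \<in> carrier_mat N N"
    "kron_list As \<in> carrier_mat (N ^ length As) (N ^ length As)"
    "kron_list Bs \<in> carrier_mat (N ^ length As) (N ^ length As)"
    using Cons.prems Cons.hyps kron_list_carrier[of As N] kron_list_carrier[of Bs N] by auto
  have "mtrace (kron_list (A # As) * kron_list (B # Bs))
    = mtrace (kron A (kron_list As) * kron B (kron_list Bs))" by (simp add: kron_list_def)
  also have "\<dots> = mtrace (A * B) * (\<Prod>l<length As. mtrace (As ! l * Bs ! l))"
    using mtrace_kron_mult[OF car] Cons by simp
  also have "\<dots> = (\<Prod>l<length (A # As). mtrace ((A # As) ! l * (B # Bs) ! l))"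
    by (simp add: prod.lessThan_Suc_shift del: prod.lessThan_Suc)
  finally show ?case .
qed

lemma mtrace_elem_mat:
  assumes "A \<in> carrier_mat N N" "i < N" "j < N"
  shows "mtrace (A * elem_mat N i j) = A $$ (j, i)"
proof -
  have "mtrace (A * elem_mat N i j) = (\<Sum>a<N. \<Sum>b<N. A $$ (a, b) * elem_mat N i j $$ (b, a))"
    using assms(1) by (intro mtrace_mult) (auto simp: elem_mat_def)
  also have "\<dots> = (\<Sum>a<N. \<Sum>b<N. if b = i then (if a = j then A $$ (a, b) else 0) else 0)"
    by (intro sum.cong) (auto simp: elem_mat_def)
  also have "\<dots> = A $$ (j, i)" using assms by simp
  finally show ?thesis .
qed

abbreviation flip :: "nat + nat \<Rightarrow> nat + nat" where
  "flip \<equiv> case_sum Inr Inl"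

lemma flip_flip [simp]: "flip (flip x) = x"
  by (cases x) auto

lemma flip_points [simp]: "flip x \<in> points k \<longleftrightarrow> x \<in> points k"
  by (cases x) auto

lemma transpose_partitions:
  assumes "p \<in> partitions k"
  shows "transpose_part p \<in> partitions k"
proof -
  have "inj_on flip (points k)" by (rule inj_on_inverseI[of _ flip]) simp
  then have "partition_on (flip ` points k) ((`) flip ` p - {{}})"
    using assms by (intro partition_on_inj_image) (simp_all add: partitions_def)
  moreover have "flip ` points k = points k"
  proof (intro equalityI subsetI)
    fix x assume "x \<in> points k"
    then show "x \<in> flip ` points k" by (intro image_eqI[of _ _ "flip x"]) simp_all
  qed auto
  moreover have "(`) flip ` p - {{}} = transpose_part p"
    using partitionsD(3)[OF assms] by (auto simp: transpose_part_def)
  ultimately show ?thesis by (simp add: partitions_def)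
qed

lemma blockwise_const_transpose:
  "blockwise_const (transpose_part p) I \<longleftrightarrow> blockwise_const p (\<lambda>x. I (flip x))"
  by (simp add: blockwise_const_def transpose_part_def)

text \<open>Row indices are labelled by the bottom points and column indices by the top points; the
  transposition of \<open>p\<close> compensates the exchange of rows and columns in the trace.\<close>

lemma mtrace_rho:
  assumes Xs: "\<And>A. A \<in> set Xs \<Longrightarrow> A \<in> carrier_mat N N" and k: "length Xs = k" and p: "p \<in> partitions k"
  shows "mtrace (kron_list Xs * rho N k (transpose_part p))
    = (\<Sum>I\<in>colourings k {..<N} p. \<Prod>l<k. Xs ! l $$ (I (Inr l), I (Inl l)))"
proof -
  define E where "E I = map (\<lambda>l. elem_mat N (I (Inr l)) (I (Inl l))) [0..<k]" for I :: "nat + nat \<Rightarrow> nat"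
  let ?S = "colourings k {..<N} (transpose_part p)"
  have S: "{I \<in> indices k N. coarser k (transpose_part p) (Ker k I)} = ?S"
    by (simp add: colourings_def coarser_Ker_iff[OF transpose_partitions[OF p]])
  have K: "kron_list Xs \<in> carrier_mat (N ^ k) (N ^ k)" using kron_list_carrier[OF Xs] k by blast
  have E: "kron_list (E I) \<in> carrier_mat (N ^ k) (N ^ k)" for I
  proof -
    have "kron_list (E I) \<in> carrier_mat (N ^ length (E I)) (N ^ length (E I))"
      by (rule kron_list_carrier) (auto simp: E_def elem_mat_def)
    then show ?thesis by (simp add: E_def)
  qed
  have rho: "rho N k (transpose_part p) \<in> carrier_mat (N ^ k) (N ^ k)" by (simp add: rho_def)
  have "mtrace (kron_list Xs * rho N k (transpose_part p))
    = (\<Sum>i<N ^ k. \<Sum>j<N ^ k. \<Sum>I\<in>?S. kron_list Xs $$ (i, j) * kron_list (E I) $$ (j, i))"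
    unfolding mtrace_mult[OF K rho]
    by (intro sum.cong refl) (simp add: rho_def S E_def sum_distrib_left)
  also have "\<dots> = (\<Sum>I\<in>?S. \<Sum>i<N ^ k. \<Sum>j<N ^ k. kron_list Xs $$ (i, j) * kron_list (E I) $$ (j, i))"
  proof -
    have "(\<Sum>i<N ^ k. \<Sum>j<N ^ k. \<Sum>I\<in>?S. kron_list Xs $$ (i, j) * kron_list (E I) $$ (j, i))
      = (\<Sum>i<N ^ k. \<Sum>I\<in>?S. \<Sum>j<N ^ k. kron_list Xs $$ (i, j) * kron_list (E I) $$ (j, i))"
      by (intro sum.cong refl sum.swap)
    then show ?thesis by (simp add: sum.swap[of _ ?S])
  qed
  also have "\<dots> = (\<Sum>I\<in>?S. mtrace (kron_list Xs * kron_list (E I)))"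
    by (simp add: mtrace_mult[OF K E])
  also have "\<dots> = (\<Sum>I\<in>?S. \<Prod>l<k. Xs ! l $$ (I (Inl l), I (Inr l)))"
  proof (rule sum.cong[OF refl])
    fix I assume "I \<in> ?S"
    then have I: "I \<in> indices k N" by (simp add: colourings_def)
    have "mtrace (kron_list Xs * kron_list (E I)) = (\<Prod>l<length Xs. mtrace (Xs ! l * E I ! l))"
      by (rule mtrace_kron_list[of _ _ N]) (use Xs k in \<open>auto simp: E_def elem_mat_def\<close>)
    also have "\<dots> = (\<Prod>l<k. mtrace (Xs ! l * E I ! l))" by (simp add: k)
    also have "\<dots> = (\<Prod>l<k. Xs ! l $$ (I (Inl l), I (Inr l)))"
    proof (rule prod.cong[OF refl])
      fix l assume "l \<in> {..<k}"
      then have l: "l < k" by simp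
      have "I (Inl l) < N" "I (Inr l) < N" using PiE_mem[OF I, of "Inl l"] PiE_mem[OF I, of "Inr l"] l by simp_all
      then show "mtrace (Xs ! l * E I ! l) = Xs ! l $$ (I (Inl l), I (Inr l))"
        using mtrace_elem_mat[OF Xs] l k by (simp add: E_def)
    qed
    finally show "mtrace (kron_list Xs * kron_list (E I)) = (\<Prod>l<k. Xs ! l $$ (I (Inl l), I (Inr l)))" .
  qed
  also have "\<dots> = (\<Sum>I\<in>colourings k {..<N} p. \<Prod>l<k. Xs ! l $$ (I (Inr l), I (Inl l)))"
  proof (rule sum.reindex_bij_witness[where i = "\<lambda>I. \<lambda>x\<in>points k. I (flip x)"
        and j = "\<lambda>I. \<lambda>x\<in>points k. I (flip x)"])
    have twice: "(\<lambda>x\<in>points k. (\<lambda>x\<in>points k. I (flip x)) (flip x)) = I" if "I \<in> colourings k {..<N} q" for I q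
    proof
      fix x
      have "I \<in> indices k N" using that by (simp add: colourings_def)
      then show "(\<lambda>x\<in>points k. (\<lambda>x\<in>points k. I (flip x)) (flip x)) x = I x"
        using PiE_arb[of I "points k" "\<lambda>_. {..<N}" x] by (cases "x \<in> points k") simp_all
    qed
    have turn: "(\<lambda>x\<in>points k. I (flip x)) \<in> colourings k {..<N} q"
      if "I \<in> indices k N" "blockwise_const q (\<lambda>x. I (flip x))" "q \<in> partitions k" for I q
    proof -
      have "blockwise_const q (\<lambda>x\<in>points k. I (flip x))"
        using that(2) blockwise_const_cong[OF that(3), of "\<lambda>x\<in>points k. I (flip x)" "\<lambda>x. I (flip x)"] by simp
      moreover have "(\<lambda>x\<in>points k. I (flip x)) \<in> indices k N"
        using PiE_mem[OF that(1)] by (intro restrict_PiE_iff[THEN iffD2]) simp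
      ultimately show ?thesis by (simp add: colourings_def)
    qed
    fix I
    show "(\<lambda>x\<in>points k. (\<lambda>x\<in>points k. I (flip x)) (flip x)) = I" if "I \<in> ?S" using twice[OF that] .
    show "(\<lambda>x\<in>points k. (\<lambda>x\<in>points k. I (flip x)) (flip x)) = I" if "I \<in> colourings k {..<N} p"
      using twice[OF that] .
    show "(\<lambda>x\<in>points k. I (flip x)) \<in> colourings k {..<N} p" if "I \<in> ?S"
      by (rule turn) (use that p in \<open>simp_all add: colourings_def blockwise_const_transpose\<close>)
    show "(\<lambda>x\<in>points k. I (flip x)) \<in> ?S" if "I \<in> colourings k {..<N} p"
      by (rule turn) (use that transpose_partitions[OF p] in
          \<open>simp_all add: colourings_def blockwise_const_transpose\<close>)
    show "(\<Prod>l<k. Xs ! l $$ ((\<lambda>x\<in>points k. I (flip x)) (Inr l), (\<lambda>x\<in>points k. I (flip x)) (Inl l)))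
      = (\<Prod>l<k. Xs ! l $$ (I (Inl l), I (Inr l)))"
      by (intro prod.cong) auto
  qed
  finally show ?thesis .
qed

text \<open>The entry of \<open>E[M\<^sub>1 \<otimes> \<dots> \<otimes> M\<^sub>k]\<close> with row index \<open>I \<circ> Inr\<close> and column index \<open>I \<circ> Inl\<close>.\<close>

definition expected_entry :: "'w measure \<Rightarrow> ('w \<Rightarrow> complex mat) list \<Rightarrow> (nat + nat \<Rightarrow> nat) \<Rightarrow> complex" where
  "expected_entry \<Omega> Xs I = (\<integral>\<omega>. (\<Prod>l<length Xs. (Xs ! l) \<omega> $$ (I (Inr l), I (Inl l))) \<partial>\<Omega>)"

lemma expected_entry_map:
  assumes "length js = k"
  shows "expected_entry \<Omega> (map X js) I = (\<integral>\<omega>. (\<Prod>l<k. X (js ! l) \<omega> $$ (I (Inr l), I (Inl l))) \<partial>\<Omega>)"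
  unfolding expected_entry_def using assms
  by (intro Bochner_Integration.integral_cong prod.cong) auto

text \<open>By induction from \<open>\<bar>x y\<bar>\<^sup>n \<le> \<bar>x\<bar>\<^bsup>2 n\<^esup> + \<bar>y\<bar>\<^bsup>2 n\<^esup>\<close>, which is why moments of all orders are
  carried along.\<close>

lemma integrable_prod_moments:
  fixes f :: "'l \<Rightarrow> 'w \<Rightarrow> complex"
  assumes \<Omega>: "prob_space \<Omega>" and L: "finite L"
    and meas: "\<And>l. l \<in> L \<Longrightarrow> f l \<in> borel_measurable \<Omega>"
    and int: "\<And>l n. l \<in> L \<Longrightarrow> integrable \<Omega> (\<lambda>\<omega>. norm (f l \<omega>) ^ (n :: nat))"
  shows "integrable \<Omega> (\<lambda>\<omega>. \<Prod>l\<in>L. f l \<omega>)"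
proof -
  interpret prob_space \<Omega> by fact
  have "integrable \<Omega> (\<lambda>\<omega>. norm (\<Prod>l\<in>L. f l \<omega>) ^ n)" for n :: nat
    using L meas int
  proof (induction L arbitrary: n rule: finite_induct)
    case (insert l L)
    have 1: "integrable \<Omega> (\<lambda>\<omega>. norm (f l \<omega>) ^ (2 * n))" using insert.prems(2) by blast
    have 2: "integrable \<Omega> (\<lambda>\<omega>. norm (\<Prod>l\<in>L. f l \<omega>) ^ (2 * n))"
      using insert.prems by (intro insert.IH) auto
    have m: "(\<lambda>\<omega>. \<Prod>l\<in>insert l L. f l \<omega>) \<in> borel_measurable \<Omega>"
      using insert.prems(1) by (intro borel_measurable_prod) auto
    have bound: "norm (\<Prod>l\<in>insert l L. f l \<omega>) ^ n
      \<le> norm (f l \<omega>) ^ (2 * n) + norm (\<Prod>l\<in>L. f l \<omega>) ^ (2 * n)" for \<omega>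
    proof -
      define a b where "a = norm (f l \<omega>) ^ n" and "b = norm (\<Prod>l\<in>L. f l \<omega>) ^ n"
      have "0 \<le> a" "0 \<le> b" by (simp_all add: a_def b_def)
      then have "a * b \<le> a\<^sup>2 + b\<^sup>2"
        using sum_squares_bound[of a b] mult_nonneg_nonneg[OF \<open>0 \<le> a\<close> \<open>0 \<le> b\<close>] by linarith
      then show ?thesis
        using insert.hyps by (simp add: a_def b_def norm_mult power_mult_distrib power_mult mult.commute[of 2 n])
    qed
    show ?case
    proof (rule Bochner_Integration.integrable_bound[OF Bochner_Integration.integrable_add[OF 1 2]])
      show "(\<lambda>\<omega>. norm (\<Prod>l\<in>insert l L. f l \<omega>) ^ n) \<in> borel_measurable \<Omega>"
        by (intro borel_measurable_power measurable_compose[OF m borel_measurable_norm])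
      show "AE \<omega> in \<Omega>. norm (norm (\<Prod>l\<in>insert l L. f l \<omega>) ^ n)
        \<le> norm (norm (f l \<omega>) ^ (2 * n) + norm (\<Prod>l\<in>L. f l \<omega>) ^ (2 * n))"
        using bound by (intro AE_I2) simp
    qed
  qed simp
  from this[of 1] have "integrable \<Omega> (\<lambda>\<omega>. norm (\<Prod>l\<in>L. f l \<omega>))" by simp
  moreover have "(\<lambda>\<omega>. \<Prod>l\<in>L. f l \<omega>) \<in> borel_measurable \<Omega>" by (intro borel_measurable_prod meas)
  ultimately show ?thesis using integrable_norm_iff by blast
qed

lemma indices_less:
  assumes "I \<in> indices k N" "l < k"
  shows "I (Inl l) < N" "I (Inr l) < N"
  using PiE_mem[OF assms(1), of "Inl l"] PiE_mem[OF assms(1), of "Inr l"] assms(2) by simp_all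

lemma integrable_entries:
  assumes \<Omega>: "prob_space \<Omega>" and Xs: "\<And>X. X \<in> set Xs \<Longrightarrow> random_matrix \<Omega> N X"
    and ab: "\<And>l. l < length Xs \<Longrightarrow> a l < N \<and> b l < N"
  shows "integrable \<Omega> (\<lambda>\<omega>. \<Prod>l<length Xs. (Xs ! l) \<omega> $$ (a l, b l))"
proof (rule integrable_prod_moments[OF \<Omega>])
  fix l n assume "l \<in> {..<length Xs}"
  then have "random_matrix \<Omega> N (Xs ! l)" "a l < N" "b l < N" using Xs ab by auto
  then show "(\<lambda>\<omega>. (Xs ! l) \<omega> $$ (a l, b l)) \<in> borel_measurable \<Omega>"
    "integrable \<Omega> (\<lambda>\<omega>. norm ((Xs ! l) \<omega> $$ (a l, b l)) ^ n)"
    unfolding random_matrix_def by blast+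
qed simp

lemma moment_expand:
  assumes \<Omega>: "prob_space \<Omega>" and Xs: "\<And>X. X \<in> set Xs \<Longrightarrow> random_matrix \<Omega> N X"
    and k: "length Xs = k" and p: "p \<in> partitions k"
  shows "moment \<Omega> N p Xs
    = (\<Sum>I\<in>colourings k {..<N} p. expected_entry \<Omega> Xs I) / of_nat N ^ nc (join k p (id_part k))"
proof -
  have "(\<integral>\<omega>. mtrace (kron_list (map (\<lambda>X. X \<omega>) Xs) * rho N k (transpose_part p)) \<partial>\<Omega>)
    = (\<integral>\<omega>. (\<Sum>I\<in>colourings k {..<N} p. \<Prod>l<k. (Xs ! l) \<omega> $$ (I (Inr l), I (Inl l))) \<partial>\<Omega>)"
  proof (rule Bochner_Integration.integral_cong[OF refl])
    fix \<omega> assume \<omega>: "\<omega> \<in> space \<Omega>"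
    have "mtrace (kron_list (map (\<lambda>X. X \<omega>) Xs) * rho N k (transpose_part p))
      = (\<Sum>I\<in>colourings k {..<N} p. \<Prod>l<k. map (\<lambda>X. X \<omega>) Xs ! l $$ (I (Inr l), I (Inl l)))"
      using Xs \<omega> k by (intro mtrace_rho p) (auto simp: random_matrix_def)
    also have "\<dots> = (\<Sum>I\<in>colourings k {..<N} p. \<Prod>l<k. (Xs ! l) \<omega> $$ (I (Inr l), I (Inl l)))"
      using k by (intro sum.cong prod.cong refl) simp
    finally show "mtrace (kron_list (map (\<lambda>X. X \<omega>) Xs) * rho N k (transpose_part p))
      = (\<Sum>I\<in>colourings k {..<N} p. \<Prod>l<k. (Xs ! l) \<omega> $$ (I (Inr l), I (Inl l)))" .
  qed
  also have "\<dots> = (\<Sum>I\<in>colourings k {..<N} p. expected_entry \<Omega> Xs I)"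
    unfolding expected_entry_def k
  proof (rule Bochner_Integration.integral_sum)
    fix I assume "I \<in> colourings k {..<N} p"
    then have "I \<in> indices k N" by (simp add: colourings_def)
    then show "integrable \<Omega> (\<lambda>\<omega>. \<Prod>l<k. (Xs ! l) \<omega> $$ (I (Inr l), I (Inl l)))"
      using integrable_entries[where Xs = Xs and a = "\<lambda>l. I (Inr l)" and b = "\<lambda>l. I (Inl l)", OF \<Omega> Xs] indices_less k by simp
  qed
  finally show ?thesis by (simp add: moment_def Let_def k)
qed

section \<open>Invariance of the expected entries\<close>

lemma expected_entry_joint_law:
  assumes meas: "\<And>l a b. l < length Xs \<Longrightarrow> a < N \<Longrightarrow> b < N \<Longrightarrow> (\<lambda>\<omega>. (Xs ! l) \<omega> $$ (a, b)) \<in> borel_measurable \<Omega>"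
    and I: "I \<in> indices (length Xs) N"
  shows "expected_entry \<Omega> Xs I
    = (\<integral>f. (\<Prod>l<length Xs. f (l, I (Inr l), I (Inl l))) \<partial>joint_law \<Omega> N Xs)"
proof -
  let ?S = "{..<length Xs} \<times> {..<N} \<times> {..<N}"
  have S: "(l, I (Inr l), I (Inl l)) \<in> ?S" if "l < length Xs" for l
    using that indices_less[OF I that] by simp
  have "(\<lambda>\<omega>. \<lambda>s\<in>?S. (case s of (l, a, b) \<Rightarrow> (Xs ! l) \<omega> $$ (a, b))) \<in> measurable \<Omega> (PiM ?S (\<lambda>_. borel))"
    by (rule measurable_restrict) (auto intro: meas)
  moreover have "(\<lambda>f. \<Prod>l<length Xs. f (l, I (Inr l), I (Inl l)) :: complex) \<in> borel_measurable (PiM ?S (\<lambda>_. borel))"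
    by (intro borel_measurable_prod measurable_component_singleton) (use S in simp)
  ultimately have "(\<integral>f. (\<Prod>l<length Xs. f (l, I (Inr l), I (Inl l))) \<partial>joint_law \<Omega> N Xs)
    = (\<integral>\<omega>. (\<Prod>l<length Xs. (\<lambda>s\<in>?S. (case s of (l, a, b) \<Rightarrow> (Xs ! l) \<omega> $$ (a, b))) (l, I (Inr l), I (Inl l))) \<partial>\<Omega>)"
    unfolding joint_law_def Let_def by (rule integral_distr)
  also have "\<dots> = expected_entry \<Omega> Xs I"
    unfolding expected_entry_def
    by (intro Bochner_Integration.integral_cong prod.cong refl) (use S in simp)
  finally show ?thesis ..
qed

lemma conj_entry:
  fixes g X h :: "complex mat"
  assumes "g \<in> carrier_mat N N" "X \<in> carrier_mat N N" "h \<in> carrier_mat N N" "a < N" "b < N"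
  shows "(g * X * h) $$ (a, b) = (\<Sum>(a', b')\<in>{..<N} \<times> {..<N}. g $$ (a, a') * h $$ (b', b) * X $$ (a', b'))"
proof -
  have "(g * X * h) $$ (a, b) = (\<Sum>a'<N. g $$ (a, a') * (\<Sum>b'<N. X $$ (a', b') * h $$ (b', b)))"
    using assms by (simp add: scalar_prod_def atLeast0LessThan)
  also have "\<dots> = (\<Sum>a'<N. \<Sum>b'<N. g $$ (a, a') * h $$ (b', b) * X $$ (a', b'))"
    unfolding sum_distrib_left by (intro sum.cong refl) (simp only: mult_ac)
  finally show ?thesis by (simp add: sum.cartesian_product)
qed

text \<open>Conjugating all factors by \<open>g\<close>, with inverse \<open>h\<close>, acts separately on each index of the tensor
  product; this is the matrix acting on the index at the point \<open>x\<close>.\<close>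

definition leg :: "complex mat \<Rightarrow> complex mat \<Rightarrow> nat + nat \<Rightarrow> nat \<Rightarrow> nat \<Rightarrow> complex" where
  "leg g h x a b = (case x of Inl _ \<Rightarrow> h $$ (b, a) | Inr _ \<Rightarrow> g $$ (a, b))"

lemma prod_points: "(\<Prod>x\<in>points k. f x) = (\<Prod>l<k. f (Inr l) * f (Inl l) :: complex)"
  by (simp add: points_def prod.Plus prod.distrib)

lemma expected_entry_conj:
  assumes \<Omega>: "prob_space \<Omega>" and Xs: "\<And>j. j \<in> set js \<Longrightarrow> random_matrix \<Omega> N (X j)" and k: "length js = k"
    and g: "g \<in> carrier_mat N N" and h: "h \<in> carrier_mat N N" and I: "I \<in> indices k N"
  shows "expected_entry \<Omega> (map (\<lambda>j \<omega>. g * X j \<omega> * h) js) I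
    = (\<Sum>J\<in>indices k N. (\<Prod>x\<in>points k. leg g h x (I x) (J x)) * expected_entry \<Omega> (map X js) J)"
proof -
  have "(\<Prod>l<k. (g * X (js ! l) \<omega> * h) $$ (I (Inr l), I (Inl l)))
    = (\<Sum>J\<in>indices k N. (\<Prod>x\<in>points k. leg g h x (I x) (J x)) * (\<Prod>l<k. X (js ! l) \<omega> $$ (J (Inr l), J (Inl l))))"
    if \<omega>: "\<omega> \<in> space \<Omega>" for \<omega>
  proof -
    have "(\<Prod>l<k. (g * X (js ! l) \<omega> * h) $$ (I (Inr l), I (Inl l)))
      = (\<Prod>l<k. \<Sum>ab\<in>{..<N} \<times> {..<N}. g $$ (I (Inr l), fst ab) * h $$ (snd ab, I (Inl l)) * X (js ! l) \<omega> $$ ab)"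
    proof (rule prod.cong[OF refl])
      fix l assume "l \<in> {..<k}"
      then have l: "l < k" by simp
      have "X (js ! l) \<omega> \<in> carrier_mat N N" using Xs[of "js ! l"] l k \<omega> by (simp add: random_matrix_def)
      then show "(g * X (js ! l) \<omega> * h) $$ (I (Inr l), I (Inl l))
        = (\<Sum>ab\<in>{..<N} \<times> {..<N}. g $$ (I (Inr l), fst ab) * h $$ (snd ab, I (Inl l)) * X (js ! l) \<omega> $$ ab)"
        using conj_entry[OF g _ h indices_less(2)[OF I l] indices_less(1)[OF I l]] by (simp add: case_prod_beta)
    qed
    also have "\<dots> = (\<Sum>\<phi>\<in>{..<k} \<rightarrow>\<^sub>E {..<N} \<times> {..<N}. \<Prod>l<k.
        g $$ (I (Inr l), fst (\<phi> l)) * h $$ (snd (\<phi> l), I (Inl l)) * X (js ! l) \<omega> $$ \<phi> l)"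
      by (rule prod_sum_PiE) auto
    also have "\<dots> = (\<Sum>J\<in>indices k N. \<Prod>l<k.
        g $$ (I (Inr l), J (Inr l)) * h $$ (J (Inl l), I (Inl l)) * X (js ! l) \<omega> $$ (J (Inr l), J (Inl l)))"
    proof (rule sum.reindex_bij_witness[where
          i = "\<lambda>J. \<lambda>l\<in>{..<k}. (J (Inr l), J (Inl l))" and
          j = "\<lambda>\<phi>. \<lambda>x\<in>points k. case x of Inl l \<Rightarrow> snd (\<phi> l) | Inr l \<Rightarrow> fst (\<phi> l)"])
      fix \<phi> assume \<phi>: "\<phi> \<in> {..<k} \<rightarrow>\<^sub>E {..<N} \<times> {..<N}"
      show "(\<lambda>l\<in>{..<k}. ((\<lambda>x\<in>points k. case x of Inl l \<Rightarrow> snd (\<phi> l) | Inr l \<Rightarrow> fst (\<phi> l)) (Inr l),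
          (\<lambda>x\<in>points k. case x of Inl l \<Rightarrow> snd (\<phi> l) | Inr l \<Rightarrow> fst (\<phi> l)) (Inl l))) = \<phi>"
      proof
        fix l
        show "(\<lambda>l\<in>{..<k}. ((\<lambda>x\<in>points k. case x of Inl l \<Rightarrow> snd (\<phi> l) | Inr l \<Rightarrow> fst (\<phi> l)) (Inr l),
          (\<lambda>x\<in>points k. case x of Inl l \<Rightarrow> snd (\<phi> l) | Inr l \<Rightarrow> fst (\<phi> l)) (Inl l))) l = \<phi> l"
          using PiE_arb[OF \<phi>, of l] by (cases "l < k") simp_all
      qed
      have "(case x of Inl l \<Rightarrow> snd (\<phi> l) | Inr l \<Rightarrow> fst (\<phi> l)) < N" if "x \<in> points k" for x
        using that PiE_mem[OF \<phi>] by (cases x) (force simp: mem_Times_iff)+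
      then show "(\<lambda>x\<in>points k. case x of Inl l \<Rightarrow> snd (\<phi> l) | Inr l \<Rightarrow> fst (\<phi> l)) \<in> indices k N"
        by (intro restrict_PiE_iff[THEN iffD2]) simp
      show "(\<Prod>l<k. g $$ (I (Inr l), (\<lambda>x\<in>points k. case x of Inl l \<Rightarrow> snd (\<phi> l) | Inr l \<Rightarrow> fst (\<phi> l)) (Inr l)) *
          h $$ ((\<lambda>x\<in>points k. case x of Inl l \<Rightarrow> snd (\<phi> l) | Inr l \<Rightarrow> fst (\<phi> l)) (Inl l), I (Inl l)) *
          X (js ! l) \<omega> $$ ((\<lambda>x\<in>points k. case x of Inl l \<Rightarrow> snd (\<phi> l) | Inr l \<Rightarrow> fst (\<phi> l)) (Inr l),
            (\<lambda>x\<in>points k. case x of Inl l \<Rightarrow> snd (\<phi> l) | Inr l \<Rightarrow> fst (\<phi> l)) (Inl l)))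
        = (\<Prod>l<k. g $$ (I (Inr l), fst (\<phi> l)) * h $$ (snd (\<phi> l), I (Inl l)) * X (js ! l) \<omega> $$ \<phi> l)"
        by (intro prod.cong refl) simp
    next
      fix J assume J: "J \<in> indices k N"
      show "(\<lambda>l\<in>{..<k}. (J (Inr l), J (Inl l))) \<in> {..<k} \<rightarrow>\<^sub>E {..<N} \<times> {..<N}"
        using indices_less[OF J] by (intro restrict_PiE_iff[THEN iffD2]) simp
      show "(\<lambda>x\<in>points k. case x of Inl l \<Rightarrow> snd ((\<lambda>l\<in>{..<k}. (J (Inr l), J (Inl l))) l)
          | Inr l \<Rightarrow> fst ((\<lambda>l\<in>{..<k}. (J (Inr l), J (Inl l))) l)) = J"
      proof
        fix x
        show "(\<lambda>x\<in>points k. case x of Inl l \<Rightarrow> snd ((\<lambda>l\<in>{..<k}. (J (Inr l), J (Inl l))) l)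
          | Inr l \<Rightarrow> fst ((\<lambda>l\<in>{..<k}. (J (Inr l), J (Inl l))) l)) x = J x"
          using PiE_arb[OF J, of x] by (cases x) (simp_all split: if_splits)
      qed
    qed
    also have "\<dots> = (\<Sum>J\<in>indices k N. (\<Prod>x\<in>points k. leg g h x (I x) (J x)) *
        (\<Prod>l<k. X (js ! l) \<omega> $$ (J (Inr l), J (Inl l))))"
      by (simp add: prod_points leg_def prod.distrib)
    finally show ?thesis .
  qed
  then have "expected_entry \<Omega> (map (\<lambda>j \<omega>. g * X j \<omega> * h) js) I
    = (\<integral>\<omega>. (\<Sum>J\<in>indices k N. (\<Prod>x\<in>points k. leg g h x (I x) (J x)) *
        (\<Prod>l<k. X (js ! l) \<omega> $$ (J (Inr l), J (Inl l)))) \<partial>\<Omega>)"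
    using k by (simp add: expected_entry_map[OF k, of _ "\<lambda>j \<omega>. g * X j \<omega> * h"] cong: Bochner_Integration.integral_cong)
  also have "\<dots> = (\<Sum>J\<in>indices k N. (\<integral>\<omega>. (\<Prod>x\<in>points k. leg g h x (I x) (J x)) *
        (\<Prod>l<k. X (js ! l) \<omega> $$ (J (Inr l), J (Inl l))) \<partial>\<Omega>))"
  proof (rule Bochner_Integration.integral_sum)
    fix J assume J: "J \<in> indices k N"
    have "integrable \<Omega> (\<lambda>\<omega>. \<Prod>l<length (map X js). (map X js ! l) \<omega> $$ (J (Inr l), J (Inl l)))"
      using Xs indices_less[OF J] k by (intro integrable_entries[OF \<Omega>]) auto
    moreover have "(\<lambda>\<omega>. \<Prod>l<length (map X js). (map X js ! l) \<omega> $$ (J (Inr l), J (Inl l)))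
      = (\<lambda>\<omega>. \<Prod>l<k. X (js ! l) \<omega> $$ (J (Inr l), J (Inl l)))"
      using k by (intro ext prod.cong) auto
    ultimately have "integrable \<Omega> (\<lambda>\<omega>. \<Prod>l<k. X (js ! l) \<omega> $$ (J (Inr l), J (Inl l)))" by simp
    then show "integrable \<Omega> (\<lambda>\<omega>. (\<Prod>x\<in>points k. leg g h x (I x) (J x)) *
        (\<Prod>l<k. X (js ! l) \<omega> $$ (J (Inr l), J (Inl l))))"
      by (intro integrable_mult_right)
  qed
  also have "\<dots> = (\<Sum>J\<in>indices k N. (\<Prod>x\<in>points k. leg g h x (I x) (J x)) * expected_entry \<Omega> (map X js) J)"
    by (simp add: expected_entry_map k)
  finally show ?thesis .
qed

text \<open>An expected entry is the integral of a monomial against the joint law, so it does not change under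
  conjugation, whereas expanding the conjugated matrices gives the sum on the right.\<close>

lemma invariant_expected_entry:
  assumes \<Omega>: "prob_space \<Omega>" and Xs: "\<And>j. j \<in> J \<Longrightarrow> random_matrix \<Omega> N (X j)"
    and inv: "group_invariant A \<Omega> N J X" and js: "js \<in> lists J" and k: "length js = k"
    and g: "g \<in> matrix_group A N" "g \<in> carrier_mat N N" and h: "h \<in> carrier_mat N N"
    and gh: "g * h = 1\<^sub>m N" "h * g = 1\<^sub>m N" and I: "I \<in> indices k N"
  shows "expected_entry \<Omega> (map X js) I
    = (\<Sum>I'\<in>indices k N. (\<Prod>x\<in>points k. leg g h x (I x) (I' x)) * expected_entry \<Omega> (map X js) I')"
proof -
  have mem: "js ! l \<in> J" if "l < k" for l using js k that by auto
  have X: "random_matrix \<Omega> N (X j)" if "j \<in> set js" for j using js Xs that by auto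
  have car: "X j \<omega> \<in> carrier_mat N N" if "j \<in> J" "\<omega> \<in> space \<Omega>" for j \<omega>
    using Xs[OF that(1)] that(2) by (simp add: random_matrix_def)
  have meas: "(\<lambda>\<omega>. X j \<omega> $$ (a, b)) \<in> borel_measurable \<Omega>" if "j \<in> J" "a < N" "b < N" for j a b
    using Xs[OF that(1)] that(2,3) by (simp add: random_matrix_def)
  have meas': "(\<lambda>\<omega>. (g * X j \<omega> * h) $$ (a, b)) \<in> borel_measurable \<Omega>" if "j \<in> J" "a < N" "b < N" for j a b
  proof -
    have "(\<lambda>\<omega>. \<Sum>(a', b')\<in>{..<N} \<times> {..<N}. g $$ (a, a') * h $$ (b', b) * X j \<omega> $$ (a', b')) \<in> borel_measurable \<Omega>"
      unfolding case_prod_beta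
      by (intro borel_measurable_sum borel_measurable_times borel_measurable_const meas that) auto
    then show ?thesis
      by (subst measurable_cong[where g = "\<lambda>\<omega>. \<Sum>(a', b')\<in>{..<N} \<times> {..<N}. g $$ (a, a') * h $$ (b', b) * X j \<omega> $$ (a', b')"])
        (rule conj_entry[OF g(2) car[OF that(1)] h that(2,3)])
  qed
  have law: "joint_law \<Omega> N (map (\<lambda>j \<omega>. g * X j \<omega> * h) js) = joint_law \<Omega> N (map X js)"
    using inv g h gh js unfolding group_invariant_def inverts_mat_def by auto
  have "expected_entry \<Omega> (map X js) I
    = (\<integral>f. (\<Prod>l<k. f (l, I (Inr l), I (Inl l))) \<partial>joint_law \<Omega> N (map X js))"
    using expected_entry_joint_law[of "map X js" N \<Omega> I] meas mem k I by simp
  also have "\<dots> = expected_entry \<Omega> (map (\<lambda>j \<omega>. g * X j \<omega> * h) js) I"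
    using expected_entry_joint_law[of "map (\<lambda>j \<omega>. g * X j \<omega> * h) js" N \<Omega> I] meas' mem k I by (simp add: law)
  also have "\<dots> = (\<Sum>I'\<in>indices k N. (\<Prod>x\<in>points k. leg g h x (I x) (I' x)) * expected_entry \<Omega> (map X js) I')"
    by (rule expected_entry_conj[OF \<Omega> X k g(2) h I])
  finally show ?thesis .
qed

section \<open>Permutations, phases and reflections in the matrix groups\<close>

lemma mat_mult_entries:
  fixes A B :: "complex mat"
  assumes "A \<in> carrier_mat N N" "B \<in> carrier_mat N N"
    and "\<And>a b. a < N \<Longrightarrow> b < N \<Longrightarrow> (\<Sum>c<N. A $$ (a, c) * B $$ (c, b)) = of_bool (a = b)"
  shows "A * B = 1\<^sub>m N"
proof (rule eq_matI)
  fix a b assume "a < dim_row (1\<^sub>m N :: complex mat)" "b < dim_col (1\<^sub>m N :: complex mat)"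
  then have ab: "a < N" "b < N" by simp_all
  have "(A * B) $$ (a, b) = (\<Sum>c<N. A $$ (a, c) * B $$ (c, b))"
    using assms(1,2) ab by (simp add: scalar_prod_def atLeast0LessThan)
  then show "(A * B) $$ (a, b) = 1\<^sub>m N $$ (a, b)" using assms(3)[OF ab] ab by simp
qed (use assms in auto)

lemma mat_adjoint_entry:
  fixes A :: "complex mat"
  assumes "A \<in> carrier_mat N N" "a < N" "b < N"
  shows "mat_adjoint A $$ (a, b) = cnj (A $$ (b, a))"
  using assms by (simp add: mat_adjoint_def mat_of_rows_index)

lemma mat_adjoint_carrier:
  fixes A :: "complex mat"
  assumes "A \<in> carrier_mat N N"
  shows "mat_adjoint A \<in> carrier_mat N N"
  using assms unfolding mat_adjoint_def by auto

lemma orthogonal_groupI: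
  fixes f :: "nat \<Rightarrow> nat \<Rightarrow> complex" and N :: nat
  defines "g \<equiv> Matrix.mat N N (\<lambda>(a, b). f a b)"
  assumes real: "\<And>a b. a < N \<Longrightarrow> b < N \<Longrightarrow> f a b \<in> \<real>"
    and rows: "\<And>a b. a < N \<Longrightarrow> b < N \<Longrightarrow> (\<Sum>c<N. f a c * f b c) = of_bool (a = b)"
    and cols: "\<And>a b. a < N \<Longrightarrow> b < N \<Longrightarrow> (\<Sum>c<N. f c a * f c b) = of_bool (a = b)"
  shows "g * transpose_mat g = 1\<^sub>m N" "transpose_mat g * g = 1\<^sub>m N"
    "g \<in> orthogonal_group N" "g \<in> unitary_group N"
proof -
  have g: "g \<in> carrier_mat N N" by (simp add: g_def)
  show gt: "g * transpose_mat g = 1\<^sub>m N"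
    using g rows by (intro mat_mult_entries) (auto simp: g_def)
  show tg: "transpose_mat g * g = 1\<^sub>m N"
    using g cols by (intro mat_mult_entries) (auto simp: g_def)
  have "elements_mat g \<subseteq> \<real>"
  proof
    fix z assume "z \<in> elements_mat g"
    then obtain a b where "a < N" "b < N" "z = f a b" using g by (auto simp: g_def)
    then show "z \<in> \<real>" using real by simp
  qed
  then show "g \<in> orthogonal_group N" using g gt tg by (simp add: orthogonal_group_def)
  have "mat_adjoint g = transpose_mat g"
  proof (rule eq_matI)
    fix a b assume "a < dim_row (transpose_mat g)" "b < dim_col (transpose_mat g)"
    then have ab: "a < N" "b < N" using g by simp_all
    have "cnj (f b a) = f b a" using real[OF ab(2,1)] by (simp add: Reals_cnj_iff)
    then show "mat_adjoint g $$ (a, b) = transpose_mat g $$ (a, b)"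
      unfolding mat_adjoint_entry[OF g ab] using ab by (simp add: g_def)
  qed (use mat_adjoint_carrier[OF g] g in auto)
  then show "g \<in> unitary_group N" using g gt tg by (simp add: unitary_group_def)
qed

definition perm_mat :: "nat \<Rightarrow> (nat \<Rightarrow> nat) \<Rightarrow> complex mat" where
  "perm_mat N \<sigma> = Matrix.mat N N (\<lambda>(a, b). if a = \<sigma> b then 1 else 0)"

lemma perm_mat_sums:
  fixes N :: nat
  assumes \<sigma>: "\<sigma> permutes {..<N}" and ab: "a < N" "b < N"
  shows "(\<Sum>c<N. (if a = \<sigma> c then 1 else 0) * (if b = \<sigma> c then 1 else 0 :: complex)) = of_bool (a = b)"
    and "(\<Sum>c<N. (if c = \<sigma> a then 1 else 0) * (if c = \<sigma> b then 1 else 0 :: complex)) = of_bool (a = b)"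
    and "(\<Sum>c<N. (if a = \<sigma> c then 1 else 0 :: complex)) = 1"
    and "(\<Sum>c<N. (if c = \<sigma> a then 1 else 0 :: complex)) = 1"
proof -
  have bij: "bij_betw \<sigma> {..<N} {..<N}" using \<sigma> by (rule permutes_imp_bij)
  have lt: "\<sigma> a < N" "\<sigma> b < N" using permutes_in_image[OF \<sigma>] ab by auto
  have "(\<Sum>c<N. (if a = \<sigma> c then 1 else 0) * (if b = \<sigma> c then 1 else 0 :: complex))
    = (\<Sum>c<N. (if a = c then 1 else 0) * (if b = c then 1 else 0))"
    by (rule sum.reindex_bij_betw[OF bij])
  also have "\<dots> = (\<Sum>c<N. if a = c then of_bool (a = b) else 0)" by (intro sum.cong) auto
  finally show "(\<Sum>c<N. (if a = \<sigma> c then 1 else 0) * (if b = \<sigma> c then 1 else 0 :: complex)) = of_bool (a = b)"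
    using ab by simp
  have "(\<Sum>c<N. (if c = \<sigma> a then 1 else 0) * (if c = \<sigma> b then 1 else 0 :: complex))
    = (\<Sum>c<N. if c = \<sigma> a then of_bool (\<sigma> a = \<sigma> b) else 0)" by (intro sum.cong) auto
  then show "(\<Sum>c<N. (if c = \<sigma> a then 1 else 0) * (if c = \<sigma> b then 1 else 0 :: complex)) = of_bool (a = b)"
    using lt permutes_inj[OF \<sigma>] by (simp add: inj_eq)
  have "(\<Sum>c<N. (if a = \<sigma> c then 1 else 0 :: complex)) = (\<Sum>c<N. if a = c then 1 else 0)"
    by (rule sum.reindex_bij_betw[OF bij])
  then show "(\<Sum>c<N. (if a = \<sigma> c then 1 else 0 :: complex)) = 1" using ab by simp
  show "(\<Sum>c<N. (if c = \<sigma> a then 1 else 0 :: complex)) = 1" using lt by simp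
qed

lemma perm_mat_group:
  assumes \<sigma>: "\<sigma> permutes {..<N}"
  shows "perm_mat N \<sigma> \<in> matrix_group A N" "perm_mat N \<sigma> * transpose_mat (perm_mat N \<sigma>) = 1\<^sub>m N"
    "transpose_mat (perm_mat N \<sigma>) * perm_mat N \<sigma> = 1\<^sub>m N"
proof -
  note orth = orthogonal_groupI[of N "\<lambda>a b. if a = \<sigma> b then 1 else 0", folded perm_mat_def,
      OF _ perm_mat_sums(1)[OF \<sigma>] perm_mat_sums(2)[OF \<sigma>]]
  show "perm_mat N \<sigma> * transpose_mat (perm_mat N \<sigma>) = 1\<^sub>m N"
    "transpose_mat (perm_mat N \<sigma>) * perm_mat N \<sigma> = 1\<^sub>m N"
    by (rule orth; simp)+
  have O: "perm_mat N \<sigma> \<in> orthogonal_group N" and U: "perm_mat N \<sigma> \<in> unitary_group N"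
    by (rule orth; simp)+
  show "perm_mat N \<sigma> \<in> matrix_group A N"
  proof (cases A)
    case ClassBs
    then show ?thesis using O perm_mat_sums(3,4)[OF \<sigma>] by (simp add: perm_mat_def)
  next
    case ClassH
    then show ?thesis
      using \<sigma> by (auto simp: perm_mat_def intro!: exI[of _ \<sigma>] exI[of _ "\<lambda>_. 1 :: complex"])
  next
    case ClassP
    then show ?thesis using \<sigma> by (auto simp: perm_mat_def)
  qed (use O U in simp_all)
qed

definition diagonal :: "nat \<Rightarrow> (nat \<Rightarrow> complex) \<Rightarrow> complex mat" where
  "diagonal N v = Matrix.mat N N (\<lambda>(a, b). if a = b then v a else 0)"

lemma diagonal_carrier [simp]: "diagonal N v \<in> carrier_mat N N"
  by (simp add: diagonal_def)

lemma diagonal_mult: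
  assumes "\<And>a. a < N \<Longrightarrow> v a * w a = 1"
  shows "diagonal N v * diagonal N w = 1\<^sub>m N"
proof (rule mat_mult_entries)
  fix a b assume ab: "a < N" "b < N"
  have "(\<Sum>c<N. diagonal N v $$ (a, c) * diagonal N w $$ (c, b))
    = (\<Sum>c<N. if a = c then (if a = b then v a * w a else 0) else 0)"
    using ab by (intro sum.cong) (auto simp: diagonal_def)
  then show "(\<Sum>c<N. diagonal N v $$ (a, c) * diagonal N w $$ (c, b)) = of_bool (a = b)"
    using ab assms by simp
qed simp_all

lemma phase_diagonal_group:
  assumes A: "A \<in> {ClassS, ClassB, ClassH}"
  shows "diagonal N (\<lambda>x. if x = a then unit_phase A else 1) \<in> matrix_group A N" (is "diagonal N ?v \<in> _")
proof -
  have t: "transpose_mat (diagonal N v) = diagonal N v" for v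
    by (rule eq_matI) (auto simp: diagonal_def)
  have adj: "mat_adjoint (diagonal N v) = diagonal N (\<lambda>x. cnj (v x))" for v
    by (rule eq_matI) (use mat_adjoint_carrier[of "diagonal N v" N] mat_adjoint_entry[of "diagonal N v" N] in
        \<open>auto simp: diagonal_def\<close>)
  consider "A = ClassS" | "A = ClassB" | "A = ClassH" using A by auto
  then show ?thesis
  proof cases
    case 1
    then show ?thesis by (auto simp: unitary_group_def adj intro!: diagonal_mult)
  next
    case 2
    have "elements_mat (diagonal N ?v) \<subseteq> \<real>"
      using 2 by (auto simp: diagonal_def)
    moreover have "diagonal N ?v * diagonal N ?v = 1\<^sub>m N"
      using 2 by (intro diagonal_mult) simp
    ultimately show ?thesis using 2 by (simp add: orthogonal_group_def t)
  next
    case 3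
    have "diagonal N ?v = Matrix.mat N N (\<lambda>(x, y). if x = id y then ?v y else 0)"
      by (rule eq_matI) (auto simp: diagonal_def)
    moreover have "\<forall>b<N. ?v b \<in> {1, - 1}" using 3 by simp
    moreover have "id permutes {..<N}" by (rule permutes_id)
    ultimately show ?thesis
      unfolding 3 matrix_group.simps mem_Collect_eq
      by - (rule exI[of _ id], rule exI[of _ "\<lambda>x. if x = a then unit_phase ClassH else 1"], intro conjI)
  qed
qed

definition reflection_mat :: "nat \<Rightarrow> nat \<Rightarrow> nat \<Rightarrow> nat \<Rightarrow> nat \<Rightarrow> complex mat" where
  "reflection_mat N a b c d = Matrix.mat N N (\<lambda>(x, y). reflection a b c d x y)"

lemma reflection_mat_group:
  assumes A: "A \<in> {ClassS, ClassB, ClassBs}" and N: "distinct [a, b, c, d]" "a < N" "b < N" "c < N" "d < N"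
  shows "reflection_mat N a b c d \<in> matrix_group A N"
    "reflection_mat N a b c d * transpose_mat (reflection_mat N a b c d) = 1\<^sub>m N"
    "transpose_mat (reflection_mat N a b c d) * reflection_mat N a b c d = 1\<^sub>m N"
proof -
  let ?g = "reflection_mat N a b c d"
  have real: "reflection a b c d x y \<in> \<real>" for x y
    by (auto simp: reflection_def reflection_vector_def)
  have col: "(\<Sum>z<N. reflection a b c d z x * reflection a b c d z y) = of_bool (x = y)"
    if "x < N" "y < N" for x y
    using reflection_involution[OF N that] by (simp add: reflection_commute[of a b c d _ x] reflection_commute[of a b c d _ y])
  have colsum: "(\<Sum>y<N. reflection a b c d y x) = 1" if "x < N" for x
    using reflection_row_sum[OF N that] by (simp add: reflection_commute[of a b c d _ x])
  note orth = orthogonal_groupI[of N "reflection a b c d", folded reflection_mat_def,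
      OF real reflection_involution[OF N] col]
  show "?g * transpose_mat ?g = 1\<^sub>m N" "transpose_mat ?g * ?g = 1\<^sub>m N" by (rule orth; assumption)+
  have O: "?g \<in> orthogonal_group N" and U: "?g \<in> unitary_group N" by (rule orth; assumption)+
  consider "A = ClassS" | "A = ClassB" | "A = ClassBs" using A by auto
  then show "?g \<in> matrix_group A N"
  proof cases
    case 3
    then show ?thesis using O reflection_row_sum[OF N] colsum by (simp add: reflection_mat_def)
  qed (use O U in simp_all)
qed

text \<open>Two maps with the same kernel differ by a bijection between their images, which extends to a
  permutation of the finite codomain.\<close>

lemma permutes_extend:
  assumes S: "finite S" and f: "f ` A \<subseteq> S" and g: "g ` A \<subseteq> S"
    and fg: "\<And>x y. x \<in> A \<Longrightarrow> y \<in> A \<Longrightarrow> f x = f y \<longleftrightarrow> g x = g y"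
  shows "\<exists>\<sigma>. \<sigma> permutes S \<and> (\<forall>x\<in>A. f x = \<sigma> (g x))"
proof -
  define \<tau> where "\<tau> y = f (inv_into A g y)" for y
  have \<tau>: "\<tau> (g x) = f x" if "x \<in> A" for x
    using fg[OF inv_into_into[of "g x" g A] that] f_inv_into_f[of "g x" g A] that by (simp add: \<tau>_def)
  have bij1: "bij_betw \<tau> (g ` A) (f ` A)"
    unfolding bij_betw_def
  proof
    show "inj_on \<tau> (g ` A)"
    proof (rule inj_onI)
      fix u v assume "u \<in> g ` A" "v \<in> g ` A" and eq: "\<tau> u = \<tau> v"
      then obtain x y where x: "x \<in> A" "u = g x" and y: "y \<in> A" "v = g y" by blast
      have "f x = f y" using eq \<tau>[OF x(1)] \<tau>[OF y(1)] x(2) y(2) by simp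
      then show "u = v" using fg[OF x(1) y(1)] x(2) y(2) by simp
    qed
    show "\<tau> ` g ` A = f ` A" using \<tau> by (simp add: image_image)
  qed
  have "card (S - g ` A) = card (S - f ` A)"
    using bij_betw_same_card[OF bij1] S f g
    by (simp add: card_Diff_subset finite_subset)
  then obtain \<rho> where bij2: "bij_betw \<rho> (S - g ` A) (S - f ` A)"
    using finite_same_card_bij[of "S - g ` A" "S - f ` A"] S by auto
  define \<sigma> where "\<sigma> y = (if y \<in> g ` A then \<tau> y else if y \<in> S then \<rho> y else y)" for y
  have "bij_betw \<sigma> (g ` A) (f ` A)"
    using bij1 by (rule bij_betw_cong[THEN iffD1, rotated]) (simp add: \<sigma>_def)
  moreover have "bij_betw \<sigma> (S - g ` A) (S - f ` A)"
    using bij2 by (rule bij_betw_cong[THEN iffD1, rotated]) (simp add: \<sigma>_def)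
  ultimately have "bij_betw \<sigma> (g ` A \<union> (S - g ` A)) (f ` A \<union> (S - f ` A))"
    by (rule bij_betw_combine) auto
  then have "bij_betw \<sigma> S S" using f g by (simp add: Un_absorb1)
  then have "\<sigma> permutes S"
  proof (rule bij_imp_permutes)
    show "\<sigma> y = y" if "y \<notin> S" for y using that g by (auto simp: \<sigma>_def)
  qed
  moreover have "f x = \<sigma> (g x)" if "x \<in> A" for x using \<tau>[OF that] that by (simp add: \<sigma>_def)
  ultimately show ?thesis by blast
qed

lemma leg_transpose:
  assumes "g \<in> carrier_mat N N" "a < N" "b < N"
  shows "leg g (transpose_mat g) x a b = g $$ (a, b)"
  using assms by (cases x) (simp_all add: leg_def)

text \<open>A conjugation by a monomial matrix expresses an entry by a single other one.\<close>

lemma sum_single_index: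
  fixes E :: "(nat + nat \<Rightarrow> nat) \<Rightarrow> complex"
  assumes J: "J \<in> indices k N"
    and off: "\<And>I' x. I' \<in> indices k N \<Longrightarrow> x \<in> points k \<Longrightarrow> I' x \<noteq> J x \<Longrightarrow> w x (I' x) = 0"
  shows "(\<Sum>I'\<in>indices k N. (\<Prod>x\<in>points k. w x (I' x)) * E I') = (\<Prod>x\<in>points k. w x (J x)) * E J"
proof -
  have "(\<Sum>I'\<in>indices k N. (\<Prod>x\<in>points k. w x (I' x)) * E I')
    = (\<Sum>I'\<in>{J}. (\<Prod>x\<in>points k. w x (I' x)) * E I')"
  proof (rule sum.mono_neutral_right)
    show "\<forall>I'\<in>indices k N - {J}. (\<Prod>x\<in>points k. w x (I' x)) * E I' = 0"
    proof
      fix I' assume I': "I' \<in> indices k N - {J}"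
      then have "\<exists>x\<in>points k. I' x \<noteq> J x" using PiE_ext[of I' "points k" _ J] J by blast
      then have "(\<Prod>x\<in>points k. w x (I' x)) = 0" using off I' by (intro prod_zero) auto
      then show "(\<Prod>x\<in>points k. w x (I' x)) * E I' = 0" by simp
    qed
  qed (use J in \<open>auto intro!: finite_PiE\<close>)
  then show ?thesis by simp
qed

lemma expected_entry_tensor_invariant:
  assumes \<Omega>: "prob_space \<Omega>" and Xs: "\<And>j. j \<in> J \<Longrightarrow> random_matrix \<Omega> N (X j)"
    and inv: "group_invariant A \<Omega> N J X" and js: "js \<in> lists J" and k: "length js = k"
  shows "tensor_invariant A k N (expected_entry \<Omega> (map X js))" (is "tensor_invariant A k N ?E")
  unfolding tensor_invariant_def
proof (intro conjI impI)
  note conj = invariant_expected_entry[OF \<Omega> Xs inv js k]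
  have less: "I x < N" if "I \<in> indices k N" "x \<in> points k" for I x using PiE_mem[OF that] by simp
  show "kernel_invariant k N ?E"
    unfolding kernel_invariant_def
  proof (intro ballI impI)
    fix I I' assume I: "I \<in> indices k N" and I': "I' \<in> indices k N" and K: "Ker k I = Ker k I'"
    have "\<exists>\<sigma>. \<sigma> permutes {..<N} \<and> (\<forall>x\<in>points k. I x = \<sigma> (I' x))"
      by (rule permutes_extend) (use less I I' Ker_eqD[OF K] in auto)
    then obtain \<sigma> where \<sigma>: "\<sigma> permutes {..<N}" and eq: "\<And>x. x \<in> points k \<Longrightarrow> I x = \<sigma> (I' x)" by blast
    let ?g = "perm_mat N \<sigma>"
    have car: "?g \<in> carrier_mat N N" by (simp add: perm_mat_def)
    have leg: "leg ?g (transpose_mat ?g) x (I x) b = (if b = I' x then 1 else 0)"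
      if "x \<in> points k" "b < N" for x b
    proof -
      have "I x = \<sigma> b \<longleftrightarrow> b = I' x"
        unfolding eq[OF that(1)] using permutes_inj[OF \<sigma>] by (auto simp: inj_eq)
      then show ?thesis
        unfolding leg_transpose[OF car less[OF I that(1)] that(2)]
        using less[OF I that(1)] that(2) by (simp add: perm_mat_def)
    qed
    have "?E I = (\<Sum>I''\<in>indices k N. (\<Prod>x\<in>points k. leg ?g (transpose_mat ?g) x (I x) (I'' x)) * ?E I'')"
      by (rule conj[OF _ perm_mat_group(1)[OF \<sigma>] car _ perm_mat_group(2,3)[OF \<sigma>] I]) (use car in simp_all)
    also have "\<dots> = (\<Prod>x\<in>points k. leg ?g (transpose_mat ?g) x (I x) (I' x)) * ?E I'"
      by (rule sum_single_index[OF I']) (simp add: leg less)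
    also have "\<dots> = ?E I'" using leg less[OF I'] by simp
    finally show "?E I = ?E I'" .
  qed
  show "phase_invariant A k N ?E"
    unfolding phase_invariant_def
  proof (intro ballI allI impI)
    fix I a assume I: "I \<in> indices k N" and a: "a < N"
    show "?E I = (\<Prod>x\<in>{x \<in> points k. I x = a}. phase A x) * ?E I"
    proof (cases "A \<in> {ClassS, ClassB, ClassH}")
      case True
      let ?u = "unit_phase A"
      let ?g = "diagonal N (\<lambda>x. if x = a then ?u else 1)"
        and ?h = "diagonal N (\<lambda>x. if x = a then inverse ?u else 1)"
      have u: "?u \<noteq> 0" by (cases A) auto
      have leg: "leg ?g ?h x (I x) b = (if b = I x then (if I x = a then phase A x else 1) else 0)"
        if "x \<in> points k" "b < N" for x b
        using less[OF I that(1)] that(2) by (cases x) (auto simp: leg_def diagonal_def phase_def)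
      have "?E I = (\<Sum>I''\<in>indices k N. (\<Prod>x\<in>points k. leg ?g ?h x (I x) (I'' x)) * ?E I'')"
        by (rule conj[OF _ phase_diagonal_group[OF True] _ _ _ _ I]) (use u in \<open>auto intro!: diagonal_mult\<close>)
      also have "\<dots> = (\<Prod>x\<in>points k. leg ?g ?h x (I x) (I x)) * ?E I"
        by (rule sum_single_index[OF I]) (simp add: leg less)
      also have "(\<Prod>x\<in>points k. leg ?g ?h x (I x) (I x)) = (\<Prod>x\<in>points k. if I x = a then phase A x else 1)"
        using leg less[OF I] by (intro prod.cong) simp_all
      also have "\<dots> = (\<Prod>x\<in>{x \<in> points k. I x = a}. phase A x)" by (rule prod.inter_filter[symmetric]) simp
      finally show ?thesis .
    next
      case False
      then have "unit_phase A = 1" by (cases A) auto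
      then have "phase A x = 1" for x by (cases x) (simp_all add: phase_def)
      then show ?thesis by simp
    qed
  qed
  assume A: "A \<in> {ClassS, ClassB, ClassBs}"
  show "reflection_invariant k N ?E"
    unfolding reflection_invariant_def
  proof (intro allI impI ballI)
    fix a b c d I assume N: "a < N" "b < N" "c < N" "d < N" and dist: "distinct [a, b, c, d]"
      and I: "I \<in> indices k N"
    let ?g = "reflection_mat N a b c d"
    have car: "?g \<in> carrier_mat N N" by (simp add: reflection_mat_def)
    have "?E I = (\<Sum>I'\<in>indices k N. (\<Prod>x\<in>points k. leg ?g (transpose_mat ?g) x (I x) (I' x)) * ?E I')"
      by (rule conj[OF _ reflection_mat_group(1)[OF A dist N] car _ reflection_mat_group(2,3)[OF A dist N] I])
        (use car in simp_all)
    also have "\<dots> = (\<Sum>I'\<in>indices k N. (\<Prod>x\<in>points k. reflection a b c d (I x) (I' x)) * ?E I')"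
    proof (rule sum.cong[OF refl])
      fix I' assume I': "I' \<in> indices k N"
      have "(\<Prod>x\<in>points k. leg ?g (transpose_mat ?g) x (I x) (I' x))
        = (\<Prod>x\<in>points k. reflection a b c d (I x) (I' x))"
      proof (rule prod.cong[OF refl])
        fix x assume x: "x \<in> points k"
        show "leg ?g (transpose_mat ?g) x (I x) (I' x) = reflection a b c d (I x) (I' x)"
          unfolding leg_transpose[OF car less[OF I x] less[OF I' x]]
          using less[OF I x] less[OF I' x] by (simp add: reflection_mat_def)
      qed
      then show "(\<Prod>x\<in>points k. leg ?g (transpose_mat ?g) x (I x) (I' x)) * ?E I'
        = (\<Prod>x\<in>points k. reflection a b c d (I x) (I' x)) * ?E I'" by simp
    qed
    finally show "?E I = (\<Sum>I'\<in>indices k N. (\<Prod>x\<in>points k. reflection a b c d (I x) (I' x)) * ?E I')" .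
  qed
qed

section \<open>Asymptotics of the moments\<close>

lemma power_ratio_tendsto:
  assumes "e1 \<le> e2"
  shows "(\<lambda>N. of_nat N ^ e1 / of_nat N ^ e2 :: complex) \<longlonglongrightarrow> of_bool (e1 = e2)"
proof (cases "e1 = e2")
  case True
  have "eventually (\<lambda>N. 1 = (of_nat N ^ e1 / of_nat N ^ e2 :: complex)) sequentially"
    using eventually_gt_at_top[of 0] by eventually_elim (simp add: True)
  then show ?thesis using True tendsto_cong[THEN iffD1, OF _ tendsto_const[of "1 :: complex"]] by simp
next
  case False
  define e where "e = e2 - e1"
  have e: "e2 = e1 + e" "e > 0" using assms False by (auto simp: e_def)
  have "(\<lambda>N. inverse (of_nat N :: complex) ^ e) \<longlonglongrightarrow> 0 ^ e"
    by (intro tendsto_power lim_inverse_n)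
  then have lim: "(\<lambda>N. inverse (of_nat N :: complex) ^ e) \<longlonglongrightarrow> 0" unfolding zero_power[OF e(2)] .
  have "eventually (\<lambda>N. inverse (of_nat N :: complex) ^ e = of_nat N ^ e1 / of_nat N ^ e2) sequentially"
    using eventually_gt_at_top[of 0] by eventually_elim (simp add: e(1) power_add field_simps)
  then have "(\<lambda>N. of_nat N ^ e1 / of_nat N ^ e2 :: complex) \<longlonglongrightarrow> 0"
    by (rule tendsto_cong[THEN iffD1, OF _ lim])
  then show ?thesis using False by simp
qed

text \<open>The trace of \<open>\<rho>\<^sub>N(p) \<rho>\<^sub>N(\<^sup>tq)\<close>: it counts the common colourings of \<open>p\<close> and \<open>q\<close>.\<close>

lemma sum_part_tensor:
  assumes p: "p \<in> partitions k" and q: "q \<in> partitions k"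
  shows "(\<Sum>I\<in>colourings k {..<N} p. part_tensor q I) = of_nat N ^ nc (join k p q)"
proof -
  have fin: "finite (colourings k {..<N} p)" by (rule finite_colourings) simp
  have "(\<Sum>I\<in>colourings k {..<N} p. part_tensor q I)
    = (\<Sum>I\<in>{I \<in> colourings k {..<N} p. blockwise_const q I}. 1)"
    unfolding part_tensor_def by (subst sum.inter_filter[OF fin]) (intro sum.cong refl, simp)
  also have "{I \<in> colourings k {..<N} p. blockwise_const q I} = colourings k {..<N} (join k p q)"
    unfolding colourings_join[OF p q] by (auto simp: colourings_def)
  also have "(\<Sum>I\<in>colourings k {..<N} (join k p q). 1 :: complex) = of_nat (card (colourings k {..<N} (join k p q)))"
    by simp
  also have "\<dots> = of_nat N ^ nc (join k p q)"
    by (simp add: card_colourings[OF join_partitions(1)[OF p q]])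
  finally show ?thesis .
qed

lemma sum_geodesic:
  fixes f :: "part \<Rightarrow> complex"
  assumes "finite S"
  shows "(\<Sum>r\<in>{r \<in> S. geodesic_le k r q}. f r) = (\<Sum>r\<in>S. of_bool (geodesic_le k r q) * f r)"
  by (subst sum.inter_filter[OF assms]) (intro sum.cong refl, simp)

lemma geodesic_unitriangular:
  assumes "S \<subseteq> partitions k"
  shows "q \<in> S \<Longrightarrow> (of_bool (geodesic_le k q q) :: complex) = 1"
    and "q \<in> S \<Longrightarrow> r \<in> S \<Longrightarrow> (of_bool (geodesic_le k r q) :: complex) \<noteq> 0 \<Longrightarrow>
      r = q \<or> part_dist k (id_part k) r < part_dist k (id_part k) q"
  using assms geodesic_le_refl geodesic_le_rank[of r k q] by (auto split: if_splits)

text \<open>The normalization of a moment of \<open>p\<close> and the rescaling of the coefficients together leave powers of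
  \<open>N\<close> with exponent \<open>nc(q \<or> p) + nc(q \<or> id) - nc(p \<or> id) - nc(q) \<le> 0\<close>, which vanishes exactly when
  \<open>q \<le> p\<close>. The moments of the class thus form a small perturbation of a unitriangular system.\<close>

theorem moments_tendsto_cumulant_sums:
  fixes J :: "'i set" and \<Omega> :: "nat \<Rightarrow> 'w measure" and M :: "nat \<Rightarrow> 'i \<Rightarrow> 'w \<Rightarrow> complex mat"
  assumes prob: "\<And>N. N > 0 \<Longrightarrow> prob_space (\<Omega> N)"
    and random: "\<And>N j. N > 0 \<Longrightarrow> j \<in> J \<Longrightarrow> random_matrix (\<Omega> N) N (M N j)"
    and invariant: "\<And>N. N > 0 \<Longrightarrow> group_invariant A (\<Omega> N) N J (M N)"
    and convergent: "converges_in_distribution A \<Omega> J M"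
    and js: "js \<in> lists J" and k: "length js = k"
  shows "\<exists>\<kappa>. \<forall>p\<in>partitions k. (\<lambda>N. moment (\<Omega> N) N p (map (M N) js))
    \<longlonglongrightarrow> (\<Sum>q\<in>{q \<in> parts A k. geodesic_le k q p}. \<kappa> q)"
proof -
  let ?S = "parts A k" and ?id = "id_part k"
  define E where "E N = expected_entry (\<Omega> N) (map (M N) js)" for N
  define m where "m N p = moment (\<Omega> N) N p (map (M N) js)" for N p
  have "\<exists>c. \<forall>I\<in>indices k N. E N I = (\<Sum>q\<in>?S. c q * part_tensor q I)" if "2 * k + 3 \<le> N" for N
    unfolding E_def
    by (rule invariant_tensor_spanned[OF expected_entry_tensor_invariant[OF prob random invariant js k] that])
      (use that in auto)
  then obtain c where c: "\<And>N I. 2 * k + 3 \<le> N \<Longrightarrow> I \<in> indices k N \<Longrightarrow>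
      E N I = (\<Sum>q\<in>?S. c N q * part_tensor q I)" by metis
  define \<kappa> where "\<kappa> N q = c N q * of_nat N ^ nc q / of_nat N ^ nc (join k q ?id)" for N q
  define G where "G N p q = (of_nat N ^ (nc (join k q p) + nc (join k q ?id))
      / of_nat N ^ (nc (join k p ?id) + nc q) :: complex)" for N p q
  have m_eq: "m N p = (\<Sum>q\<in>?S. G N p q * \<kappa> N q)" if N: "2 * k + 3 \<le> N" and p: "p \<in> partitions k" for N p
  proof -
    have N0: "N > 0" using N by simp
    have "m N p = (\<Sum>I\<in>colourings k {..<N} p. E N I) / of_nat N ^ nc (join k p ?id)"
      unfolding m_def E_def
      by (rule moment_expand[OF prob[OF N0] _ _ p]) (use random[OF N0] js k in auto)
    also have "(\<Sum>I\<in>colourings k {..<N} p. E N I)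
      = (\<Sum>I\<in>colourings k {..<N} p. \<Sum>q\<in>?S. c N q * part_tensor q I)"
      by (intro sum.cong refl c[OF N]) (simp add: colourings_def)
    also have "\<dots> = (\<Sum>q\<in>?S. c N q * (\<Sum>I\<in>colourings k {..<N} p. part_tensor q I))"
      by (subst sum.swap) (simp add: sum_distrib_left)
    also have "\<dots> = (\<Sum>q\<in>?S. c N q * of_nat N ^ nc (join k q p))"
      using p by (intro sum.cong refl) (simp add: sum_part_tensor parts_partitions join_commute[of p k])
    also have "\<dots> / of_nat N ^ nc (join k p ?id) = (\<Sum>q\<in>?S. G N p q * \<kappa> N q)"
      unfolding sum_divide_distrib
      by (intro sum.cong refl) (use N0 in \<open>simp add: G_def \<kappa>_def power_add field_simps\<close>)
    finally show ?thesis .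
  qed
  have G_lim: "(\<lambda>N. G N p q) \<longlonglongrightarrow> of_bool (geodesic_le k q p)"
    if p: "p \<in> partitions k" and q: "q \<in> partitions k" for p q
    unfolding G_def geodesic_le_iff_nc[OF q p] by (rule power_ratio_tendsto[OF nc_join_id_le[OF q p]])
  have ev: "eventually (\<lambda>N. 2 * k + 3 \<le> N) sequentially" by (rule eventually_ge_at_top)
  have "\<exists>\<kappa>'. \<forall>q\<in>?S. (\<lambda>N. \<kappa> N q) \<longlonglongrightarrow> \<kappa>' q"
  proof (rule perturbed_unitriangular_convergent[where G = G and Z = "\<lambda>p q. of_bool (geodesic_le k q p)"
        and m = m and \<mu> = "\<lambda>p. lim (\<lambda>N. m N p)" and rank = "part_dist k ?id"])
    show "(of_bool (geodesic_le k q q) :: complex) = 1" if "q \<in> ?S" for q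
      using geodesic_unitriangular(1)[of ?S k q] that parts_partitions by blast
    show "r = q \<or> part_dist k ?id r < part_dist k ?id q"
      if "q \<in> ?S" "r \<in> ?S" "(of_bool (geodesic_le k r q) :: complex) \<noteq> 0" for q r
      using geodesic_unitriangular(2)[of ?S k q r] that parts_partitions by blast
    show "(\<lambda>N. G N q r) \<longlonglongrightarrow> of_bool (geodesic_le k r q)" if "q \<in> ?S" "r \<in> ?S" for q r
      using G_lim that parts_partitions by blast
    show "(\<lambda>N. m N q) \<longlonglongrightarrow> lim (\<lambda>N. m N q)" if "q \<in> ?S" for q
    proof -
      have "Topological_Spaces.convergent (\<lambda>N. m N q)"
        using convergent js k that unfolding converges_in_distribution_def m_def by blast
      then show ?thesis by (simp add: convergent_LIMSEQ_iff)
    qed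
    show "eventually (\<lambda>N. \<forall>q\<in>?S. m N q = (\<Sum>r\<in>?S. G N q r * \<kappa> N r)) sequentially"
      using ev by eventually_elim (intro ballI m_eq parts_partitions)
  qed simp
  then obtain \<kappa>' where \<kappa>': "\<And>q. q \<in> ?S \<Longrightarrow> (\<lambda>N. \<kappa> N q) \<longlonglongrightarrow> \<kappa>' q" by blast
  have "(\<lambda>N. m N p) \<longlonglongrightarrow> (\<Sum>q\<in>{q \<in> ?S. geodesic_le k q p}. \<kappa>' q)" if p: "p \<in> partitions k" for p
  proof -
    have "(\<lambda>N. \<Sum>q\<in>?S. G N p q * \<kappa> N q) \<longlonglongrightarrow> (\<Sum>q\<in>?S. of_bool (geodesic_le k q p) * \<kappa>' q)"
      by (intro tendsto_sum tendsto_mult G_lim p \<kappa>' parts_partitions)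
    moreover have "eventually (\<lambda>N. (\<Sum>q\<in>?S. G N p q * \<kappa> N q) = m N p) sequentially"
      using ev by eventually_elim (simp add: m_eq p)
    ultimately show ?thesis
      unfolding sum_geodesic[OF finite_parts] by (rule Lim_transform_eventually)
  qed
  then show ?thesis unfolding m_def by blast
qed

text \<open>A solution of the moment-cumulant relation is the family of cumulants, because the relation is
  unitriangular and so has no other solution.\<close>

lemma cumulant_eqI:
  assumes k: "length js = k"
    and sys: "\<And>q. q \<in> parts C k \<Longrightarrow>
      limit_moment \<Omega> X q js = (\<Sum>r\<in>{r \<in> parts C k. geodesic_le k r q}. \<kappa> r)"
    and p: "p \<in> parts C k"
  shows "cumulant C \<Omega> X p js = \<kappa> p"
proof -
  let ?S = "parts C k"
  let ?P = "\<lambda>\<kappa>. \<kappa> \<in> extensional ?S \<and>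
        (\<forall>q\<in>?S. limit_moment \<Omega> X q js = (\<Sum>r\<in>{r \<in> ?S. geodesic_le k r q}. \<kappa> r))"
  have sub: "?S \<subseteq> partitions k" using parts_partitions by blast
  have "(THE \<kappa>. ?P \<kappa>) = restrict \<kappa> ?S"
  proof (rule the_equality)
    show "?P (restrict \<kappa> ?S)" using sys by (auto intro!: sum.cong)
    fix \<kappa>' assume \<kappa>': "?P \<kappa>'"
    show "\<kappa>' = restrict \<kappa> ?S"
    proof (rule extensionalityI[of _ ?S])
      fix r assume r: "r \<in> ?S"
      have "\<kappa>' r = \<kappa> r"
      proof (rule unitriangular_unique[where Z = "\<lambda>q r. of_bool (geodesic_le k r q)"
            and rank = "part_dist k (id_part k)" and S = ?S])
        show "(\<Sum>r\<in>?S. of_bool (geodesic_le k r q) * \<kappa>' r) = (\<Sum>r\<in>?S. of_bool (geodesic_le k r q) * \<kappa> r)"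
          if "q \<in> ?S" for q
          using \<kappa>' sys[OF that] that by (simp add: sum_geodesic[OF finite_parts, symmetric])
      qed (use r geodesic_unitriangular[OF sub] in \<open>simp_all only: finite_parts\<close>)
      then show "\<kappa>' r = restrict \<kappa> ?S r" using r by simp
    qed (use \<kappa>' in simp_all)
  qed
  then show ?thesis using p by (simp add: cumulant_def Let_def k)
qed

text \<open>By the splitting of the ideal below a tensor product, the difference between the cumulants of
  tensor products and the products of cumulants solves a homogeneous unitriangular system indexed by
  pairs.\<close>

lemma cumulants_factorize:
  fixes \<kappa> \<kappa>1 \<kappa>2 :: "part \<Rightarrow> complex"
  assumes fact: "\<And>p q. p \<in> parts A k \<Longrightarrow> q \<in> parts A l \<Longrightarrow>
      (\<Sum>r\<in>{r \<in> parts A (k + l). geodesic_le (k + l) r (tensor_part k p q)}. \<kappa> r)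
      = (\<Sum>r\<in>{r \<in> parts A k. geodesic_le k r p}. \<kappa>1 r) * (\<Sum>r\<in>{r \<in> parts A l. geodesic_le l r q}. \<kappa>2 r)"
    and r: "r1 \<in> parts A k" "r2 \<in> parts A l"
  shows "\<kappa> (tensor_part k r1 r2) = \<kappa>1 r1 * \<kappa>2 r2"
proof -
  let ?S = "parts A k \<times> parts A l"
  define Z where "Z = (\<lambda>(p, q) (r, s). of_bool (geodesic_le k r p) * of_bool (geodesic_le l s q) :: complex)"
  define rank where "rank = (\<lambda>(r, s). part_dist k (id_part k) r + part_dist l (id_part l) s)"
  have "(\<lambda>(r, s). \<kappa> (tensor_part k r s)) (r1, r2) = (\<lambda>(r, s). \<kappa>1 r * \<kappa>2 s) (r1, r2)"
  proof (rule unitriangular_unique[where Z = Z and rank = rank and S = ?S])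
    show "Z pq pq = 1" if "pq \<in> ?S" for pq
      using that by (auto simp: Z_def geodesic_le_refl parts_partitions)
    show "rs = pq \<or> rank rs < rank pq" if "pq \<in> ?S" "rs \<in> ?S" "Z pq rs \<noteq> 0" for pq rs
    proof -
      obtain p q r s where eq: "pq = (p, q)" "rs = (r, s)" by (cases pq; cases rs)
      have mem: "p \<in> partitions k" "r \<in> partitions k" "q \<in> partitions l" "s \<in> partitions l"
        using that(1,2) parts_partitions unfolding eq by blast+
      have le: "geodesic_le k r p" "geodesic_le l s q" using that(3) by (auto simp: Z_def eq split: if_splits)
      have "r = p \<or> part_dist k (id_part k) r < part_dist k (id_part k) p"
        "s = q \<or> part_dist l (id_part l) s < part_dist l (id_part l) q"
        using geodesic_le_rank[OF mem(2,1) le(1)] geodesic_le_rank[OF mem(4,3) le(2)] by blast+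
      then show ?thesis by (auto simp: eq rank_def)
    qed
    show "(\<Sum>rs\<in>?S. Z pq rs * (\<lambda>(r, s). \<kappa> (tensor_part k r s)) rs)
      = (\<Sum>rs\<in>?S. Z pq rs * (\<lambda>(r, s). \<kappa>1 r * \<kappa>2 s) rs)" if "pq \<in> ?S" for pq
    proof -
      obtain p q where pq: "pq = (p, q)" by (cases pq)
      have p: "p \<in> parts A k" and q: "q \<in> parts A l" using that unfolding pq by blast+
      let ?L = "{r \<in> parts A k. geodesic_le k r p}" and ?R = "{s \<in> parts A l. geodesic_le l s q}"
      have restr: "(\<Sum>rs\<in>?S. Z pq rs * f rs) = (\<Sum>rs\<in>?L \<times> ?R. f rs)" for f
        by (rule sum.mono_neutral_cong_right) (auto simp: Z_def pq)
      have "(\<Sum>rs\<in>?S. Z pq rs * (\<lambda>(r, s). \<kappa> (tensor_part k r s)) rs)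
        = (\<Sum>rs\<in>?L \<times> ?R. \<kappa> ((\<lambda>(r, s). tensor_part k r s) rs))"
        unfolding restr by (intro sum.cong) auto
      also have "\<dots> = (\<Sum>r\<in>{r \<in> parts A (k + l). geodesic_le (k + l) r (tensor_part k p q)}. \<kappa> r)"
        by (rule sum.reindex_bij_betw[OF bij_betw_tensor_ideal[OF parts_partitions[OF p] parts_partitions[OF q]]])
      also have "\<dots> = (\<Sum>r\<in>?L. \<Sum>s\<in>?R. \<kappa>1 r * \<kappa>2 s)"
        unfolding fact[OF p q] by (rule sum_product)
      also have "\<dots> = (\<Sum>rs\<in>?S. Z pq rs * (\<lambda>(r, s). \<kappa>1 r * \<kappa>2 s) rs)"
        unfolding restr by (rule sum.cartesian_product)
      finally show ?thesis .
    qed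
  qed (use r in simp_all)
  then show ?thesis by simp
qed

theorem theorem4p3:
  fixes A :: part_class
    and J :: "'i set"
    and \<Omega> :: "nat \<Rightarrow> 'w measure"
    and M :: "nat \<Rightarrow> 'i \<Rightarrow> 'w \<Rightarrow> complex mat"
  assumes prob: "\<And>N. N > 0 \<Longrightarrow> prob_space (\<Omega> N)"
    and random: "\<And>N j. N > 0 \<Longrightarrow> j \<in> J \<Longrightarrow> random_matrix (\<Omega> N) N (M N j)"
    and invariant: "\<And>N. N > 0 \<Longrightarrow> group_invariant A (\<Omega> N) N J (M N)"
    and convergent: "converges_in_distribution A \<Omega> J M"
  shows "converges_in_distribution ClassP \<Omega> J M \<and>
    asymptotically_invariant A \<Omega> J M \<and>
    (factorization_property A \<Omega> J M \<longrightarrow> factorization_property ClassP \<Omega> J M)"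
proof -
  have "\<forall>js\<in>lists J. \<exists>\<kappa>. \<forall>p\<in>partitions (length js). (\<lambda>N. moment (\<Omega> N) N p (map (M N) js))
    \<longlonglongrightarrow> (\<Sum>q\<in>{q \<in> parts A (length js). geodesic_le (length js) q p}. \<kappa> q)"
    using moments_tendsto_cumulant_sums[OF prob random invariant convergent _ refl] by blast
  from bchoice[OF this] obtain \<kappa> where choice: "\<forall>js\<in>lists J. \<forall>p\<in>partitions (length js).
      (\<lambda>N. moment (\<Omega> N) N p (map (M N) js))
      \<longlonglongrightarrow> (\<Sum>q\<in>{q \<in> parts A (length js). geodesic_le (length js) q p}. \<kappa> js q)" ..
  have \<kappa>: "(\<lambda>N. moment (\<Omega> N) N p (map (M N) js))
      \<longlonglongrightarrow> (\<Sum>q\<in>{q \<in> parts A (length js). geodesic_le (length js) q p}. \<kappa> js q)"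
    if "js \<in> lists J" "p \<in> partitions (length js)" for js p
    using choice that by blast
  have lm: "limit_moment \<Omega> M p js = (\<Sum>q\<in>{q \<in> parts A (length js). geodesic_le (length js) q p}. \<kappa> js q)"
    if "js \<in> lists J" "p \<in> partitions (length js)" for js p
    unfolding limit_moment_def by (rule limI[OF \<kappa>[OF that]])
  have conv: "converges_in_distribution ClassP \<Omega> J M"
    unfolding converges_in_distribution_def parts.simps
    by (intro ballI convergentI[OF \<kappa>])
  moreover have "asymptotically_invariant A \<Omega> J M"
    unfolding asymptotically_invariant_def
  proof (intro conjI conv ballI)
    fix js p assume js: "js \<in> lists J" and p: "p \<in> partitions (length js)"
    let ?k = "length js"
    have "cumulant ClassP \<Omega> M p js = (if p \<in> parts A ?k then \<kappa> js p else 0)"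
    proof (rule cumulant_eqI[OF refl])
      fix q assume "q \<in> parts ClassP ?k"
      then have "limit_moment \<Omega> M q js = (\<Sum>r\<in>{r \<in> parts A ?k. geodesic_le ?k r q}. \<kappa> js r)"
        using lm[OF js] by simp
      also have "\<dots> = (\<Sum>r\<in>{r \<in> parts ClassP ?k. geodesic_le ?k r q}. if r \<in> parts A ?k then \<kappa> js r else 0)"
        by (rule sum.mono_neutral_cong_left) (auto simp: parts_partitions)
      finally show "limit_moment \<Omega> M q js
        = (\<Sum>r\<in>{r \<in> parts ClassP ?k. geodesic_le ?k r q}. if r \<in> parts A ?k then \<kappa> js r else 0)" .
    qed (use p in simp)
    moreover have "cumulant A \<Omega> M p js = \<kappa> js p" if "p \<in> parts A ?k"
      by (rule cumulant_eqI[OF refl _ that]) (rule lm[OF js parts_partitions])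
    ultimately show "cumulant ClassP \<Omega> M p js = (if p \<in> parts A ?k then cumulant A \<Omega> M p js else 0)"
      by simp
  qed
  moreover have "factorization_property ClassP \<Omega> J M" if fact: "factorization_property A \<Omega> J M"
    unfolding factorization_property_def parts.simps
  proof (intro ballI)
    fix us js p q assume us: "us \<in> lists J" and js: "js \<in> lists J"
      and p: "p \<in> partitions (length us)" and q: "q \<in> partitions (length js)"
    let ?k = "length us" and ?l = "length js"
    have app: "us @ js \<in> lists J" "length (us @ js) = ?k + ?l" using us js by auto
    have lm_tensor: "limit_moment \<Omega> M (tensor_part ?k p q) (us @ js)
      = (\<Sum>r\<in>{r \<in> parts A (?k + ?l). geodesic_le (?k + ?l) r (tensor_part ?k p q)}. \<kappa> (us @ js) r)"
      if "p \<in> partitions ?k" "q \<in> partitions ?l" for p q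
      using lm[OF app(1), of "tensor_part ?k p q"] tensor_partitions[OF that] by (simp add: app(2))
    have split: "\<kappa> (us @ js) (tensor_part ?k r s) = \<kappa> us r * \<kappa> js s"
      if "r \<in> parts A ?k" "s \<in> parts A ?l" for r s
    proof (rule cumulants_factorize[OF _ that])
      fix p q assume pq: "p \<in> parts A ?k" "q \<in> parts A ?l"
      then have "limit_moment \<Omega> M (tensor_part ?k p q) (us @ js)
        = limit_moment \<Omega> M p us * limit_moment \<Omega> M q js"
        using fact us js unfolding factorization_property_def by blast
      then show "(\<Sum>r\<in>{r \<in> parts A (?k + ?l). geodesic_le (?k + ?l) r (tensor_part ?k p q)}. \<kappa> (us @ js) r)
        = (\<Sum>r\<in>{r \<in> parts A ?k. geodesic_le ?k r p}. \<kappa> us r) * (\<Sum>r\<in>{r \<in> parts A ?l. geodesic_le ?l r q}. \<kappa> js r)"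
        using lm_tensor lm[OF us] lm[OF js] pq by (simp add: parts_partitions)
    qed
    let ?L = "{r \<in> parts A ?k. geodesic_le ?k r p}" and ?R = "{s \<in> parts A ?l. geodesic_le ?l s q}"
    have "limit_moment \<Omega> M (tensor_part ?k p q) (us @ js)
      = (\<Sum>rs\<in>?L \<times> ?R. \<kappa> (us @ js) ((\<lambda>(r, s). tensor_part ?k r s) rs))"
      unfolding lm_tensor[OF p q] by (rule sum.reindex_bij_betw[OF bij_betw_tensor_ideal[OF p q], symmetric])
    also have "\<dots> = (\<Sum>(r, s)\<in>?L \<times> ?R. \<kappa> us r * \<kappa> js s)"
      by (intro sum.cong) (auto simp: split)
    also have "\<dots> = (\<Sum>r\<in>?L. \<kappa> us r) * (\<Sum>s\<in>?R. \<kappa> js s)"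
      unfolding sum_product by (rule sum.cartesian_product[symmetric])
    also have "\<dots> = limit_moment \<Omega> M p us * limit_moment \<Omega> M q js"
      by (simp add: lm us js p q)
    finally show "limit_moment \<Omega> M (tensor_part ?k p q) (us @ js)
      = limit_moment \<Omega> M p us * limit_moment \<Omega> M q js" .
  qed
  ultimately show ?thesis by blast
qed

end
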